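(* Let $\kappa \le \infty$ be an uncountable regular cardinal, and let $\Phi = \Psi_\kappa$ be a $\kappa$-saturated class of $\kappa$-small presheaves, consisting of the $\kappa$-small presheaves in some saturated class $\Psi$. Then for any category $\mathcal{C}$ and presheaf $\phi : \mathcal{C}^{op} \to \mathrm{Set}$, the following are equivalent: (i) $\phi \in \Phi^*[\mathcal{C}] = (\Psi_\kappa)^*[\mathcal{C}]$, i.e., $\phi$ is an iterated $\kappa$-small $\Psi$-colimit of representables; (ii) $\phi$ is the left Kan extension, along the inclusion $\mathcal{D}^{op}\to\mathcal{C}^{op}$, of some $\psi \in \Phi[\mathcal{D}] = \Psi_\kappa[\mathcal{D}]$ for some $\kappa$-small subcategory $\mathcal{D} \subseteq \mathcal{C}$ (whence in particular, $\phi$ is a single $\kappa$-small $\Psi$-colimit of representables, namely the colimit of the diagram $y_{\mathcal{D}} \downarrow \psi \to \mathcal{D} \subseteq \mathcal{C} \xrightarrow{y_{\mathcal{C}}} [\mathcal{C}^{op}, \mathrm{Set}]$).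
   Context: Categories are locally small by default. $\infty$ denotes the bound on the fixed universe of small sets, so "$\infty$-small" means small; "$\kappa$-small" means of size $<\kappa$ (a category is $\kappa$-small if it has fewer than $\kappa$ morphisms). Subcategories are not required to be full. $y_{\mathcal{C}}$ is the Yoneda embedding and $y_{\mathcal{C}}\downarrow\phi$ is the category of elements of $\phi$. A presheaf is small-presented if it is a small colimit of representables. A $\kappa$-small presheaf is a presheaf $\phi : \mathcal{J}^{op} \to \mathrm{Set}$ such that $\mathcal{J}$ is a $\kappa$-small category and $\phi$ takes values in sets of size $<\kappa$. For a presheaf $\phi\in[\mathcal{J}^{op},\mathrm{Set}]$ and a diagram $F : \mathcal{J} \to \mathcal{A}$, the $\phi$-weighted colimit $\phi\star F$ is the colimit of $y_{\mathcal{J}}\downarrow\phi \to \mathcal{J} \xrightarrow{F} \mathcal{A}$. Let $\Phi$ be a class of small-presented presheaves on arbitrary categories. $\Phi[\mathcal{C}]$ denotes the full subcategory of $[\mathcal{C}^{op},\mathrm{Set}]$ on those presheaves on $\mathcal{C}$ belonging to $\Phi$. A $\Phi$-colimit is a colimit weighted by some $\phi\in\Phi$. The saturation $\Phi^*$ of $\Phi$ is the class with $\Phi^*[\mathcal{C}]$ the (replete) closure of the representables in $[\mathcal{C}^{op},\mathrm{Set}]$ under $\Phi$-colimits, for each $\mathcal{C}$; $\Phi$ is saturated if $\Phi=\Phi^*$. For any class $\Psi$ of small-presented presheaves, $\Psi_\kappa\subseteq\Psi$ is the class of $\kappa$-small presheaves in $\Psi$. A class $\Phi$ of $\kappa$-small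 presheaves is $\kappa$-saturated if $(\Phi^* )_\kappa=\Phi$; equivalently, $\Phi=\Psi_\kappa$ for some saturated class $\Psi$; equivalently, for all $\kappa$-small $\mathcal{C}$, $\Phi[\mathcal{C}]$ contains the representables and is closed under $\Phi$-colimits. A $\kappa$-small $\Psi$-colimit is a $\Psi_\kappa$-colimit. *)

theory Defs
  imports "HOL-Library.FuncSet"
begin

unbundle cardinal_syntax

section \<open>Categories, functors, natural transformations\<close>

record ('o, 'm) cat =
  Obj :: "'o set"
  Arr :: "'m set"
  Dom :: "'m \<Rightarrow> 'o"
  Cod :: "'m \<Rightarrow> 'o"
  Idn :: "'o \<Rightarrow> 'm"
  Cmp :: "'m \<Rightarrow> 'm \<Rightarrow> 'm"  \<comment> \<open>\<open>Cmp C g f\<close> is \<open>g\<close> after \<open>f\<close>\<close>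

definition hom :: "('o, 'm) cat \<Rightarrow> 'o \<Rightarrow> 'o \<Rightarrow> 'm set" where
  "hom C x y = {f \<in> Arr C. Dom C f = x \<and> Cod C f = y}"

locale category =
  fixes C :: "('o, 'm) cat"
  assumes Dom_in: "f \<in> Arr C \<Longrightarrow> Dom C f \<in> Obj C"
    and Cod_in: "f \<in> Arr C \<Longrightarrow> Cod C f \<in> Obj C"
    and Idn_in: "x \<in> Obj C \<Longrightarrow> Idn C x \<in> hom C x x"
    and Cmp_in: "f \<in> hom C x y \<Longrightarrow> g \<in> hom C y z \<Longrightarrow> Cmp C g f \<in> hom C x z"
    and Cmp_Idn_left: "f \<in> hom C x y \<Longrightarrow> Cmp C (Idn C y) f = f"
    and Cmp_Idn_right: "f \<in> hom C x y \<Longrightarrow> Cmp C f (Idn C x) = f"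
    and Cmp_assoc: "f \<in> hom C w x \<Longrightarrow> g \<in> hom C x y \<Longrightarrow> h \<in> hom C y z \<Longrightarrow>
      Cmp C h (Cmp C g f) = Cmp C (Cmp C h g) f"

definition op_cat :: "('o, 'm) cat \<Rightarrow> ('o, 'm) cat" where
  "op_cat C = \<lparr>Obj = Obj C, Arr = Arr C, Dom = Cod C, Cod = Dom C,
     Idn = Idn C, Cmp = (\<lambda>g f. Cmp C f g)\<rparr>"

definition isomorphic_in :: "('o, 'm) cat \<Rightarrow> 'o \<Rightarrow> 'o \<Rightarrow> bool" where
  "isomorphic_in C x y \<longleftrightarrow>
     (\<exists>f \<in> hom C x y. \<exists>g \<in> hom C y x. Cmp C g f = Idn C x \<and> Cmp C f g = Idn C y)"

text \<open>Subcategories are not required to be full.\<close>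

definition subcategory :: "('o, 'm) cat \<Rightarrow> ('o, 'm) cat \<Rightarrow> bool" where
  "subcategory D C \<longleftrightarrow> category D \<and> Obj D \<subseteq> Obj C \<and> Arr D \<subseteq> Arr C \<and>
     (\<forall>f \<in> Arr D. Dom D f = Dom C f \<and> Cod D f = Cod C f) \<and>
     (\<forall>x \<in> Obj D. Idn D x = Idn C x) \<and>
     (\<forall>f \<in> Arr D. \<forall>g \<in> Arr D. Cod D f = Dom D g \<longrightarrow> Cmp D g f = Cmp C g f)"

record ('o1, 'm1, 'o2, 'm2) ftor =
  On_obj :: "'o1 \<Rightarrow> 'o2"
  On_arr :: "'m1 \<Rightarrow> 'm2"

text \<open>Functors and natural transformations are \<^const>\<open>undefined\<close> outside their source category, so
  that two of them are equal in HOL exactly when they agree on objects and arrows.\<close>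

definition is_functor ::
  "('o1, 'm1) cat \<Rightarrow> ('o2, 'm2) cat \<Rightarrow> ('o1, 'm1, 'o2, 'm2) ftor \<Rightarrow> bool" where
  "is_functor A B F \<longleftrightarrow>
     On_obj F \<in> Obj A \<rightarrow>\<^sub>E Obj B \<and> On_arr F \<in> Arr A \<rightarrow>\<^sub>E Arr B \<and>
     (\<forall>f \<in> Arr A. On_arr F f \<in> hom B (On_obj F (Dom A f)) (On_obj F (Cod A f))) \<and>
     (\<forall>x \<in> Obj A. On_arr F (Idn A x) = Idn B (On_obj F x)) \<and>
     (\<forall>f \<in> Arr A. \<forall>g \<in> Arr A. Cod A f = Dom A g \<longrightarrow>
        On_arr F (Cmp A g f) = Cmp B (On_arr F g) (On_arr F f))"

definition comp_functor :: "('o1, 'm1) cat \<Rightarrow> ('o2, 'm2, 'o3, 'm3) ftor \<Rightarrow>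
    ('o1, 'm1, 'o2, 'm2) ftor \<Rightarrow> ('o1, 'm1, 'o3, 'm3) ftor" where
  "comp_functor A G F = \<lparr>On_obj = (\<lambda>x \<in> Obj A. On_obj G (On_obj F x)),
     On_arr = (\<lambda>f \<in> Arr A. On_arr G (On_arr F f))\<rparr>"

text \<open>For a subcategory \<open>D\<close> of \<open>C\<close>, \<open>incl_functor D\<close> is the inclusion into \<open>C\<close> and
  \<open>incl_functor (op_cat D)\<close> is the inclusion into \<open>op_cat C\<close>.\<close>

definition incl_functor :: "('o, 'm) cat \<Rightarrow> ('o, 'm, 'o, 'm) ftor" where
  "incl_functor D = \<lparr>On_obj = (\<lambda>x \<in> Obj D. x), On_arr = (\<lambda>f \<in> Arr D. f)\<rparr>"

type_synonym ('o1, 'm1, 'o2, 'm2) nat_trans =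
  "('o1, 'm1, 'o2, 'm2) ftor \<times> ('o1 \<Rightarrow> 'm2) \<times> ('o1, 'm1, 'o2, 'm2) ftor"

definition functor_cat :: "('o1, 'm1) cat \<Rightarrow> ('o2, 'm2) cat \<Rightarrow>
    (('o1, 'm1, 'o2, 'm2) ftor, ('o1, 'm1, 'o2, 'm2) nat_trans) cat" where
  "functor_cat A B = \<lparr>
     Obj = {F. is_functor A B F},
     Arr = {(F, \<eta>, G). is_functor A B F \<and> is_functor A B G \<and> \<eta> \<in> extensional (Obj A) \<and>
       (\<forall>x \<in> Obj A. \<eta> x \<in> hom B (On_obj F x) (On_obj G x)) \<and>
       (\<forall>f \<in> Arr A. Cmp B (On_arr G f) (\<eta> (Dom A f)) = Cmp B (\<eta> (Cod A f)) (On_arr F f))},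
     Dom = (\<lambda>(F, \<eta>, G). F),
     Cod = (\<lambda>(F, \<eta>, G). G),
     Idn = (\<lambda>F. (F, \<lambda>x \<in> Obj A. Idn B (On_obj F x), F)),
     Cmp = (\<lambda>(G', \<theta>, H) (F, \<eta>, G). (F, \<lambda>x \<in> Obj A. Cmp B (\<theta> x) (\<eta> x), H))\<rparr>"

text \<open>Whiskering of \<open>\<beta>\<close> with a functor \<open>K\<close> out of \<open>A\<close>.\<close>

definition whisker :: "('o1, 'm1) cat \<Rightarrow> ('o2, 'm2, 'o3, 'm3) nat_trans \<Rightarrow>
    ('o1, 'm1, 'o2, 'm2) ftor \<Rightarrow> ('o1, 'm1, 'o3, 'm3) nat_trans" where
  "whisker A = (\<lambda>(L, \<beta>, M) K.
     (comp_functor A L K, \<lambda>x \<in> Obj A. \<beta> (On_obj K x), comp_functor A M K))"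

text \<open>\<open>L : B \<rightarrow> E\<close> is a left Kan extension of \<open>F : A \<rightarrow> E\<close> along \<open>K : A \<rightarrow> B\<close>.\<close>

definition is_left_kan_extension :: "('o1, 'm1) cat \<Rightarrow> ('o2, 'm2) cat \<Rightarrow> ('o3, 'm3) cat \<Rightarrow>
    ('o1, 'm1, 'o2, 'm2) ftor \<Rightarrow> ('o1, 'm1, 'o3, 'm3) ftor \<Rightarrow> ('o2, 'm2, 'o3, 'm3) ftor \<Rightarrow> bool" where
  "is_left_kan_extension A B E K F L \<longleftrightarrow> is_functor B E L \<and>
     (\<exists>\<eta> \<in> hom (functor_cat A E) F (comp_functor A L K).
        \<forall>M \<alpha>. is_functor B E M \<and> \<alpha> \<in> hom (functor_cat A E) F (comp_functor A M K) \<longrightarrow>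
          (\<exists>!\<beta>. \<beta> \<in> hom (functor_cat B E) L M \<and>
                Cmp (functor_cat A E) (whisker A \<beta> K) \<eta> = \<alpha>))"


section \<open>Colimits\<close>

definition is_cocone :: "('oj, 'mj) cat \<Rightarrow> ('o, 'm) cat \<Rightarrow> ('oj, 'mj, 'o, 'm) ftor \<Rightarrow>
    'o \<Rightarrow> ('oj \<Rightarrow> 'm) \<Rightarrow> bool" where
  "is_cocone J A F a \<mu> \<longleftrightarrow> a \<in> Obj A \<and> (\<forall>j \<in> Obj J. \<mu> j \<in> hom A (On_obj F j) a) \<and>
     (\<forall>f \<in> Arr J. Cmp A (\<mu> (Cod J f)) (On_arr F f) = \<mu> (Dom J f))"

definition is_colimit :: "('oj, 'mj) cat \<Rightarrow> ('o, 'm) cat \<Rightarrow> ('oj, 'mj, 'o, 'm) ftor \<Rightarrow>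
    'o \<Rightarrow> bool" where
  "is_colimit J A F a \<longleftrightarrow> (\<exists>\<mu>. is_cocone J A F a \<mu> \<and>
     (\<forall>b \<nu>. is_cocone J A F b \<nu> \<longrightarrow>
        (\<exists>!h. h \<in> hom A a b \<and> (\<forall>j \<in> Obj J. Cmp A h (\<mu> j) = \<nu> j))))"


section \<open>Size, sets and presheaves\<close>

text \<open>The type \<open>'u\<close> hosts the objects and arrows of all the categories on which presheaves are
  considered, and the elements of all the values of those presheaves. The cardinal \<open>\<Omega> :: 'u rel\<close> is
  the bound on the small sets (written as infinity in the literature): a set is small iff it has
  fewer than \<open>\<Omega>\<close> elements. As \<open>\<Omega>\<close> lives on \<open>'u\<close>, there are at least \<open>\<Omega>\<close> elements of type \<open>'u\<close>,
  hence every small set has a copy in \<open>'u\<close>; categories may well have \<open>\<Omega>\<close> or more objects.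
  Of the universe bound only regularity is required, so that inaccessible cardinals are included.\<close>

type_synonym 'u set_arr = "'u set \<times> ('u \<Rightarrow> 'u) \<times> 'u set"
type_synonym 'u psh = "('u, 'u, 'u set, 'u set_arr) ftor"
type_synonym 'u psh_arr = "('u, 'u, 'u set, 'u set_arr) nat_trans"

text \<open>A class of presheaves on arbitrary categories, as a set of pairs of a category and a presheaf
  on it.\<close>

type_synonym 'u psh_class = "(('u, 'u) cat \<times> 'u psh) set"

definition regular_cardinal :: "'a rel \<Rightarrow> bool" where
  "regular_cardinal r \<longleftrightarrow> Cinfinite r \<and> regularCard r"

definition small_category :: "'k rel \<Rightarrow> ('o, 'm) cat \<Rightarrow> bool" where
  "small_category \<kappa> C \<longleftrightarrow> category C \<and> |Arr C| <o \<kappa>"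

definition locally_small :: "'u rel \<Rightarrow> ('o, 'm) cat \<Rightarrow> bool" where
  "locally_small \<Omega> C \<longleftrightarrow> category C \<and> (\<forall>x \<in> Obj C. \<forall>y \<in> Obj C. |hom C x y| <o \<Omega>)"

definition set_cat :: "'u rel \<Rightarrow> ('u set, 'u set_arr) cat" where
  "set_cat \<Omega> = \<lparr>
     Obj = {A. |A| <o \<Omega>},
     Arr = {(A, f, B). |A| <o \<Omega> \<and> |B| <o \<Omega> \<and> f \<in> A \<rightarrow>\<^sub>E B},
     Dom = (\<lambda>(A, f, B). A),
     Cod = (\<lambda>(A, f, B). B),
     Idn = (\<lambda>A. (A, \<lambda>x \<in> A. x, A)),
     Cmp = (\<lambda>(B', g, D) (A, f, B). (A, compose A g f, D))\<rparr>"

abbreviation presheaf :: "'u rel \<Rightarrow> ('u, 'u) cat \<Rightarrow> 'u psh \<Rightarrow> bool" where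
  "presheaf \<Omega> C \<phi> \<equiv> is_functor (op_cat C) (set_cat \<Omega>) \<phi>"

abbreviation psh_cat :: "'u rel \<Rightarrow> ('u, 'u) cat \<Rightarrow> ('u psh, 'u psh_arr) cat" where
  "psh_cat \<Omega> C \<equiv> functor_cat (op_cat C) (set_cat \<Omega>)"

text \<open>For \<open>f : x \<rightarrow> y\<close> in \<open>C\<close>, \<open>restriction \<phi> f\<close> is the function from \<open>\<phi> y\<close> to \<open>\<phi> x\<close>.\<close>

definition restriction :: "'u psh \<Rightarrow> 'u \<Rightarrow> 'u \<Rightarrow> 'u" where
  "restriction \<phi> f = fst (snd (On_arr \<phi> f))"

definition yoneda_obj :: "('u, 'u) cat \<Rightarrow> 'u \<Rightarrow> 'u psh" where
  "yoneda_obj C c = \<lparr>On_obj = (\<lambda>x \<in> Obj C. hom C x c),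
     On_arr = (\<lambda>f \<in> Arr C.
       (hom C (Cod C f) c, \<lambda>g \<in> hom C (Cod C f) c. Cmp C g f, hom C (Dom C f) c))\<rparr>"

definition yoneda :: "('u, 'u) cat \<Rightarrow> ('u, 'u, 'u psh, 'u psh_arr) ftor" where
  "yoneda C = \<lparr>On_obj = (\<lambda>c \<in> Obj C. yoneda_obj C c),
     On_arr = (\<lambda>h \<in> Arr C. (yoneda_obj C (Dom C h),
       \<lambda>x \<in> Obj C. (hom C x (Dom C h), \<lambda>g \<in> hom C x (Dom C h). Cmp C h g, hom C x (Cod C h)),
       yoneda_obj C (Cod C h)))\<rparr>"

definition elements_cat :: "('u, 'u) cat \<Rightarrow> 'u psh \<Rightarrow>
    ('u \<times> 'u, ('u \<times> 'u) \<times> 'u \<times> ('u \<times> 'u)) cat" where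
  "elements_cat J \<phi> = \<lparr>
     Obj = {(j, x). j \<in> Obj J \<and> x \<in> On_obj \<phi> j},
     Arr = {((j, x), f, (j', x')). x \<in> On_obj \<phi> j \<and> x' \<in> On_obj \<phi> j' \<and>
       f \<in> hom J j j' \<and> restriction \<phi> f x' = x},
     Dom = (\<lambda>(p, f, q). p),
     Cod = (\<lambda>(p, f, q). q),
     Idn = (\<lambda>p. (p, Idn J (fst p), p)),
     Cmp = (\<lambda>(q', g, r) (p, f, q). (p, Cmp J g f, r))\<rparr>"

definition elements_proj :: "('u, 'u) cat \<Rightarrow> 'u psh \<Rightarrow>
    ('u \<times> 'u, ('u \<times> 'u) \<times> 'u \<times> ('u \<times> 'u), 'u, 'u) ftor" where
  "elements_proj J \<phi> = \<lparr>On_obj = (\<lambda>p \<in> Obj (elements_cat J \<phi>). fst p),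
     On_arr = (\<lambda>h \<in> Arr (elements_cat J \<phi>). fst (snd h))\<rparr>"

definition is_weighted_colimit :: "('u, 'u) cat \<Rightarrow> ('o, 'm) cat \<Rightarrow> 'u psh \<Rightarrow>
    ('u, 'u, 'o, 'm) ftor \<Rightarrow> 'o \<Rightarrow> bool" where
  "is_weighted_colimit J A \<phi> F a \<longleftrightarrow>
     is_colimit (elements_cat J \<phi>) A
       (comp_functor (elements_cat J \<phi>) F (elements_proj J \<phi>)) a"


section \<open>Classes of presheaves and saturation\<close>

definition representable :: "'u rel \<Rightarrow> ('u, 'u) cat \<Rightarrow> 'u psh \<Rightarrow> bool" where
  "representable \<Omega> C \<phi> \<longleftrightarrow> (\<exists>c \<in> Obj C. isomorphic_in (psh_cat \<Omega> C) (yoneda_obj C c) \<phi>)"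

text \<open>Every small category is isomorphic to one with objects and arrows in \<open>'u\<close>, so it suffices to
  let the small index category \<open>I\<close> range over those.\<close>

definition small_presented :: "'u rel \<Rightarrow> ('u, 'u) cat \<Rightarrow> 'u psh \<Rightarrow> bool" where
  "small_presented \<Omega> C \<phi> \<longleftrightarrow> (\<exists>(I :: ('u, 'u) cat) F.
     small_category \<Omega> I \<and> is_functor I (psh_cat \<Omega> C) F \<and>
     (\<forall>i \<in> Obj I. representable \<Omega> C (On_obj F i)) \<and> is_colimit I (psh_cat \<Omega> C) F \<phi>)"

definition small_presented_class :: "'u rel \<Rightarrow> 'u psh_class \<Rightarrow> bool" where
  "small_presented_class \<Omega> \<Phi> \<longleftrightarrow>
     (\<forall>(C, \<phi>) \<in> \<Phi>. locally_small \<Omega> C \<and> presheaf \<Omega> C \<phi> \<and> small_presented \<Omega> C \<phi>)"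

definition members_on :: "'u psh_class \<Rightarrow> ('u, 'u) cat \<Rightarrow> 'u psh set" where
  "members_on \<Phi> C = {\<phi>. (C, \<phi>) \<in> \<Phi>}"

inductive_set colimit_closure :: "'u rel \<Rightarrow> 'u psh_class \<Rightarrow> ('u, 'u) cat \<Rightarrow> 'u psh set"
  for \<Omega> \<Phi> C where
  yoneda: "c \<in> Obj C \<Longrightarrow> yoneda_obj C c \<in> colimit_closure \<Omega> \<Phi> C"
| replete: "\<phi> \<in> colimit_closure \<Omega> \<Phi> C \<Longrightarrow> isomorphic_in (psh_cat \<Omega> C) \<phi> \<phi>' \<Longrightarrow>
    \<phi>' \<in> colimit_closure \<Omega> \<Phi> C"
| colimit: "\<omega> \<in> members_on \<Phi> J \<Longrightarrow> is_functor J (psh_cat \<Omega> C) F \<Longrightarrow>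
    (\<And>j. j \<in> Obj J \<Longrightarrow> On_obj F j \<in> colimit_closure \<Omega> \<Phi> C) \<Longrightarrow>
    is_weighted_colimit J (psh_cat \<Omega> C) \<omega> F \<phi> \<Longrightarrow>
    \<phi> \<in> colimit_closure \<Omega> \<Phi> C"

definition saturation :: "'u rel \<Rightarrow> 'u psh_class \<Rightarrow> 'u psh_class" where
  "saturation \<Omega> \<Phi> = {(C, \<phi>). locally_small \<Omega> C \<and> \<phi> \<in> colimit_closure \<Omega> \<Phi> C}"

definition saturated :: "'u rel \<Rightarrow> 'u psh_class \<Rightarrow> bool" where
  "saturated \<Omega> \<Phi> \<longleftrightarrow> small_presented_class \<Omega> \<Phi> \<and> \<Phi> = saturation \<Omega> \<Phi>"

definition small_presheaf :: "'k rel \<Rightarrow> ('u, 'u) cat \<Rightarrow> 'u psh \<Rightarrow> bool" where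
  "small_presheaf \<kappa> C \<phi> \<longleftrightarrow> small_category \<kappa> C \<and> (\<forall>c \<in> Obj C. |On_obj \<phi> c| <o \<kappa>)"

definition small_part :: "'k rel \<Rightarrow> 'u psh_class \<Rightarrow> 'u psh_class" where
  "small_part \<kappa> \<Psi> = {(C, \<phi>) \<in> \<Psi>. small_presheaf \<kappa> C \<phi>}"

definition kappa_saturated :: "'u rel \<Rightarrow> 'k rel \<Rightarrow> 'u psh_class \<Rightarrow> bool" where
  "kappa_saturated \<Omega> \<kappa> \<Phi> \<longleftrightarrow> small_presented_class \<Omega> \<Phi> \<and>
     (\<forall>(C, \<phi>) \<in> \<Phi>. small_presheaf \<kappa> C \<phi>) \<and> small_part \<kappa> (saturation \<Omega> \<Phi>) = \<Phi>"

end

theory Submission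
  imports Defs
begin

text \<open>
  Call a presheaf \<open>\<phi>\<close> on \<open>C\<close> generated by a presheaf \<open>\<psi>\<close> on a subcategory \<open>D\<close> if it is the left Kan
  extension of \<open>\<psi>\<close>. One direction is the Yoneda lemma: transformations from \<open>\<psi>\<close> to the restriction of
  \<open>M\<close> to \<open>D\<close> are the same as cocones with vertex \<open>M\<close> on the diagram of representables indexed by the
  elements of \<open>\<psi>\<close>, so a Kan extension of \<open>\<psi>\<close> is a \<open>\<psi>\<close>-weighted colimit of representables
  (\<open>left_kan_extension_imp_weighted_colimit\<close>), hence lies in the closure.

  For the other direction, the presheaves generated over \<open>\<kappa>\<close>-small subcategories by members of \<open>\<Phi>\<close>
  are shown to contain the representables and to be closed under isomorphism and \<open>\<Phi>\<close>-colimits. The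
  substance (\<open>kan_generated_colimit\<close>) is the colimit of a diagram \<open>F\<close> on \<open>J\<close> weighted by \<open>\<omega>\<close>, where \<open>F j\<close> is generated by \<open>\<psi> j\<close> on
  \<open>D j\<close>. Being generated has an elementary meaning (\<open>pointwise_lan\<close>): every element is a restriction of
  an element of \<open>\<psi>\<close>, and two such restrictions coincide only if a finite zigzag of arrows forces them
  to. Colimits have the same kind of description (\<open>pointwise_colimit\<close>). All these conditions ask for
  finitely many arrows of \<open>C\<close> at a time, and fewer than \<open>\<kappa>\<close> conditions arise at a time, so
  uncountability and regularity of \<open>\<kappa>\<close> give one \<open>\<kappa>\<close>-small subcategory \<open>E\<close> of \<open>C\<close> that contains every
  \<open>D j\<close> and is closed under all the witnesses (\<open>ex_small_witness_closed_subcategory\<close>).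

  Over such an \<open>E\<close> the whole diagram descends. The elements of \<open>F j\<close> that come from \<open>\<psi> j\<close> along arrows
  of \<open>E\<close> form a presheaf \<open>S j\<close> on \<open>E\<close>, which is the Kan extension of \<open>\<psi> j\<close> to \<open>E\<close>; these form a diagram
  on \<open>J\<close>; its \<open>\<omega>\<close>-weighted colimit is the union \<open>T\<close> of their images in the colimit \<open>\<phi>\<close>; and \<open>\<phi>\<close> is the
  Kan extension of \<open>T\<close> (the locale \<open>generated_diagram\<close>). So \<open>T\<close> is in the closure over \<open>E\<close>, it is
  \<open>\<kappa>\<close>-small, and therefore it belongs to \<open>\<Phi>\<close> because \<open>\<Phi>\<close> is \<open>\<kappa>\<close>-saturated.
\<close>

section \<open>Regular cardinals\<close>

lemma card_of_UN_less:
  assumes "regular_cardinal r" "|I| <o r" "\<And>i. i \<in> I \<Longrightarrow> |A i| <o r"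
  shows "|\<Union>i\<in>I. A i| <o r"
  using assms card_of_UNION_ordLess_infinite_Field_regularCard[of r I A]
  unfolding regular_cardinal_def by blast

lemma card_of_Sigma_less:
  assumes "regular_cardinal r" "|I| <o r" "\<And>i. i \<in> I \<Longrightarrow> |A i| <o r"
  shows "|Sigma I A| <o r"
proof -
  have "stable r"
    using assms(1) regularCard_stable unfolding regular_cardinal_def cinfinite_def by blast
  then show ?thesis using assms(2,3) stable_elim by blast
qed

lemma card_of_image_less: "|A| <o r \<Longrightarrow> |f ` A| <o r"
  using card_of_image ordLeq_ordLess_trans by blast

lemma card_of_subset_less: "|A| <o r \<Longrightarrow> B \<subseteq> A \<Longrightarrow> |B| <o r"
  using card_of_mono1 ordLeq_ordLess_trans by blast

lemma card_of_Field_regular: "regular_cardinal r \<Longrightarrow> |Field r| =o r"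
  unfolding regular_cardinal_def using card_of_Field_ordIso by blast

lemma card_of_finite_less:
  assumes "regular_cardinal r" "finite A"
  shows "|A| <o r"
proof -
  have "infinite (Field r)" using assms(1) unfolding regular_cardinal_def cinfinite_def by blast
  with assms(2) have "|A| <o |Field r|"
    by (intro finite_ordLess_infinite) (auto simp: card_of_well_order_on Field_card_of)
  then show ?thesis using card_of_Field_regular[OF assms(1)] ordLess_ordIso_trans by blast
qed

lemma card_of_Un_less:
  "regular_cardinal r \<Longrightarrow> |A| <o r \<Longrightarrow> |B| <o r \<Longrightarrow> |A \<union> B| <o r"
  unfolding regular_cardinal_def cinfinite_def
  using card_of_Un_ordLess_infinite_Field by blast

text \<open>This is where uncountability is used: closing off takes \<open>\<omega>\<close> many rounds, each of which
  preserves being small by regularity, and regularity bounds the union of the rounds as well,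
  because there are fewer than \<open>r\<close> of them.\<close>

lemma ex_small_closed_superset:
  assumes reg: "regular_cardinal r" and unc: "natLeq <o r"
    and A: "|A| <o r" and W: "\<And>a b. |W a b| <o r"
  shows "\<exists>X. A \<subseteq> X \<and> |X| <o r \<and> (\<forall>a\<in>X. \<forall>b\<in>X. W a b \<subseteq> X)"
proof -
  define X where "X = rec_nat A (\<lambda>_ Y. Y \<union> (\<Union>a\<in>Y. \<Union>b\<in>Y. W a b))"
  have X0: "X 0 = A" and XS: "X (Suc n) = X n \<union> (\<Union>a\<in>X n. \<Union>b\<in>X n. W a b)" for n
    by (simp_all add: X_def)
  have small: "|X n| <o r" for n
  proof (induction n)
    case 0 show ?case by (simp add: X0 A)
  next
    case (Suc n)
    show ?case unfolding XS by (intro card_of_Un_less card_of_UN_less reg Suc W)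
  qed
  have "|UNIV :: nat set| <o r"
    using unc card_of_nat ordIso_ordLess_trans by blast
  then have "|\<Union>n. X n| <o r" by (rule card_of_UN_less[OF reg]) (rule small)
  moreover have "W a b \<subseteq> (\<Union>n. X n)" if "a \<in> X n" "b \<in> X m" for a b n m
  proof -
    have mono: "X k \<subseteq> X l" if "k \<le> l" for k l
      using lift_Suc_mono_le[of X, OF _ that] XS by blast
    have "a \<in> X (max n m)" "b \<in> X (max n m)"
      using that mono[of n "max n m"] mono[of m "max n m"] by auto
    then have "W a b \<subseteq> X (Suc (max n m))" unfolding XS by blast
    then show ?thesis by blast
  qed
  ultimately show ?thesis using X0 by (intro exI[of _ "\<Union>n. X n"]) blast
qed

text \<open>The values of a presheaf are subsets of \<open>'u\<close>; this lets any small set serve as one.\<close>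

lemma ex_coding:
  fixes r :: "'u rel"
  assumes "regular_cardinal r" "|A| <o r"
  shows "\<exists>e :: 'a \<Rightarrow> 'u. inj_on e A"
proof -
  have "|A| \<le>o |Field r|"
    using assms(2) card_of_Field_regular[OF assms(1)]
    by (rule ordLeq_ordIso_trans[OF ordLess_imp_ordLeq ordIso_symmetric])
  then show ?thesis using card_of_ordLeq[of A "Field r"] by blast
qed


section \<open>Zigzags\<close>

text \<open>The smallest equivalence relation containing \<open>r\<close>. Equality in a colimit of sets and equality in
  a pointwise left Kan extension are both of this form.\<close>

definition zigzag :: "'a rel \<Rightarrow> 'a rel" where
  "zigzag r = (r \<union> r\<inverse>)\<^sup>*"

lemma zigzag_refl [simp]: "(a, a) \<in> zigzag r"
  by (simp add: zigzag_def)

lemma zigzag_step: "(a, b) \<in> r \<Longrightarrow> (a, b) \<in> zigzag r"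
  by (auto simp: zigzag_def)

lemma zigzag_sym: "(a, b) \<in> zigzag r \<Longrightarrow> (b, a) \<in> zigzag r"
  unfolding zigzag_def by (rule symD[OF sym_rtrancl[OF sym_Un_converse]])

lemma zigzag_trans [trans]: "(a, b) \<in> zigzag r \<Longrightarrow> (b, c) \<in> zigzag r \<Longrightarrow> (a, c) \<in> zigzag r"
  unfolding zigzag_def by (rule rtrancl_trans)

lemma zigzag_induct [consumes 1, case_names refl step unstep]:
  assumes "(a, b) \<in> zigzag r" and "P a"
    and "\<And>x y. (a, x) \<in> zigzag r \<Longrightarrow> (x, y) \<in> r \<Longrightarrow> P x \<Longrightarrow> P y"
    and "\<And>x y. (a, x) \<in> zigzag r \<Longrightarrow> (y, x) \<in> r \<Longrightarrow> P x \<Longrightarrow> P y"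
  shows "P b"
  using assms(1) unfolding zigzag_def
proof (induction rule: rtrancl_induct)
  case base show ?case by fact
next
  case (step y z)
  then show ?case using assms(3,4) unfolding zigzag_def by blast
qed

lemma zigzag_map:
  assumes "(a, b) \<in> zigzag r" and "\<And>x y. (x, y) \<in> r \<Longrightarrow> (f x, f y) \<in> zigzag s"
  shows "(f a, f b) \<in> zigzag s"
  using assms(1)
proof (induction rule: zigzag_induct)
  case (step x y)
  then show ?case using zigzag_trans assms(2) by metis
next
  case (unstep x y)
  then show ?case using zigzag_trans zigzag_sym assms(2) by metis
qed simp

lemma zigzag_mono: "(a, b) \<in> zigzag r \<Longrightarrow> r \<subseteq> s \<Longrightarrow> (a, b) \<in> zigzag s"
  unfolding zigzag_def by (rule rev_subsetD[OF _ rtrancl_mono]) auto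

lemma zigzag_invariant:
  assumes "(a, b) \<in> zigzag r" and "\<And>x y. (x, y) \<in> r \<Longrightarrow> f x = f y"
  shows "f a = f b"
  using assms(1) by (induction rule: zigzag_induct) (auto simp: assms(2))

text \<open>Only finitely many steps are used, so a single identification can be carried over to any
  subcategory containing finitely many suitable arrows.\<close>

lemma zigzag_finite_witness:
  assumes "(a, b) \<in> zigzag r"
  shows "\<exists>q. finite q \<and> q \<subseteq> r \<and> (a, b) \<in> zigzag q"
  using assms
proof (induction rule: zigzag_induct)
  case refl show ?case by (intro exI[of _ "{}"]) simp
next
  case (step x y)
  then obtain q where q: "finite q" "q \<subseteq> r" "(a, x) \<in> zigzag q" by blast
  have "(a, y) \<in> zigzag (insert (x, y) q)"
    by (meson zigzag_mono zigzag_step zigzag_trans insertI1 q(3) subset_insertI)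
  then show ?case using q step by (intro exI[of _ "insert (x, y) q"]) auto
next
  case (unstep x y)
  then obtain q where q: "finite q" "q \<subseteq> r" "(a, x) \<in> zigzag q" by blast
  have "(a, y) \<in> zigzag (insert (y, x) q)"
    by (meson zigzag_mono zigzag_step zigzag_sym zigzag_trans insertI1 q(3) subset_insertI)
  then show ?case using q unstep by (intro exI[of _ "insert (y, x) q"]) auto
qed

text \<open>The form in which finiteness is used: \<open>f\<close> extracts from a step the data that a subcategory must
  contain in order to perform that step. The premise is kept inside the quantifier so that one
  \<open>W\<close> can be chosen for every pair.\<close>

lemma zigzag_finite_image_witness:
  "\<exists>W. finite W \<and> ((a, b) \<in> zigzag r \<longrightarrow> (a, b) \<in> zigzag {x \<in> r. f x \<in> W})"
proof (cases "(a, b) \<in> zigzag r")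
  case True
  then obtain q where q: "finite q" "q \<subseteq> r" "(a, b) \<in> zigzag q"
    using zigzag_finite_witness[OF True] by (elim exE conjE)
  have "(a, b) \<in> zigzag {x \<in> r. f x \<in> f ` q}"
    by (rule zigzag_mono[OF q(3)]) (use q(2) in auto)
  then show ?thesis using q(1) by (intro exI[of _ "f ` q"]) simp
qed blast

text \<open>A quotient of a small set, realised on elements of \<open>'u\<close> by choosing a code for each class.\<close>

lemma ex_quotient_coding:
  fixes \<Omega> :: "'u rel" and r :: "'a rel"
  assumes "regular_cardinal \<Omega>" "|X| <o \<Omega>"
  shows "\<exists>q :: 'a \<Rightarrow> 'u. \<forall>a\<in>X. \<forall>b\<in>X. q a = q b \<longleftrightarrow> (a, b) \<in> zigzag r"
proof -
  have cls: "zigzag r `` {a} = zigzag r `` {b} \<longleftrightarrow> (a, b) \<in> zigzag r" for a b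
    by (auto dest: zigzag_sym zigzag_trans)
  have "|(\<lambda>a. zigzag r `` {a}) ` X| <o \<Omega>" using assms(2) by (rule card_of_image_less)
  then obtain e :: "'a set \<Rightarrow> 'u" where e: "inj_on e ((\<lambda>a. zigzag r `` {a}) ` X)"
    using ex_coding[OF assms(1)] by blast
  show ?thesis
    using e cls by (intro exI[of _ "\<lambda>a. e (zigzag r `` {a})"]) (metis (no_types, lifting) imageI inj_onD)
qed


section \<open>Presheaves and their transformations in terms of elements\<close>

lemma homI: "f \<in> Arr C \<Longrightarrow> Dom C f = x \<Longrightarrow> Cod C f = y \<Longrightarrow> f \<in> hom C x y"
  by (simp add: hom_def)

lemma homD: "f \<in> hom C x y \<Longrightarrow> f \<in> Arr C" "f \<in> hom C x y \<Longrightarrow> Dom C f = x"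
  "f \<in> hom C x y \<Longrightarrow> Cod C f = y"
  by (simp_all add: hom_def)

lemma op_cat_simps [simp]: "Obj (op_cat C) = Obj C" "Arr (op_cat C) = Arr C"
  "Dom (op_cat C) = Cod C" "Cod (op_cat C) = Dom C" "Idn (op_cat C) = Idn C"
  "Cmp (op_cat C) g f = Cmp C f g"
  by (simp_all add: op_cat_def)

lemma (in category) hom_Obj: "f \<in> hom C x y \<Longrightarrow> x \<in> Obj C" "f \<in> hom C x y \<Longrightarrow> y \<in> Obj C"
  using Dom_in Cod_in by (auto simp: hom_def)

lemma set_arr_hom_iff: "a \<in> hom (set_cat \<Omega>) A B \<longleftrightarrow>
    |A| <o \<Omega> \<and> |B| <o \<Omega> \<and> (\<exists>f. a = (A, f, B) \<and> f \<in> A \<rightarrow>\<^sub>E B)"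
  by (auto simp: hom_def set_cat_def)

definition mk_psh :: "('u, 'u) cat \<Rightarrow> ('u \<Rightarrow> 'u set) \<Rightarrow> ('u \<Rightarrow> 'u \<Rightarrow> 'u) \<Rightarrow> 'u psh" where
  "mk_psh C P r = \<lparr>On_obj = (\<lambda>c \<in> Obj C. P c),
     On_arr = (\<lambda>f \<in> Arr C. (P (Cod C f), \<lambda>a \<in> P (Cod C f). r f a, P (Dom C f)))\<rparr>"

lemma mk_psh_obj: "c \<in> Obj C \<Longrightarrow> On_obj (mk_psh C P r) c = P c"
  by (simp add: mk_psh_def)

lemma mk_psh_restriction:
  "f \<in> Arr C \<Longrightarrow> a \<in> P (Cod C f) \<Longrightarrow> restriction (mk_psh C P r) f a = r f a"
  by (simp add: mk_psh_def restriction_def)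

lemma presheaf_mk_psh:
  assumes C: "category C"
    and small: "\<And>c. c \<in> Obj C \<Longrightarrow> |P c| <o \<Omega>"
    and maps: "\<And>f x y a. f \<in> hom C x y \<Longrightarrow> a \<in> P y \<Longrightarrow> r f a \<in> P x"
    and idn: "\<And>c a. c \<in> Obj C \<Longrightarrow> a \<in> P c \<Longrightarrow> r (Idn C c) a = a"
    and cmp: "\<And>f g x y z a. f \<in> hom C x y \<Longrightarrow> g \<in> hom C y z \<Longrightarrow> a \<in> P z \<Longrightarrow>
      r (Cmp C g f) a = r f (r g a)"
  shows "presheaf \<Omega> C (mk_psh C P r)"
proof -
  interpret category C by fact
  have hm: "f \<in> hom C (Dom C f) (Cod C f)" if "f \<in> Arr C" for f
    using that by (simp add: hom_def)
  have 1: "On_arr (mk_psh C P r) f \<in> hom (set_cat \<Omega>) (P (Cod C f)) (P (Dom C f))" if "f \<in> Arr C" for f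
    using that small maps[OF hm] Dom_in Cod_in by (auto simp: set_arr_hom_iff mk_psh_def)
  have 2: "On_arr (mk_psh C P r) (Idn C x) = Idn (set_cat \<Omega>) (P x)" if "x \<in> Obj C" for x
    using Idn_in[OF that] idn[OF that]
    by (auto simp: mk_psh_def hom_def set_cat_def intro!: restrict_ext)
  have 3: "On_arr (mk_psh C P r) (Cmp C f g) =
      Cmp (set_cat \<Omega>) (On_arr (mk_psh C P r) g) (On_arr (mk_psh C P r) f)"
    if "f \<in> Arr C" "g \<in> Arr C" "Dom C f = Cod C g" for f g
  proof -
    have h: "g \<in> hom C (Dom C g) (Dom C f)" "f \<in> hom C (Dom C f) (Cod C f)"
      using that by (auto simp: hom_def)
    have "Cmp C f g \<in> hom C (Dom C g) (Cod C f)" by (rule Cmp_in[OF h])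
    then show ?thesis
      using cmp[OF h] maps[OF h(2)] that
      by (auto simp: mk_psh_def set_cat_def compose_def homD intro!: restrict_ext)
  qed
  have 4: "On_arr (mk_psh C P r) \<in> Arr C \<rightarrow>\<^sub>E Arr (set_cat \<Omega>)"
    using 1 by (auto simp: hom_def mk_psh_def)
  show ?thesis
    unfolding is_functor_def using 1 2 3 4 small Dom_in Cod_in
    by (auto simp: mk_psh_obj) (auto simp: mk_psh_def set_cat_def)
qed

text \<open>A presheaf unfolded into its values and restriction maps, free of the triples by which the category of sets
  encodes functions.\<close>

lemma presheaf_cat_dest:
  assumes "category C" "presheaf \<Omega> C \<phi>"
  shows presheaf_small: "c \<in> Obj C \<Longrightarrow> |On_obj \<phi> c| <o \<Omega>"
    and presheaf_arr: "f \<in> Arr C \<Longrightarrow> On_arr \<phi> f =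
      (On_obj \<phi> (Cod C f), restriction \<phi> f, On_obj \<phi> (Dom C f))"
    and restriction_in: "f \<in> hom C x y \<Longrightarrow> a \<in> On_obj \<phi> y \<Longrightarrow> restriction \<phi> f a \<in> On_obj \<phi> x"
    and restriction_Idn: "c \<in> Obj C \<Longrightarrow> a \<in> On_obj \<phi> c \<Longrightarrow> restriction \<phi> (Idn C c) a = a"
    and restriction_Cmp: "f \<in> hom C x y \<Longrightarrow> g \<in> hom C y z \<Longrightarrow> a \<in> On_obj \<phi> z \<Longrightarrow>
      restriction \<phi> (Cmp C g f) a = restriction \<phi> f (restriction \<phi> g a)"
proof -
  interpret category C by fact
  have F: "\<And>c. c \<in> Obj C \<Longrightarrow> On_obj \<phi> c \<in> Obj (set_cat \<Omega>)"
    "\<And>f. f \<in> Arr C \<Longrightarrow> On_arr \<phi> f \<in> hom (set_cat \<Omega>) (On_obj \<phi> (Cod C f)) (On_obj \<phi> (Dom C f))"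
    "\<And>x. x \<in> Obj C \<Longrightarrow> On_arr \<phi> (Idn C x) = Idn (set_cat \<Omega>) (On_obj \<phi> x)"
    "\<And>f g. f \<in> Arr C \<Longrightarrow> g \<in> Arr C \<Longrightarrow> Dom C f = Cod C g \<Longrightarrow>
      On_arr \<phi> (Cmp C f g) = Cmp (set_cat \<Omega>) (On_arr \<phi> g) (On_arr \<phi> f)"
    using assms(2) unfolding is_functor_def by auto
  show "c \<in> Obj C \<Longrightarrow> |On_obj \<phi> c| <o \<Omega>" using F(1) by (simp add: set_cat_def)
  show arr: "f \<in> Arr C \<Longrightarrow> On_arr \<phi> f =
      (On_obj \<phi> (Cod C f), restriction \<phi> f, On_obj \<phi> (Dom C f))" for f
    using F(2)[of f] by (auto simp: set_arr_hom_iff restriction_def)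
  show "f \<in> hom C x y \<Longrightarrow> a \<in> On_obj \<phi> y \<Longrightarrow> restriction \<phi> f a \<in> On_obj \<phi> x"
    using F(2)[OF homD(1)] arr[OF homD(1)] by (auto simp: set_arr_hom_iff homD)
  show "c \<in> Obj C \<Longrightarrow> a \<in> On_obj \<phi> c \<Longrightarrow> restriction \<phi> (Idn C c) a = a"
    using F(3)[of c] by (simp add: restriction_def set_cat_def)
  show "restriction \<phi> (Cmp C g f) a = restriction \<phi> f (restriction \<phi> g a)"
    if "f \<in> hom C x y" "g \<in> hom C y z" "a \<in> On_obj \<phi> z"
  proof -
    have "On_arr \<phi> (Cmp C g f) = Cmp (set_cat \<Omega>) (On_arr \<phi> f) (On_arr \<phi> g)"
      using F(4)[of g f] that(1,2) by (simp add: homD)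
    also have "\<dots> = (On_obj \<phi> z, compose (On_obj \<phi> z) (restriction \<phi> f) (restriction \<phi> g), On_obj \<phi> x)"
      unfolding arr[OF homD(1)[OF that(1)]] arr[OF homD(1)[OF that(2)]]
      using that(1,2) by (simp add: set_cat_def homD)
    finally show ?thesis using that(3) by (simp add: restriction_def[of _ "Cmp C g f"] compose_def)
  qed
qed

text \<open>The component functions of a transformation, stripped of the sources and targets that arrows of
  the category of sets carry.\<close>

definition nt_app :: "'u psh_arr \<Rightarrow> 'u \<Rightarrow> 'u \<Rightarrow> 'u" where
  "nt_app \<alpha> c = fst (snd (fst (snd \<alpha>) c))"

definition mk_nt :: "('u, 'u) cat \<Rightarrow> 'u psh \<Rightarrow> ('u \<Rightarrow> 'u \<Rightarrow> 'u) \<Rightarrow> 'u psh \<Rightarrow> 'u psh_arr" where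
  "mk_nt C F t G = (F, \<lambda>c \<in> Obj C. (On_obj F c, \<lambda>a \<in> On_obj F c. t c a, On_obj G c), G)"

lemma nt_app_mk: "c \<in> Obj C \<Longrightarrow> a \<in> On_obj F c \<Longrightarrow> nt_app (mk_nt C F t G) c a = t c a"
  by (simp add: nt_app_def mk_nt_def)

lemma psh_cat_Obj [simp]: "Obj (psh_cat \<Omega> C) = {F. presheaf \<Omega> C F}"
  by (simp add: functor_cat_def)

text \<open>A transformation is determined by its component functions. Equalities of arrows of
  presheaf categories are thereby checked on elements.\<close>

lemma psh_hom_iff:
  assumes C: "category C"
  shows "\<alpha> \<in> hom (psh_cat \<Omega> C) F G \<longleftrightarrow> presheaf \<Omega> C F \<and> presheaf \<Omega> C G \<and>
    \<alpha> = mk_nt C F (nt_app \<alpha>) G \<and>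
    (\<forall>c \<in> Obj C. \<forall>a \<in> On_obj F c. nt_app \<alpha> c a \<in> On_obj G c) \<and>
    (\<forall>f x y a. f \<in> hom C x y \<longrightarrow> a \<in> On_obj F y \<longrightarrow>
       nt_app \<alpha> x (restriction F f a) = restriction G f (nt_app \<alpha> y a))" (is "?l \<longleftrightarrow> ?r")
proof
  interpret category C by fact
  assume ?l
  then obtain t where al: "\<alpha> = (F, t, G)" and F: "presheaf \<Omega> C F" and G: "presheaf \<Omega> C G"
    and ext: "t \<in> extensional (Obj C)"
    and t: "\<And>x. x \<in> Obj C \<Longrightarrow> t x \<in> hom (set_cat \<Omega>) (On_obj F x) (On_obj G x)"
    and nat: "\<And>f. f \<in> Arr C \<Longrightarrow> Cmp (set_cat \<Omega>) (On_arr G f) (t (Cod C f)) =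
       Cmp (set_cat \<Omega>) (t (Dom C f)) (On_arr F f)"
    by (auto simp: hom_def functor_cat_def)
  have t1: "t x = (On_obj F x, nt_app \<alpha> x, On_obj G x)"
    and t2: "nt_app \<alpha> x \<in> On_obj F x \<rightarrow>\<^sub>E On_obj G x" if "x \<in> Obj C" for x
    using t[OF that] by (auto simp: set_arr_hom_iff al nt_app_def)
  have "\<alpha> = mk_nt C F (nt_app \<alpha>) G"
  proof -
    have "t x = (\<lambda>c \<in> Obj C. (On_obj F c, \<lambda>a \<in> On_obj F c. nt_app \<alpha> c a, On_obj G c)) x" for x
    proof (cases "x \<in> Obj C")
      case True
      then have "restrict (nt_app \<alpha> x) (On_obj F x) = nt_app \<alpha> x"
        by (rule PiE_restrict[OF t2])
      then show ?thesis using True t1[OF True] by simp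
    next
      case False
      then show ?thesis using ext by (simp add: extensional_def)
    qed
    then have "t = (\<lambda>c \<in> Obj C. (On_obj F c, \<lambda>a \<in> On_obj F c. nt_app \<alpha> c a, On_obj G c))" by blast
    then show ?thesis using al by (simp add: mk_nt_def)
  qed
  moreover have "nt_app \<alpha> x (restriction F f a) = restriction G f (nt_app \<alpha> y a)"
    if f: "f \<in> hom C x y" and a: "a \<in> On_obj F y" for f x y a
  proof -
    note xy = hom_Obj[OF f] and fD = homD[OF f]
    show ?thesis
      using nat[OF fD(1)] presheaf_arr[OF C F fD(1)] presheaf_arr[OF C G fD(1)] a t1 xy fD
      by (auto simp: set_cat_def compose_def restrict_def fun_eq_iff split: if_splits)
  qed
  ultimately show ?r using F G t2 by blast
next
  interpret category C by fact
  assume r: ?r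
  obtain s where eq: "\<alpha> = mk_nt C F s G" and s: "nt_app \<alpha> = s" using r by blast
  define t where "t = (\<lambda>c \<in> Obj C. (On_obj F c, \<lambda>a \<in> On_obj F c. s c a, On_obj G c))"
  have t: "t x = (On_obj F x, restrict (nt_app \<alpha> x) (On_obj F x), On_obj G x)" if "x \<in> Obj C" for x
    using that by (simp add: t_def s)
  have al: "\<alpha> = (F, t, G)" and ext: "t \<in> extensional (Obj C)"
    by (simp_all add: eq mk_nt_def t_def)
  have F: "presheaf \<Omega> C F" and G: "presheaf \<Omega> C G" using r by auto
  have "t x \<in> hom (set_cat \<Omega>) (On_obj F x) (On_obj G x)" if "x \<in> Obj C" for x
    using r presheaf_small[OF C F that] presheaf_small[OF C G that] that
    by (auto simp: t set_arr_hom_iff)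
  moreover have "Cmp (set_cat \<Omega>) (On_arr G f) (t (Cod C f)) =
       Cmp (set_cat \<Omega>) (t (Dom C f)) (On_arr F f)" if "f \<in> Arr C" for f
  proof -
    have f: "f \<in> hom C (Dom C f) (Cod C f)" using that by (simp add: hom_def)
    show ?thesis
      using r f hom_Obj[OF f] restriction_in[OF C F f]
      by (auto simp: presheaf_arr[OF C F that] presheaf_arr[OF C G that] t set_cat_def
          compose_def intro!: restrict_ext)
  qed
  ultimately show ?l
    using F G ext by (auto simp: al hom_def functor_cat_def)
qed

lemma psh_homD:
  assumes "category C" "\<alpha> \<in> hom (psh_cat \<Omega> C) F G"
  shows "presheaf \<Omega> C F" "presheaf \<Omega> C G"
    and "c \<in> Obj C \<Longrightarrow> a \<in> On_obj F c \<Longrightarrow> nt_app \<alpha> c a \<in> On_obj G c"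
    and "f \<in> hom C x y \<Longrightarrow> a \<in> On_obj F y \<Longrightarrow>
       nt_app \<alpha> x (restriction F f a) = restriction G f (nt_app \<alpha> y a)"
  using assms(2) unfolding psh_hom_iff[OF assms(1)] by auto

lemma mk_nt_hom:
  assumes C: "category C" and "presheaf \<Omega> C F" "presheaf \<Omega> C G"
    and t: "\<And>c a. c \<in> Obj C \<Longrightarrow> a \<in> On_obj F c \<Longrightarrow> t c a \<in> On_obj G c"
    and nat: "\<And>f x y a. f \<in> hom C x y \<Longrightarrow> a \<in> On_obj F y \<Longrightarrow>
       t x (restriction F f a) = restriction G f (t y a)"
  shows "mk_nt C F t G \<in> hom (psh_cat \<Omega> C) F G"
proof -
  interpret category C by fact
  have "mk_nt C F t G = mk_nt C F (nt_app (mk_nt C F t G)) G"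
    by (auto simp: mk_nt_def nt_app_def fun_eq_iff restrict_def)
  moreover have "nt_app (mk_nt C F t G) x (restriction F f a) =
      restriction G f (nt_app (mk_nt C F t G) y a)"
    if "f \<in> hom C x y" "a \<in> On_obj F y" for f x y a
    using that hom_Obj[OF that(1)] restriction_in[OF C assms(2) that] nat[OF that]
    by (simp add: nt_app_mk)
  ultimately show ?thesis
    unfolding psh_hom_iff[OF C] using assms by (simp add: nt_app_mk)
qed

lemma psh_hom_eqI:
  assumes C: "category C" and "\<alpha> \<in> hom (psh_cat \<Omega> C) F G" "\<beta> \<in> hom (psh_cat \<Omega> C) F G"
    and "\<And>c a. c \<in> Obj C \<Longrightarrow> a \<in> On_obj F c \<Longrightarrow> nt_app \<alpha> c a = nt_app \<beta> c a"
  shows "\<alpha> = \<beta>"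
proof -
  have "\<alpha> = mk_nt C F (nt_app \<alpha>) G" "\<beta> = mk_nt C F (nt_app \<beta>) G"
    using assms(2,3) unfolding psh_hom_iff[OF C] by blast+
  moreover have "mk_nt C F (nt_app \<alpha>) G = mk_nt C F (nt_app \<beta>) G"
    unfolding mk_nt_def using assms(4) by (auto intro!: restrict_ext)
  ultimately show ?thesis by simp
qed

lemma nt_app_Idn: "c \<in> Obj C \<Longrightarrow> a \<in> On_obj F c \<Longrightarrow> nt_app (Idn (psh_cat \<Omega> C) F) c a = a"
  by (simp add: nt_app_def functor_cat_def set_cat_def)

lemma nt_app_Cmp:
  assumes C: "category C" and al: "\<alpha> \<in> hom (psh_cat \<Omega> C) F G" and be: "\<beta> \<in> hom (psh_cat \<Omega> C) G H"
    and "c \<in> Obj C" "a \<in> On_obj F c"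
  shows "nt_app (Cmp (psh_cat \<Omega> C) \<beta> \<alpha>) c a = nt_app \<beta> c (nt_app \<alpha> c a)"
proof -
  obtain t where a: "\<alpha> = mk_nt C F t G" "t = nt_app \<alpha>" using al unfolding psh_hom_iff[OF C] by blast
  obtain s where b: "\<beta> = mk_nt C G s H" "s = nt_app \<beta>" using be unfolding psh_hom_iff[OF C] by blast
  show ?thesis
    unfolding a(2)[symmetric] b(2)[symmetric] unfolding a(1) b(1)
    using assms(4,5) psh_homD(3)[OF C al assms(4,5)] a(2)
    by (auto simp: mk_nt_def functor_cat_def set_cat_def compose_def nt_app_def)
qed

lemma Cmp_psh_hom:
  assumes C: "category C" and al: "\<alpha> \<in> hom (psh_cat \<Omega> C) F G" and be: "\<beta> \<in> hom (psh_cat \<Omega> C) G H"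
  shows "Cmp (psh_cat \<Omega> C) \<beta> \<alpha> \<in> hom (psh_cat \<Omega> C) F H"
proof -
  interpret category C by fact
  obtain t where a: "\<alpha> = mk_nt C F t G" "t = nt_app \<alpha>" using al unfolding psh_hom_iff[OF C] by blast
  obtain s where b: "\<beta> = mk_nt C G s H" "s = nt_app \<beta>" using be unfolding psh_hom_iff[OF C] by blast
  have "Cmp (psh_cat \<Omega> C) \<beta> \<alpha> = mk_nt C F (\<lambda>c x. s c (t c x)) H"
    using psh_homD(3)[OF C al] a(2) unfolding a(1) b(1)
    by (auto simp: mk_nt_def functor_cat_def set_cat_def compose_def intro!: restrict_ext)
  also have "\<dots> \<in> hom (psh_cat \<Omega> C) F H"
    using psh_homD[OF C al] psh_homD[OF C be] a(2) b(2)
    by (intro mk_nt_hom C) (simp_all add: hom_Obj)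
  finally show ?thesis .
qed

lemma Idn_psh_hom: "category C \<Longrightarrow> presheaf \<Omega> C F \<Longrightarrow> Idn (psh_cat \<Omega> C) F \<in> hom (psh_cat \<Omega> C) F F"
proof -
  assume C: "category C" and F: "presheaf \<Omega> C F"
  have "Idn (psh_cat \<Omega> C) F = mk_nt C F (\<lambda>c a. a) F"
    by (simp add: functor_cat_def mk_nt_def set_cat_def restrict_def)
  then show ?thesis using mk_nt_hom[OF C F F, of "\<lambda>c a. a"] by simp
qed


section \<open>Restriction to a subcategory\<close>

abbreviation psh_restrict :: "('u, 'u) cat \<Rightarrow> 'u psh \<Rightarrow> 'u psh" where
  "psh_restrict D \<phi> \<equiv> comp_functor (op_cat D) \<phi> (incl_functor (op_cat D))"

lemma psh_restrict_simps [simp]: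
  "d \<in> Obj D \<Longrightarrow> On_obj (psh_restrict D \<phi>) d = On_obj \<phi> d"
  "u \<in> Arr D \<Longrightarrow> restriction (psh_restrict D \<phi>) u = restriction \<phi> u"
  by (simp_all add: comp_functor_def incl_functor_def restriction_def)

lemma subcategoryD:
  assumes "subcategory D C"
  shows "category D" "d \<in> Obj D \<Longrightarrow> d \<in> Obj C" "u \<in> hom D x y \<Longrightarrow> u \<in> hom C x y"
    "d \<in> Obj D \<Longrightarrow> Idn D d = Idn C d"
    "u \<in> hom D x y \<Longrightarrow> v \<in> hom D y z \<Longrightarrow> Cmp D v u = Cmp C v u"
  using assms unfolding subcategory_def hom_def by auto

lemma presheaf_psh_restrict:
  assumes C: "category C" and sub: "subcategory D C" and F: "presheaf \<Omega> C \<phi>"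
  shows "presheaf \<Omega> D (psh_restrict D \<phi>)"
proof -
  interpret D: category D using subcategoryD(1)[OF sub] .
  have a: "u \<in> Arr D \<Longrightarrow> u \<in> Arr C \<and> Dom D u = Dom C u \<and> Cod D u = Cod C u" for u
    using sub unfolding subcategory_def by auto
  have o: "d \<in> Obj D \<Longrightarrow> d \<in> Obj C" for d using subcategoryD(2)[OF sub] .
  have F': "\<And>c. c \<in> Obj C \<Longrightarrow> On_obj \<phi> c \<in> Obj (set_cat \<Omega>)"
    "\<And>f. f \<in> Arr C \<Longrightarrow> On_arr \<phi> f \<in> hom (set_cat \<Omega>) (On_obj \<phi> (Cod C f)) (On_obj \<phi> (Dom C f))"
    "\<And>x. x \<in> Obj C \<Longrightarrow> On_arr \<phi> (Idn C x) = Idn (set_cat \<Omega>) (On_obj \<phi> x)"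
    "\<And>f g. f \<in> Arr C \<Longrightarrow> g \<in> Arr C \<Longrightarrow> Dom C f = Cod C g \<Longrightarrow>
      On_arr \<phi> (Cmp C f g) = Cmp (set_cat \<Omega>) (On_arr \<phi> g) (On_arr \<phi> f)"
    using F unfolding is_functor_def by auto
  have id: "Idn D d \<in> Arr D \<and> Idn D d = Idn C d" if "d \<in> Obj D" for d
    using D.Idn_in[OF that] subcategoryD(4)[OF sub that] by (simp add: hom_def)
  have cmp: "Cmp D f g \<in> Arr D \<and> Cmp D f g = Cmp C f g"
    if "f \<in> Arr D" "g \<in> Arr D" "Dom D f = Cod D g" for f g
    using D.Cmp_in[of g "Dom D g" "Cod D g" f "Cod D f"] that sub
    unfolding subcategory_def by (simp add: hom_def)
  let ?R = "psh_restrict D \<phi>"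
  have 1: "On_obj ?R d = On_obj \<phi> d" if "d \<in> Obj D" for d using that by simp
  have 2: "On_arr ?R u = On_arr \<phi> u" if "u \<in> Arr D" for u
    using that by (simp add: comp_functor_def incl_functor_def)
  have 3: "On_arr ?R (Idn D d) = Idn (set_cat \<Omega>) (On_obj ?R d)" if "d \<in> Obj D" for d
    using id[OF that] 2[of "Idn D d"] 1[OF that] F'(3)[OF o[OF that]] by metis
  have 4: "On_arr ?R (Cmp D f g) = Cmp (set_cat \<Omega>) (On_arr ?R g) (On_arr ?R f)"
    if "f \<in> Arr D" "g \<in> Arr D" "Dom D f = Cod D g" for f g
    using cmp[OF that] 2[of "Cmp D f g"] 2[OF that(1)] 2[OF that(2)] F'(4)[of f g] a[OF that(1)]
      a[OF that(2)] that(3) by metis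
  have 5: "On_arr ?R u \<in> hom (set_cat \<Omega>) (On_obj ?R (Cod D u)) (On_obj ?R (Dom D u))"
    if "u \<in> Arr D" for u
    using F'(2)[of u] a[OF that] that D.Dom_in[OF that] D.Cod_in[OF that] 2[OF that] by simp
  have 6: "On_obj ?R \<in> Obj D \<rightarrow>\<^sub>E Obj (set_cat \<Omega>)" "On_arr ?R \<in> Arr D \<rightarrow>\<^sub>E Arr (set_cat \<Omega>)"
    using homD(1)[OF 5] F'(1) o by (auto simp: comp_functor_def incl_functor_def)
  show ?thesis
    unfolding is_functor_def op_cat_simps using 3 4 5 6 by simp
qed

lemma whisker_hom:
  assumes C: "category C" and sub: "subcategory D C" and be: "\<beta> \<in> hom (psh_cat \<Omega> C) L M"
  shows "whisker (op_cat D) \<beta> (incl_functor (op_cat D)) \<in>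
      hom (psh_cat \<Omega> D) (psh_restrict D L) (psh_restrict D M)"
    and "d \<in> Obj D \<Longrightarrow> nt_app (whisker (op_cat D) \<beta> (incl_functor (op_cat D))) d a = nt_app \<beta> d a"
proof -
  interpret D: category D using subcategoryD(1)[OF sub] .
  obtain t where a: "\<beta> = mk_nt C L t M" "t = nt_app \<beta>" using be unfolding psh_hom_iff[OF C] by blast
  have w: "whisker (op_cat D) \<beta> (incl_functor (op_cat D)) =
      mk_nt D (psh_restrict D L) (nt_app \<beta>) (psh_restrict D M)"
    unfolding a(2)[symmetric] unfolding a(1) mk_nt_def whisker_def
    using subcategoryD(2)[OF sub]
    by (auto simp: incl_functor_def comp_functor_def intro!: restrict_ext)
  also have "\<dots> \<in> hom (psh_cat \<Omega> D) (psh_restrict D L) (psh_restrict D M)"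
    using presheaf_psh_restrict[OF C sub] psh_homD[OF C be] D.hom_Obj
      subcategoryD(2,3)[OF sub] D.category_axioms
    by (intro mk_nt_hom) (simp_all add: homD)
  finally show "whisker (op_cat D) \<beta> (incl_functor (op_cat D)) \<in>
      hom (psh_cat \<Omega> D) (psh_restrict D L) (psh_restrict D M)" .
  show "d \<in> Obj D \<Longrightarrow> nt_app (whisker (op_cat D) \<beta> (incl_functor (op_cat D))) d a = nt_app \<beta> d a"
    using a by (cases \<beta>) (simp add: whisker_def nt_app_def incl_functor_def)
qed


section \<open>Representables\<close>

lemma yoneda_obj_obj: "x \<in> Obj C \<Longrightarrow> On_obj (yoneda_obj C c) x = hom C x c"
  by (simp add: yoneda_obj_def)

lemma yoneda_obj_restriction:
  "f \<in> hom C x y \<Longrightarrow> g \<in> hom C y c \<Longrightarrow> restriction (yoneda_obj C c) f g = Cmp C g f"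
  by (simp add: yoneda_obj_def restriction_def hom_def)

lemma presheaf_yoneda_obj:
  assumes ls: "locally_small \<Omega> C" and c: "c \<in> Obj C"
  shows "presheaf \<Omega> C (yoneda_obj C c)"
proof -
  interpret category C using ls by (simp add: locally_small_def)
  have "yoneda_obj C c = mk_psh C (\<lambda>x. hom C x c) (\<lambda>f g. Cmp C g f)"
    by (simp add: yoneda_obj_def mk_psh_def)
  moreover have "presheaf \<Omega> C (mk_psh C (\<lambda>x. hom C x c) (\<lambda>f g. Cmp C g f))"
    using ls c
    by (intro presheaf_mk_psh)
      (auto simp: locally_small_def intro: Cmp_in Cmp_Idn_right Cmp_assoc)
  ultimately show ?thesis by simp
qed

lemma yoneda_arr_hom:
  assumes ls: "locally_small \<Omega> C" and h: "h \<in> hom C c d"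
  shows "On_arr (yoneda C) h \<in> hom (psh_cat \<Omega> C) (yoneda_obj C c) (yoneda_obj C d)"
    and "g \<in> hom C x c \<Longrightarrow> nt_app (On_arr (yoneda C) h) x g = Cmp C h g"
proof -
  interpret category C using ls by (simp add: locally_small_def)
  have y: "On_arr (yoneda C) h = mk_nt C (yoneda_obj C c) (\<lambda>x g. Cmp C h g) (yoneda_obj C d)"
    using h by (auto simp: yoneda_def mk_nt_def yoneda_obj_obj homD intro!: restrict_ext)
  show "On_arr (yoneda C) h \<in> hom (psh_cat \<Omega> C) (yoneda_obj C c) (yoneda_obj C d)"
    unfolding y
  proof (rule mk_nt_hom)
    show "Cmp C h (restriction (yoneda_obj C c) f a) = restriction (yoneda_obj C d) f (Cmp C h a)"
      if "f \<in> hom C x y" "a \<in> On_obj (yoneda_obj C c) y" for f x y a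
    proof -
      have a: "a \<in> hom C y c" using that hom_Obj[OF that(1)] by (simp add: yoneda_obj_obj)
      show ?thesis
        using yoneda_obj_restriction[OF that(1) a] yoneda_obj_restriction[OF that(1) Cmp_in[OF a h]]
          Cmp_assoc[OF that(1) a h] by simp
    qed
  qed (use hom_Obj[OF h] ls h Cmp_in in
      \<open>auto simp: yoneda_obj_obj category_axioms intro: presheaf_yoneda_obj\<close>)
  show "g \<in> hom C x c \<Longrightarrow> nt_app (On_arr (yoneda C) h) x g = Cmp C h g"
    unfolding y using hom_Obj by (subst nt_app_mk) (auto simp: yoneda_obj_obj)
qed

lemma yoneda_functor:
  assumes ls: "locally_small \<Omega> C"
  shows "is_functor C (psh_cat \<Omega> C) (yoneda C)"
proof -
  interpret category C using ls by (simp add: locally_small_def)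
  have o: "On_obj (yoneda C) \<in> Obj C \<rightarrow>\<^sub>E Obj (psh_cat \<Omega> C)"
    using presheaf_yoneda_obj[OF ls] by (auto simp: yoneda_def)
  have h: "On_arr (yoneda C) f \<in> hom (psh_cat \<Omega> C) (On_obj (yoneda C) (Dom C f)) (On_obj (yoneda C) (Cod C f))"
    if "f \<in> Arr C" for f
    using yoneda_arr_hom(1)[OF ls, of f] that Dom_in Cod_in by (simp add: hom_def[of C] yoneda_def)
  have a: "On_arr (yoneda C) \<in> Arr C \<rightarrow>\<^sub>E Arr (psh_cat \<Omega> C)"
    using homD(1)[OF h] by (auto simp: yoneda_def)
  have i: "On_arr (yoneda C) (Idn C x) = Idn (psh_cat \<Omega> C) (On_obj (yoneda C) x)" if x: "x \<in> Obj C" for x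
  proof (rule psh_hom_eqI[OF category_axioms])
    show "On_arr (yoneda C) (Idn C x) \<in> hom (psh_cat \<Omega> C) (yoneda_obj C x) (yoneda_obj C x)"
      using yoneda_arr_hom(1)[OF ls Idn_in[OF x]] .
    show "Idn (psh_cat \<Omega> C) (On_obj (yoneda C) x) \<in> hom (psh_cat \<Omega> C) (yoneda_obj C x) (yoneda_obj C x)"
      using Idn_psh_hom[OF category_axioms presheaf_yoneda_obj[OF ls x]] x by (simp add: yoneda_def)
    show "nt_app (On_arr (yoneda C) (Idn C x)) c a = nt_app (Idn (psh_cat \<Omega> C) (On_obj (yoneda C) x)) c a"
      if "c \<in> Obj C" "a \<in> On_obj (yoneda_obj C x) c" for c a
      using that yoneda_arr_hom(2)[OF ls Idn_in[OF x], of a c] x Cmp_Idn_left[of a c x]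
      by (subst nt_app_Idn) (auto simp: yoneda_obj_obj yoneda_def)
  qed
  have c: "On_arr (yoneda C) (Cmp C g f) = Cmp (psh_cat \<Omega> C) (On_arr (yoneda C) g) (On_arr (yoneda C) f)"
    if "f \<in> Arr C" "g \<in> Arr C" "Cod C f = Dom C g" for f g
  proof -
    have fg: "f \<in> hom C (Dom C f) (Dom C g)" "g \<in> hom C (Dom C g) (Cod C g)"
      using that by (auto simp: hom_def)
    note yf = yoneda_arr_hom[OF ls fg(1)] and yg = yoneda_arr_hom[OF ls fg(2)]
      and yc = yoneda_arr_hom[OF ls Cmp_in[OF fg]]
    show ?thesis
    proof (rule psh_hom_eqI[OF category_axioms yc(1) Cmp_psh_hom[OF category_axioms yf(1) yg(1)]])
      fix x a assume x: "x \<in> Obj C" and a: "a \<in> On_obj (yoneda_obj C (Dom C f)) x"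
      then have a': "a \<in> hom C x (Dom C f)" by (simp add: yoneda_obj_obj)
      show "nt_app (On_arr (yoneda C) (Cmp C g f)) x a =
        nt_app (Cmp (psh_cat \<Omega> C) (On_arr (yoneda C) g) (On_arr (yoneda C) f)) x a"
        unfolding nt_app_Cmp[OF category_axioms yf(1) yg(1) x a]
        using yf(2)[OF a'] yg(2)[OF Cmp_in[OF a' fg(1)]] yc(2)[OF a'] Cmp_assoc[OF a' fg] by simp
    qed
  qed
  show ?thesis unfolding is_functor_def using o h a i c by blast
qed


section \<open>Colimits of presheaves are computed pointwise\<close>

lemma functor_to_psh_catD:
  assumes "is_functor I (psh_cat \<Omega> C) F"
  shows "i \<in> Obj I \<Longrightarrow> presheaf \<Omega> C (On_obj F i)"
    and "a \<in> Arr I \<Longrightarrow> On_arr F a \<in> hom (psh_cat \<Omega> C) (On_obj F (Dom I a)) (On_obj F (Cod I a))"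
proof -
  have "On_obj F \<in> Obj I \<rightarrow>\<^sub>E Obj (psh_cat \<Omega> C)"
    and "\<forall>a \<in> Arr I. On_arr F a \<in> hom (psh_cat \<Omega> C) (On_obj F (Dom I a)) (On_obj F (Cod I a))"
    using assms unfolding is_functor_def[of I "psh_cat \<Omega> C"] by blast+
  then show "i \<in> Obj I \<Longrightarrow> presheaf \<Omega> C (On_obj F i)"
    and "a \<in> Arr I \<Longrightarrow> On_arr F a \<in> hom (psh_cat \<Omega> C) (On_obj F (Dom I a)) (On_obj F (Cod I a))"
    by auto
qed

text \<open>At an object \<open>c\<close>, the identifications \<open>x \<sim> F a x\<close> which a colimit of \<open>F\<close> must make.\<close>

definition colim_step :: "('i, 'a) cat \<Rightarrow> ('i, 'a, 'u psh, 'u psh_arr) ftor \<Rightarrow> 'u \<Rightarrow> ('i \<times> 'u) rel" where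
  "colim_step I F c = {((Dom I a, x), (Cod I a, nt_app (On_arr F a) c x)) | a x.
     a \<in> Arr I \<and> x \<in> On_obj (On_obj F (Dom I a)) c}"

text \<open>The cocone is jointly surjective and identifies only what every cocone identifies.\<close>

definition pointwise_colimit :: "('i, 'a) cat \<Rightarrow> ('u, 'u) cat \<Rightarrow>
    ('i, 'a, 'u psh, 'u psh_arr) ftor \<Rightarrow> 'u psh \<Rightarrow> ('i \<Rightarrow> 'u psh_arr) \<Rightarrow> bool" where
  "pointwise_colimit I C F \<phi> \<mu> \<longleftrightarrow>
     (\<forall>c \<in> Obj C. \<forall>y \<in> On_obj \<phi> c. \<exists>i \<in> Obj I. \<exists>x \<in> On_obj (On_obj F i) c. y = nt_app (\<mu> i) c x) \<and>
     (\<forall>c \<in> Obj C. \<forall>i \<in> Obj I. \<forall>i' \<in> Obj I. \<forall>x \<in> On_obj (On_obj F i) c. \<forall>x' \<in> On_obj (On_obj F i') c.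
        nt_app (\<mu> i) c x = nt_app (\<mu> i') c x' \<longrightarrow> ((i, x), (i', x')) \<in> zigzag (colim_step I F c))"

lemma cocone_app:
  assumes C: "category C" and F: "is_functor I (psh_cat \<Omega> C) F" and I: "category I"
    and mu: "is_cocone I (psh_cat \<Omega> C) F \<phi> \<mu>" and c: "c \<in> Obj C"
  shows "i \<in> Obj I \<Longrightarrow> x \<in> On_obj (On_obj F i) c \<Longrightarrow> nt_app (\<mu> i) c x \<in> On_obj \<phi> c"
    and "a \<in> Arr I \<Longrightarrow> x \<in> On_obj (On_obj F (Dom I a)) c \<Longrightarrow>
      nt_app (\<mu> (Cod I a)) c (nt_app (On_arr F a) c x) = nt_app (\<mu> (Dom I a)) c x"
proof -
  interpret I: category I by fact
  have mh: "i \<in> Obj I \<Longrightarrow> \<mu> i \<in> hom (psh_cat \<Omega> C) (On_obj F i) \<phi>" for i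
    using mu by (simp add: is_cocone_def)
  show "i \<in> Obj I \<Longrightarrow> x \<in> On_obj (On_obj F i) c \<Longrightarrow> nt_app (\<mu> i) c x \<in> On_obj \<phi> c"
    using psh_homD(3)[OF C mh c] by blast
  show "nt_app (\<mu> (Cod I a)) c (nt_app (On_arr F a) c x) = nt_app (\<mu> (Dom I a)) c x"
    if "a \<in> Arr I" "x \<in> On_obj (On_obj F (Dom I a)) c"
    using nt_app_Cmp[OF C functor_to_psh_catD(2)[OF F that(1)] mh[OF I.Cod_in[OF that(1)]] c that(2)]
      mu that(1) by (simp add: is_cocone_def)
qed

lemma psh_coconeI:
  assumes C: "category C" and I: "category I" and F: "is_functor I (psh_cat \<Omega> C) F"
    and phi: "presheaf \<Omega> C \<phi>"
    and mh: "\<And>i. i \<in> Obj I \<Longrightarrow> \<mu> i \<in> hom (psh_cat \<Omega> C) (On_obj F i) \<phi>"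
    and nat: "\<And>a c x. a \<in> Arr I \<Longrightarrow> c \<in> Obj C \<Longrightarrow> x \<in> On_obj (On_obj F (Dom I a)) c \<Longrightarrow>
      nt_app (\<mu> (Cod I a)) c (nt_app (On_arr F a) c x) = nt_app (\<mu> (Dom I a)) c x"
  shows "is_cocone I (psh_cat \<Omega> C) F \<phi> \<mu>"
proof -
  interpret I: category I by fact
  have "Cmp (psh_cat \<Omega> C) (\<mu> (Cod I a)) (On_arr F a) = \<mu> (Dom I a)" if "a \<in> Arr I" for a
    using Cmp_psh_hom[OF C functor_to_psh_catD(2)[OF F that] mh[OF I.Cod_in[OF that]]]
      nt_app_Cmp[OF C functor_to_psh_catD(2)[OF F that] mh[OF I.Cod_in[OF that]]] nat[OF that]
    by (intro psh_hom_eqI[OF C _ mh[OF I.Dom_in[OF that]]]) simp_all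
  then show ?thesis using phi mh by (simp add: is_cocone_def)
qed

text \<open>A jointly surjective cocone leaves no choice for the mediating arrow, and it exists as soon as
  the second cocone makes the identifications that the first one makes. Used in both
  directions of the comparison between colimits and pointwise colimits.\<close>

lemma cocone_factorization:
  assumes C: "category C" and I: "category I" and F: "is_functor I (psh_cat \<Omega> C) F"
    and mu: "is_cocone I (psh_cat \<Omega> C) F \<phi> \<mu>" and nu: "is_cocone I (psh_cat \<Omega> C) F \<psi> \<nu>"
    and surj: "\<And>c y. c \<in> Obj C \<Longrightarrow> y \<in> On_obj \<phi> c \<Longrightarrow>
      \<exists>i \<in> Obj I. \<exists>x \<in> On_obj (On_obj F i) c. y = nt_app (\<mu> i) c x"
    and compat: "\<And>c i i' x x'. c \<in> Obj C \<Longrightarrow> i \<in> Obj I \<Longrightarrow> i' \<in> Obj I \<Longrightarrow>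
      x \<in> On_obj (On_obj F i) c \<Longrightarrow> x' \<in> On_obj (On_obj F i') c \<Longrightarrow>
      nt_app (\<mu> i) c x = nt_app (\<mu> i') c x' \<Longrightarrow> nt_app (\<nu> i) c x = nt_app (\<nu> i') c x'"
  shows "\<exists>!h. h \<in> hom (psh_cat \<Omega> C) \<phi> \<psi> \<and> (\<forall>i \<in> Obj I. Cmp (psh_cat \<Omega> C) h (\<mu> i) = \<nu> i)"
proof -
  interpret C: category C by fact
  have mh: "i \<in> Obj I \<Longrightarrow> \<mu> i \<in> hom (psh_cat \<Omega> C) (On_obj F i) \<phi>"
    and nh: "i \<in> Obj I \<Longrightarrow> \<nu> i \<in> hom (psh_cat \<Omega> C) (On_obj F i) \<psi>" for i
    using mu nu by (simp_all add: is_cocone_def)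
  have phi: "presheaf \<Omega> C \<phi>" and psi: "presheaf \<Omega> C \<psi>"
    using mu nu by (simp_all add: is_cocone_def)
  have "\<exists>z. \<forall>i \<in> Obj I. \<forall>x \<in> On_obj (On_obj F i) c. y = nt_app (\<mu> i) c x \<longrightarrow> z = nt_app (\<nu> i) c x"
    if c: "c \<in> Obj C" and y: "y \<in> On_obj \<phi> c" for c y
    using surj[OF c y] compat[OF c] by metis
  then obtain t where t: "\<And>c y i x. c \<in> Obj C \<Longrightarrow> y \<in> On_obj \<phi> c \<Longrightarrow> i \<in> Obj I \<Longrightarrow>
      x \<in> On_obj (On_obj F i) c \<Longrightarrow> y = nt_app (\<mu> i) c x \<Longrightarrow> t c y = nt_app (\<nu> i) c x"
    by metis
  have tm: "t c (nt_app (\<mu> i) c x) = nt_app (\<nu> i) c x"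
    if "c \<in> Obj C" "i \<in> Obj I" "x \<in> On_obj (On_obj F i) c" for c i x
    using t[OF that(1) _ that(2,3) refl] cocone_app(1)[OF C F I mu that] by blast
  define h where "h = mk_nt C \<phi> t \<psi>"
  have hh: "h \<in> hom (psh_cat \<Omega> C) \<phi> \<psi>"
    unfolding h_def
  proof (rule mk_nt_hom[OF C phi psi])
    show "t c a \<in> On_obj \<psi> c" if "c \<in> Obj C" "a \<in> On_obj \<phi> c" for c a
      using surj[OF that] tm[OF that(1)] cocone_app(1)[OF C F I nu that(1)] by metis
    show "t x (restriction \<phi> f a) = restriction \<psi> f (t y a)"
      if f: "f \<in> hom C x y" and a: "a \<in> On_obj \<phi> y" for f x y a
    proof -
      have x: "x \<in> Obj C" and y: "y \<in> Obj C" using C.hom_Obj[OF f] by auto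
      obtain i z where i: "i \<in> Obj I" and z: "z \<in> On_obj (On_obj F i) y" and a': "a = nt_app (\<mu> i) y z"
        using surj[OF y a] by blast
      have Fi: "presheaf \<Omega> C (On_obj F i)" using functor_to_psh_catD(1)[OF F i] .
      have "restriction \<phi> f a = nt_app (\<mu> i) x (restriction (On_obj F i) f z)"
        using psh_homD(4)[OF C mh[OF i] f z] a' by simp
      then have "t x (restriction \<phi> f a) = nt_app (\<nu> i) x (restriction (On_obj F i) f z)"
        using tm[OF x i restriction_in[OF C Fi f z]] by simp
      also have "\<dots> = restriction \<psi> f (t y a)"
        using psh_homD(4)[OF C nh[OF i] f z] tm[OF y i z] a' by simp
      finally show ?thesis .
    qed
  qed
  have happ: "nt_app h c y = t c y" if "c \<in> Obj C" "y \<in> On_obj \<phi> c" for c y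
    unfolding h_def by (rule nt_app_mk[OF that])
  show ?thesis
  proof (rule ex1I[of _ h])
    have "Cmp (psh_cat \<Omega> C) h (\<mu> i) = \<nu> i" if i: "i \<in> Obj I" for i
    proof (rule psh_hom_eqI[OF C Cmp_psh_hom[OF C mh[OF i] hh] nh[OF i]])
      fix c a assume ca: "c \<in> Obj C" "a \<in> On_obj (On_obj F i) c"
      then show "nt_app (Cmp (psh_cat \<Omega> C) h (\<mu> i)) c a = nt_app (\<nu> i) c a"
        using nt_app_Cmp[OF C mh[OF i] hh ca] happ[OF ca(1) psh_homD(3)[OF C mh[OF i] ca]]
          tm[OF ca(1) i ca(2)] by simp
    qed
    then show "h \<in> hom (psh_cat \<Omega> C) \<phi> \<psi> \<and> (\<forall>i \<in> Obj I. Cmp (psh_cat \<Omega> C) h (\<mu> i) = \<nu> i)"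
      using hh by blast
  next
    fix k assume k: "k \<in> hom (psh_cat \<Omega> C) \<phi> \<psi> \<and> (\<forall>i \<in> Obj I. Cmp (psh_cat \<Omega> C) k (\<mu> i) = \<nu> i)"
    show "k = h"
    proof (rule psh_hom_eqI[OF C _ hh])
      show kh: "k \<in> hom (psh_cat \<Omega> C) \<phi> \<psi>" using k by blast
      fix c y assume c: "c \<in> Obj C" and y: "y \<in> On_obj \<phi> c"
      obtain i x where i: "i \<in> Obj I" and x: "x \<in> On_obj (On_obj F i) c" and y': "y = nt_app (\<mu> i) c x"
        using surj[OF c y] by blast
      have "nt_app k c y = nt_app (\<nu> i) c x"
        using nt_app_Cmp[OF C mh[OF i] kh c x] k i y' by simp
      then show "nt_app k c y = nt_app h c y"
        using happ[OF c y] tm[OF c i x] y' by simp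
    qed
  qed
qed

lemma pointwise_colimit_imp_colimit:
  assumes C: "category C" and I: "category I" and F: "is_functor I (psh_cat \<Omega> C) F"
    and mu: "is_cocone I (psh_cat \<Omega> C) F \<phi> \<mu>" and pw: "pointwise_colimit I C F \<phi> \<mu>"
  shows "is_colimit I (psh_cat \<Omega> C) F \<phi>"
  unfolding is_colimit_def
proof (intro exI[of _ \<mu>] conjI mu allI impI)
  fix b \<nu> assume nu: "is_cocone I (psh_cat \<Omega> C) F b \<nu>"
  show "\<exists>!h. h \<in> hom (psh_cat \<Omega> C) \<phi> b \<and> (\<forall>i \<in> Obj I. Cmp (psh_cat \<Omega> C) h (\<mu> i) = \<nu> i)"
  proof (rule cocone_factorization[OF C I F mu nu])
    fix c i i' x x'
    assume c: "c \<in> Obj C" and "i \<in> Obj I" "i' \<in> Obj I"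
      "x \<in> On_obj (On_obj F i) c" "x' \<in> On_obj (On_obj F i') c"
      "nt_app (\<mu> i) c x = nt_app (\<mu> i') c x'"
    then have "((i, x), (i', x')) \<in> zigzag (colim_step I F c)"
      using pw unfolding pointwise_colimit_def by blast
    then have "(case (i, x) of (j, z) \<Rightarrow> nt_app (\<nu> j) c z) = (case (i', x') of (j, z) \<Rightarrow> nt_app (\<nu> j) c z)"
      by (rule zigzag_invariant)
        (auto simp: colim_step_def cocone_app(2)[OF C F I nu c])
    then show "nt_app (\<nu> i) c x = nt_app (\<nu> i') c x'" by simp
  qed (use pw in \<open>auto simp: pointwise_colimit_def\<close>)
qed

lemma colim_step_restriction:
  assumes C: "category C" and F: "is_functor I (psh_cat \<Omega> C) F" and f: "f \<in> hom C x y"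
    and zigzag: "((i, a), (i', a')) \<in> zigzag (colim_step I F y)"
  shows "((i, restriction (On_obj F i) f a), (i', restriction (On_obj F i') f a')) \<in> zigzag (colim_step I F x)"
proof -
  interpret category C by fact
  let ?g = "\<lambda>(j, z). (j, restriction (On_obj F j) f z)"
  have "(?g (i, a), ?g (i', a')) \<in> zigzag (colim_step I F x)"
    using zigzag
  proof (rule zigzag_map)
    fix p q assume "(p, q) \<in> colim_step I F y"
    then obtain b z where b: "b \<in> Arr I" and z: "z \<in> On_obj (On_obj F (Dom I b)) y"
      and pq: "p = (Dom I b, z)" "q = (Cod I b, nt_app (On_arr F b) y z)"
      unfolding colim_step_def by blast
    note Fb = functor_to_psh_catD(2)[OF F b]
    have "restriction (On_obj F (Dom I b)) f z \<in> On_obj (On_obj F (Dom I b)) x"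
      by (rule restriction_in[OF C psh_homD(1)[OF C Fb] f z])
    then have "(?g p, ?g q) \<in> colim_step I F x"
      unfolding colim_step_def using b pq psh_homD(4)[OF C Fb f z] by auto
    then show "(?g p, ?g q) \<in> zigzag (colim_step I F x)" by (rule zigzag_step)
  qed
  then show ?thesis by simp
qed

text \<open>A colimit given only by its universal property is compared with the quotient \<open>P\<close> of the disjoint
  union of the diagram by zigzags, coded inside \<open>'u\<close>. Mapping to \<open>P\<close> shows that the colimit identifies no more
  than zigzags do. The resulting map \<open>h\<close> has a left inverse \<open>k\<close>, which shows that
  the colimit cocone is jointly surjective since that of \<open>P\<close> is. Smallness of the index category
  ensures that \<open>P\<close> takes small values.\<close>

lemma colimit_imp_pointwise_colimit:
  fixes \<Omega> :: "'u rel" and C :: "('u, 'u) cat"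
  assumes reg: "regular_cardinal \<Omega>" and C: "category C" and I: "category I"
    and small: "|Obj I| <o \<Omega>" and F: "is_functor I (psh_cat \<Omega> C) F"
    and colim: "is_colimit I (psh_cat \<Omega> C) F \<phi>"
  shows "\<exists>\<mu>. is_cocone I (psh_cat \<Omega> C) F \<phi> \<mu> \<and> pointwise_colimit I C F \<phi> \<mu>"
proof -
  interpret C: category C by fact
  interpret I: category I by fact
  obtain \<mu> where mu: "is_cocone I (psh_cat \<Omega> C) F \<phi> \<mu>"
    and univ: "\<And>b \<nu>. is_cocone I (psh_cat \<Omega> C) F b \<nu> \<Longrightarrow>
       \<exists>!h. h \<in> hom (psh_cat \<Omega> C) \<phi> b \<and> (\<forall>i \<in> Obj I. Cmp (psh_cat \<Omega> C) h (\<mu> i) = \<nu> i)"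
    using colim unfolding is_colimit_def by blast
  have mh: "i \<in> Obj I \<Longrightarrow> \<mu> i \<in> hom (psh_cat \<Omega> C) (On_obj F i) \<phi>" for i
    using mu by (simp add: is_cocone_def)
  have phi: "presheaf \<Omega> C \<phi>" using mu by (simp add: is_cocone_def)
  note Fp = functor_to_psh_catD(1)[OF F] and Fa = functor_to_psh_catD(2)[OF F]
  define X where "X c = (SIGMA i : Obj I. On_obj (On_obj F i) c)" for c
  have Xs: "|X c| <o \<Omega>" if "c \<in> Obj C" for c
    unfolding X_def using presheaf_small[OF C Fp that]
    by (intro card_of_Sigma_less[OF reg small]) blast
  then have "\<forall>c \<in> Obj C. \<exists>q :: 'a \<times> 'u \<Rightarrow> 'u.
      \<forall>a \<in> X c. \<forall>b \<in> X c. q a = q b \<longleftrightarrow> (a, b) \<in> zigzag (colim_step I F c)"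
    using ex_quotient_coding[OF reg] by blast
  then obtain q :: "'u \<Rightarrow> 'a \<times> 'u \<Rightarrow> 'u" where q: "\<And>c a b. c \<in> Obj C \<Longrightarrow> a \<in> X c \<Longrightarrow> b \<in> X c \<Longrightarrow>
      q c a = q c b \<longleftrightarrow> (a, b) \<in> zigzag (colim_step I F c)"
    by metis
  \<comment> \<open>The restriction map of the quotient picks a representative of \<open>y\<close>; the fact \<open>r\<close> below says that the
    choice does not matter, by invariance of zigzags under restriction.\<close>
  define r where "r f y = (case inv_into (X (Cod C f)) (q (Cod C f)) y of
      (i, x) \<Rightarrow> q (Dom C f) (i, restriction (On_obj F i) f x))" for f y
  have Xr: "(i, restriction (On_obj F i) f a) \<in> X x" if "f \<in> hom C x y" "(i, a) \<in> X y" for f x y i a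
    using that restriction_in[OF C Fp that(1)] by (auto simp: X_def)
  have r: "r f (q y (i, a)) = q x (i, restriction (On_obj F i) f a)"
    if f: "f \<in> hom C x y" and ia: "(i, a) \<in> X y" for f x y i a
  proof -
    note xy = C.hom_Obj[OF f]
    obtain i' a' where inv: "inv_into (X y) (q y) (q y (i, a)) = (i', a')" by fastforce
    have X': "(i', a') \<in> X y" and "q y (i', a') = q y (i, a)"
      using inv inv_into_into[of "q y (i, a)" "q y" "X y"] f_inv_into_f[of "q y (i, a)" "q y" "X y"] ia
      by auto
    then have "((i', a'), (i, a)) \<in> zigzag (colim_step I F y)" using q[OF xy(2)] ia by blast
    from colim_step_restriction[OF C F f this]
    have "q x (i', restriction (On_obj F i') f a') = q x (i, restriction (On_obj F i) f a)"
      using q[OF xy(1)] Xr[OF f X'] Xr[OF f ia] by blast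
    then show ?thesis using inv f by (simp add: r_def homD)
  qed
  define P where "P = mk_psh C (\<lambda>c. q c ` X c) r"
  have Po: "On_obj P c = q c ` X c" if "c \<in> Obj C" for c
    unfolding P_def by (rule mk_psh_obj[OF that])
  have Pr: "restriction P f (q y (i, a)) = q x (i, restriction (On_obj F i) f a)"
    if "f \<in> hom C x y" "(i, a) \<in> X y" for f x y i a
    using r[OF that] mk_psh_restriction[of f C "q y (i, a)" "\<lambda>c. q c ` X c" r] that
    by (simp add: P_def homD)
  have P: "presheaf \<Omega> C P"
    unfolding P_def
  proof (rule presheaf_mk_psh[OF C])
    show "|q c ` X c| <o \<Omega>" if "c \<in> Obj C" for c
      using Xs[OF that] by (rule card_of_image_less)
    show "r f a \<in> q x ` X x" if f: "f \<in> hom C x y" and "a \<in> q y ` X y" for f x y a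
      using that r[OF f] Xr[OF f] by fastforce
    show "r (Idn C c) a = a" if c: "c \<in> Obj C" and "a \<in> q c ` X c" for c a
      using that r[OF C.Idn_in[OF c]] restriction_Idn[OF C Fp c] by (auto simp: X_def)
    show "r (Cmp C g f) a = r f (r g a)"
      if f: "f \<in> hom C x y" and g: "g \<in> hom C y z" and a: "a \<in> q z ` X z" for f g x y z a
    proof -
      obtain i b where ib: "(i, b) \<in> X z" "a = q z (i, b)" using a by fastforce
      then have "restriction (On_obj F i) (Cmp C g f) b =
          restriction (On_obj F i) f (restriction (On_obj F i) g b)"
        using restriction_Cmp[OF C Fp f g] by (auto simp: X_def)
      then show ?thesis
        using r[OF C.Cmp_in[OF f g] ib(1)] r[OF g ib(1)] r[OF f Xr[OF g ib(1)]] ib(2) by simp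
    qed
  qed
  define \<nu> where "\<nu> i = mk_nt C (On_obj F i) (\<lambda>c x. q c (i, x)) P" for i
  have nh: "\<nu> i \<in> hom (psh_cat \<Omega> C) (On_obj F i) P" if i: "i \<in> Obj I" for i
    unfolding \<nu>_def
  proof (rule mk_nt_hom[OF C Fp[OF i] P])
    show "q c (i, a) \<in> On_obj P c" if "c \<in> Obj C" "a \<in> On_obj (On_obj F i) c" for c a
      using that i by (simp add: Po X_def)
    show "q x (i, restriction (On_obj F i) f a) = restriction P f (q y (i, a))"
      if "f \<in> hom C x y" "a \<in> On_obj (On_obj F i) y" for f x y a
      using Pr[OF that(1)] that i by (simp add: X_def)
  qed
  have napp: "nt_app (\<nu> i) c x = q c (i, x)" if "c \<in> Obj C" "x \<in> On_obj (On_obj F i) c" for c i x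
    unfolding \<nu>_def by (rule nt_app_mk[OF that])
  have nu: "is_cocone I (psh_cat \<Omega> C) F P \<nu>"
  proof (rule psh_coconeI[OF C I F P nh])
    fix a c x assume a: "a \<in> Arr I" and c: "c \<in> Obj C" and x: "x \<in> On_obj (On_obj F (Dom I a)) c"
    have Fx: "nt_app (On_arr F a) c x \<in> On_obj (On_obj F (Cod I a)) c"
      by (rule psh_homD(3)[OF C Fa[OF a] c x])
    have "((Dom I a, x), (Cod I a, nt_app (On_arr F a) c x)) \<in> zigzag (colim_step I F c)"
      by (rule zigzag_step) (use a x in \<open>auto simp: colim_step_def\<close>)
    then have "q c (Cod I a, nt_app (On_arr F a) c x) = q c (Dom I a, x)"
      using q[OF c, of "(Dom I a, x)" "(Cod I a, nt_app (On_arr F a) c x)"] x Fx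
        I.Dom_in[OF a] I.Cod_in[OF a] by (simp add: X_def)
    then show "nt_app (\<nu> (Cod I a)) c (nt_app (On_arr F a) c x) = nt_app (\<nu> (Dom I a)) c x"
      using napp[OF c x] napp[OF c Fx] by simp
  qed
  have nq: "((i, x), (i', x')) \<in> zigzag (colim_step I F c)"
    if "c \<in> Obj C" "i \<in> Obj I" "i' \<in> Obj I" "x \<in> On_obj (On_obj F i) c" "x' \<in> On_obj (On_obj F i') c"
      "nt_app (\<nu> i) c x = nt_app (\<nu> i') c x'" for c i i' x x'
    using q[OF that(1), of "(i, x)" "(i', x')"] napp[OF that(1)] that by (simp add: X_def)
  have "pointwise_colimit I C F P \<nu>"
    unfolding pointwise_colimit_def
  proof (intro conjI ballI impI)
    fix c y assume c: "c \<in> Obj C" and "y \<in> On_obj P c"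
    then obtain i x where "i \<in> Obj I" "x \<in> On_obj (On_obj F i) c" "y = q c (i, x)"
      by (auto simp: Po X_def)
    then show "\<exists>i \<in> Obj I. \<exists>x \<in> On_obj (On_obj F i) c. y = nt_app (\<nu> i) c x"
      using napp[OF c] by metis
  qed (use nq in blast)
  then have pwP: "\<And>c y. c \<in> Obj C \<Longrightarrow> y \<in> On_obj P c \<Longrightarrow>
      \<exists>i \<in> Obj I. \<exists>x \<in> On_obj (On_obj F i) c. y = nt_app (\<nu> i) c x"
    unfolding pointwise_colimit_def by blast
  obtain h where h: "h \<in> hom (psh_cat \<Omega> C) \<phi> P"
    and hm: "\<And>i. i \<in> Obj I \<Longrightarrow> Cmp (psh_cat \<Omega> C) h (\<mu> i) = \<nu> i"
    using univ[OF nu] by blast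
  have happ: "nt_app h c (nt_app (\<mu> i) c x) = nt_app (\<nu> i) c x"
    if "i \<in> Obj I" "c \<in> Obj C" "x \<in> On_obj (On_obj F i) c" for i c x
    using nt_app_Cmp[OF C mh h that(2,3)] hm that(1) by metis
  have "\<exists>!k. k \<in> hom (psh_cat \<Omega> C) P \<phi> \<and> (\<forall>i \<in> Obj I. Cmp (psh_cat \<Omega> C) k (\<nu> i) = \<mu> i)"
  proof (rule cocone_factorization[OF C I F nu mu pwP])
    fix c i i' x x'
    assume c: "c \<in> Obj C" and "i \<in> Obj I" "i' \<in> Obj I"
      "x \<in> On_obj (On_obj F i) c" "x' \<in> On_obj (On_obj F i') c"
      "nt_app (\<nu> i) c x = nt_app (\<nu> i') c x'"
    then have "((i, x), (i', x')) \<in> zigzag (colim_step I F c)" by (rule nq)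
    then have "(case (i, x) of (j, z) \<Rightarrow> nt_app (\<mu> j) c z) = (case (i', x') of (j, z) \<Rightarrow> nt_app (\<mu> j) c z)"
      by (rule zigzag_invariant)
        (auto simp: colim_step_def cocone_app(2)[OF C F I mu c])
    then show "nt_app (\<mu> i) c x = nt_app (\<mu> i') c x'" by simp
  qed
  then obtain k where k: "k \<in> hom (psh_cat \<Omega> C) P \<phi>"
    and km: "\<And>i. i \<in> Obj I \<Longrightarrow> Cmp (psh_cat \<Omega> C) k (\<nu> i) = \<mu> i"
    by blast
  have kapp: "nt_app k c (nt_app (\<nu> i) c x) = nt_app (\<mu> i) c x"
    if "i \<in> Obj I" "c \<in> Obj C" "x \<in> On_obj (On_obj F i) c" for i c x
    using nt_app_Cmp[OF C nh k that(2,3)] km that(1) by metis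
  have kh: "Cmp (psh_cat \<Omega> C) k h \<in> hom (psh_cat \<Omega> C) \<phi> \<phi>" by (rule Cmp_psh_hom[OF C h k])
  have idh: "Idn (psh_cat \<Omega> C) \<phi> \<in> hom (psh_cat \<Omega> C) \<phi> \<phi>" by (rule Idn_psh_hom[OF C phi])
  have "Cmp (psh_cat \<Omega> C) (Cmp (psh_cat \<Omega> C) k h) (\<mu> i) = \<mu> i"
    and "Cmp (psh_cat \<Omega> C) (Idn (psh_cat \<Omega> C) \<phi>) (\<mu> i) = \<mu> i" if i: "i \<in> Obj I" for i
  proof -
    show "Cmp (psh_cat \<Omega> C) (Cmp (psh_cat \<Omega> C) k h) (\<mu> i) = \<mu> i"
      using nt_app_Cmp[OF C mh[OF i] kh] nt_app_Cmp[OF C h k] psh_homD(3)[OF C mh[OF i]] happ[OF i] kapp[OF i]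
      by (intro psh_hom_eqI[OF C Cmp_psh_hom[OF C mh[OF i] kh] mh[OF i]]) simp
    show "Cmp (psh_cat \<Omega> C) (Idn (psh_cat \<Omega> C) \<phi>) (\<mu> i) = \<mu> i"
      using nt_app_Cmp[OF C mh[OF i] idh] psh_homD(3)[OF C mh[OF i]]
      by (intro psh_hom_eqI[OF C Cmp_psh_hom[OF C mh[OF i] idh] mh[OF i]]) (simp add: nt_app_Idn)
  qed
  then have khid: "Cmp (psh_cat \<Omega> C) k h = Idn (psh_cat \<Omega> C) \<phi>"
    using univ[OF mu] kh idh by blast
  have "pointwise_colimit I C F \<phi> \<mu>"
    unfolding pointwise_colimit_def
  proof (intro conjI ballI impI)
    fix c y assume c: "c \<in> Obj C" and y: "y \<in> On_obj \<phi> c"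
    have "y = nt_app k c (nt_app h c y)"
      using nt_app_Cmp[OF C h k c y] nt_app_Idn[OF c y, of \<Omega>] khid by simp
    then show "\<exists>i \<in> Obj I. \<exists>x \<in> On_obj (On_obj F i) c. y = nt_app (\<mu> i) c x"
      using pwP[OF c psh_homD(3)[OF C h c y]] kapp[OF _ c] by metis
  next
    fix c i i' x x'
    assume a: "c \<in> Obj C" "i \<in> Obj I" "i' \<in> Obj I"
      "x \<in> On_obj (On_obj F i) c" "x' \<in> On_obj (On_obj F i') c"
      and e: "nt_app (\<mu> i) c x = nt_app (\<mu> i') c x'"
    have "nt_app (\<nu> i) c x = nt_app (\<nu> i') c x'"
      using happ[OF a(2,1,4)] happ[OF a(3,1,5)] e by simp
    then show "((i, x), (i', x')) \<in> zigzag (colim_step I F c)" by (rule nq[OF a])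
  qed
  then show ?thesis using mu by blast
qed


section \<open>Composite diagrams and categories of elements\<close>

lemma functor_comp:
  assumes A: "category A" and F: "is_functor A B F" and G: "is_functor B E G"
  shows "is_functor A E (comp_functor A G F)"
proof -
  interpret A: category A by fact
  have F': "\<And>x. x \<in> Obj A \<Longrightarrow> On_obj F x \<in> Obj B"
    "\<And>f. f \<in> Arr A \<Longrightarrow> On_arr F f \<in> hom B (On_obj F (Dom A f)) (On_obj F (Cod A f))"
    "\<And>x. x \<in> Obj A \<Longrightarrow> On_arr F (Idn A x) = Idn B (On_obj F x)"
    "\<And>f g. f \<in> Arr A \<Longrightarrow> g \<in> Arr A \<Longrightarrow> Cod A f = Dom A g \<Longrightarrow>
      On_arr F (Cmp A g f) = Cmp B (On_arr F g) (On_arr F f)"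
    using F unfolding is_functor_def by auto
  have G': "\<And>x. x \<in> Obj B \<Longrightarrow> On_obj G x \<in> Obj E"
    "\<And>f. f \<in> Arr B \<Longrightarrow> On_arr G f \<in> hom E (On_obj G (Dom B f)) (On_obj G (Cod B f))"
    "\<And>x. x \<in> Obj B \<Longrightarrow> On_arr G (Idn B x) = Idn E (On_obj G x)"
    "\<And>f g. f \<in> Arr B \<Longrightarrow> g \<in> Arr B \<Longrightarrow> Cod B f = Dom B g \<Longrightarrow>
      On_arr G (Cmp B g f) = Cmp E (On_arr G g) (On_arr G f)"
    using G unfolding is_functor_def by auto
  let ?H = "comp_functor A G F"
  have o: "On_obj ?H x = On_obj G (On_obj F x)" if "x \<in> Obj A" for x
    using that by (simp add: comp_functor_def)
  have a: "On_arr ?H f = On_arr G (On_arr F f)" if "f \<in> Arr A" for f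
    using that by (simp add: comp_functor_def)
  have h: "On_arr ?H f \<in> hom E (On_obj ?H (Dom A f)) (On_obj ?H (Cod A f))" if "f \<in> Arr A" for f
    using G'(2)[OF homD(1)[OF F'(2)[OF that]]] homD(2,3)[OF F'(2)[OF that]] o a that
      A.Dom_in[OF that] A.Cod_in[OF that] by simp
  have i: "On_arr ?H (Idn A x) = Idn E (On_obj ?H x)" if "x \<in> Obj A" for x
    using a[OF homD(1)[OF A.Idn_in[OF that]]] o[OF that] F'(3)[OF that] G'(3)[OF F'(1)[OF that]] by simp
  have c: "On_arr ?H (Cmp A g f) = Cmp E (On_arr ?H g) (On_arr ?H f)"
    if "f \<in> Arr A" "g \<in> Arr A" "Cod A f = Dom A g" for f g
  proof -
    have "Cmp A g f \<in> Arr A" using A.Cmp_in[of f "Dom A f" "Cod A f" g "Cod A g"] that by (simp add: hom_def)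
    then show ?thesis
      using a that F'(4)[OF that] G'(4)[OF homD(1)[OF F'(2)[OF that(1)]] homD(1)[OF F'(2)[OF that(2)]]]
        homD(3)[OF F'(2)[OF that(1)]] homD(2)[OF F'(2)[OF that(2)]] by simp
  qed
  have "On_obj ?H \<in> Obj A \<rightarrow>\<^sub>E Obj E" "On_arr ?H \<in> Arr A \<rightarrow>\<^sub>E Arr E"
    using F'(1) G'(1) homD(1)[OF h] by (auto simp: comp_functor_def)
  with h i c show ?thesis unfolding is_functor_def by blast
qed

lemma incl_functor_functor:
  assumes "subcategory D C" shows "is_functor D C (incl_functor D)"
proof -
  interpret D: category D using subcategoryD(1)[OF assms] .
  have i: "On_arr (incl_functor D) (Idn D x) = Idn C x" if "x \<in> Obj D" for x
    using homD(1)[OF D.Idn_in[OF that]] subcategoryD(4)[OF assms that] by (simp add: incl_functor_def)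
  have c: "On_arr (incl_functor D) (Cmp D g f) = Cmp C g f"
    if "f \<in> Arr D" "g \<in> Arr D" "Cod D f = Dom D g" for f g
    using D.Cmp_in[of f "Dom D f" "Cod D f" g "Cod D g"] that
      subcategoryD(5)[OF assms, of f "Dom D f" "Cod D f" g "Cod D g"]
    by (simp add: incl_functor_def hom_def)
  show ?thesis
    unfolding is_functor_def using assms i c D.Dom_in D.Cod_in
    by (auto simp: subcategory_def incl_functor_def hom_def)
qed

lemma elements_cat_simps:
  "Obj (elements_cat J \<phi>) = {(j, x). j \<in> Obj J \<and> x \<in> On_obj \<phi> j}"
  "Arr (elements_cat J \<phi>) = {((j, x), f, (j', x')) | j x f j' x'. x \<in> On_obj \<phi> j \<and> x' \<in> On_obj \<phi> j' \<and>
       f \<in> hom J j j' \<and> restriction \<phi> f x' = x}"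
  "Dom (elements_cat J \<phi>) (p, f, q) = p" "Cod (elements_cat J \<phi>) (p, f, q) = q"
  "Idn (elements_cat J \<phi>) p = (p, Idn J (fst p), p)"
  "Cmp (elements_cat J \<phi>) (q', g, r) (p, f, q) = (p, Cmp J g f, r)"
  by (auto simp: elements_cat_def)

lemma category_elements_cat:
  assumes J: "category J" and F: "presheaf \<Omega> J \<phi>"
  shows "category (elements_cat J \<phi>)"
proof -
  interpret category J by fact
  have h: "h \<in> hom (elements_cat J \<phi>) p q \<longleftrightarrow> (\<exists>f. h = (p, f, q) \<and> snd p \<in> On_obj \<phi> (fst p) \<and>
      snd q \<in> On_obj \<phi> (fst q) \<and> f \<in> hom J (fst p) (fst q) \<and> restriction \<phi> f (snd q) = snd p)" for h p q
    by (cases p; cases q; cases h) (auto simp: hom_def[of "elements_cat J \<phi>"] elements_cat_simps)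
  show ?thesis
  proof
    show "Dom (elements_cat J \<phi>) f \<in> Obj (elements_cat J \<phi>)"
      "Cod (elements_cat J \<phi>) f \<in> Obj (elements_cat J \<phi>)" if "f \<in> Arr (elements_cat J \<phi>)" for f
      using that hom_Obj by (auto simp: elements_cat_simps)
    show "Idn (elements_cat J \<phi>) p \<in> hom (elements_cat J \<phi>) p p" if "p \<in> Obj (elements_cat J \<phi>)" for p
      using that Idn_in restriction_Idn[OF J F] by (auto simp: h elements_cat_simps)
    show "Cmp (elements_cat J \<phi>) g f \<in> hom (elements_cat J \<phi>) p r"
      if "f \<in> hom (elements_cat J \<phi>) p q" "g \<in> hom (elements_cat J \<phi>) q r" for f g p q r
      using that Cmp_in restriction_Cmp[OF J F] by (auto simp: h elements_cat_simps)
  qed (auto simp: h elements_cat_simps Cmp_Idn_left Cmp_Idn_right Cmp_assoc)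
qed

lemma elements_proj_functor:
  assumes J: "category J" and F: "presheaf \<Omega> J \<phi>"
  shows "is_functor (elements_cat J \<phi>) J (elements_proj J \<phi>)"
proof -
  interpret category J by fact
  interpret E: category "elements_cat J \<phi>" by (rule category_elements_cat[OF J F])
  have i: "Idn (elements_cat J \<phi>) p \<in> Arr (elements_cat J \<phi>)" if "p \<in> Obj (elements_cat J \<phi>)" for p
    using E.Idn_in[OF that] by (rule homD)
  have c: "Cmp (elements_cat J \<phi>) g f \<in> Arr (elements_cat J \<phi>)" if "f \<in> Arr (elements_cat J \<phi>)"
    "g \<in> Arr (elements_cat J \<phi>)" "Cod (elements_cat J \<phi>) f = Dom (elements_cat J \<phi>) g" for f g
    using E.Cmp_in[OF homI[OF that(1) refl that(3)] homI[OF that(2) refl refl]] by (rule homD)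
  have o: "On_obj (elements_proj J \<phi>) p = fst p" if "p \<in> Obj (elements_cat J \<phi>)" for p
    using that by (simp add: elements_proj_def)
  have a: "On_arr (elements_proj J \<phi>) h = fst (snd h)" if "h \<in> Arr (elements_cat J \<phi>)" for h
    using that by (simp add: elements_proj_def)
  have h: "On_arr (elements_proj J \<phi>) h \<in> hom J (On_obj (elements_proj J \<phi>) (Dom (elements_cat J \<phi>) h))
      (On_obj (elements_proj J \<phi>) (Cod (elements_cat J \<phi>) h))" if "h \<in> Arr (elements_cat J \<phi>)" for h
    using that unfolding a[OF that] o[OF E.Dom_in[OF that]] o[OF E.Cod_in[OF that]]
    by (auto simp: elements_cat_simps)
  have "On_obj (elements_proj J \<phi>) \<in> Obj (elements_cat J \<phi>) \<rightarrow>\<^sub>E Obj J"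
    by (auto simp: elements_proj_def elements_cat_simps)
  moreover have "On_arr (elements_proj J \<phi>) \<in> Arr (elements_cat J \<phi>) \<rightarrow>\<^sub>E Arr J"
    using homD(1)[OF h] by (auto simp: elements_proj_def)
  moreover have "On_arr (elements_proj J \<phi>) (Idn (elements_cat J \<phi>) p) = Idn J (On_obj (elements_proj J \<phi>) p)"
    if "p \<in> Obj (elements_cat J \<phi>)" for p
    using a[OF i[OF that]] o[OF that] by (simp add: elements_cat_simps)
  moreover have "On_arr (elements_proj J \<phi>) (Cmp (elements_cat J \<phi>) g f) =
      Cmp J (On_arr (elements_proj J \<phi>) g) (On_arr (elements_proj J \<phi>) f)" if "f \<in> Arr (elements_cat J \<phi>)"
    "g \<in> Arr (elements_cat J \<phi>)" "Cod (elements_cat J \<phi>) f = Dom (elements_cat J \<phi>) g" for f g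
    unfolding a[OF c[OF that]] a[OF that(1)] a[OF that(2)]
    by (cases f; cases g) (auto simp: elements_cat_simps)
  ultimately show ?thesis unfolding is_functor_def using h by blast
qed

abbreviation elements_diagram :: "('u, 'u) cat \<Rightarrow> 'u psh \<Rightarrow> ('u, 'u, 'o, 'm) ftor \<Rightarrow>
    ('u \<times> 'u, ('u \<times> 'u) \<times> 'u \<times> ('u \<times> 'u), 'o, 'm) ftor" where
  "elements_diagram J \<omega> F \<equiv> comp_functor (elements_cat J \<omega>) F (elements_proj J \<omega>)"

lemma elements_diagram_functor:
  assumes "category J" "presheaf \<Omega> J \<omega>" "is_functor J A F"
  shows "is_functor (elements_cat J \<omega>) A (elements_diagram J \<omega> F)"
  using functor_comp[OF category_elements_cat elements_proj_functor] assms by blast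

lemma elements_diagram_simps:
  "j \<in> Obj J \<Longrightarrow> x \<in> On_obj \<omega> j \<Longrightarrow> On_obj (elements_diagram J \<omega> F) (j, x) = On_obj F j"
  "(p, f, q) \<in> Arr (elements_cat J \<omega>) \<Longrightarrow> On_arr (elements_diagram J \<omega> F) (p, f, q) = On_arr F f"
  by (simp_all add: comp_functor_def elements_proj_def elements_cat_simps)

section \<open>Left Kan extensions along the inclusion of a subcategory\<close>

text \<open>The left Kan extension of \<open>\<psi>\<close> is at \<open>c\<close> the set of pairs of an arrow \<open>h : c \<rightarrow> d\<close> and an element
  \<open>s\<close> of \<open>\<psi> d\<close> (the formal restriction of \<open>s\<close> along \<open>h\<close>), modulo moving arrows of \<open>D\<close> across. The
  object \<open>c\<close> is the source of \<open>h\<close> and need not be recorded.\<close>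

definition lan_step :: "('u, 'u) cat \<Rightarrow> ('u, 'u) cat \<Rightarrow> 'u psh \<Rightarrow> ('u \<times> 'u) rel" where
  "lan_step C D \<psi> = {((Cmp C u h, s), (h, restriction \<psi> u s)) | u h s.
     u \<in> Arr D \<and> h \<in> Arr C \<and> Cod C h = Dom D u \<and> s \<in> On_obj \<psi> (Cod D u)}"

text \<open>The maps \<open>e d\<close> are the unit \<open>\<psi> \<rightarrow> \<phi>\<close>, which may fail to be injective, since \<open>D\<close> need not be full. After
  typing and naturality come surjectivity and the minimality of the identifications.\<close>

definition pointwise_lan :: "('u, 'u) cat \<Rightarrow> ('u, 'u) cat \<Rightarrow> 'u psh \<Rightarrow> 'u psh \<Rightarrow> ('u \<Rightarrow> 'u \<Rightarrow> 'u) \<Rightarrow> bool" where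
  "pointwise_lan C D \<psi> \<phi> e \<longleftrightarrow>
     (\<forall>d \<in> Obj D. \<forall>s \<in> On_obj \<psi> d. e d s \<in> On_obj \<phi> d) \<and>
     (\<forall>u d d' s. u \<in> hom D d d' \<longrightarrow> s \<in> On_obj \<psi> d' \<longrightarrow> e d (restriction \<psi> u s) = restriction \<phi> u (e d' s)) \<and>
     (\<forall>c \<in> Obj C. \<forall>y \<in> On_obj \<phi> c. \<exists>d \<in> Obj D. \<exists>h \<in> hom C c d. \<exists>s \<in> On_obj \<psi> d.
        y = restriction \<phi> h (e d s)) \<and>
     (\<forall>c h h' d d' s s'. h \<in> hom C c d \<longrightarrow> h' \<in> hom C c d' \<longrightarrow> d \<in> Obj D \<longrightarrow> d' \<in> Obj D \<longrightarrow>
        s \<in> On_obj \<psi> d \<longrightarrow> s' \<in> On_obj \<psi> d' \<longrightarrow>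
        restriction \<phi> h (e d s) = restriction \<phi> h' (e d' s') \<longrightarrow> ((h, s), (h', s')) \<in> zigzag (lan_step C D \<psi>))"

lemma pointwise_lanD:
  assumes "pointwise_lan C D \<psi> \<phi> e"
  shows "d \<in> Obj D \<Longrightarrow> s \<in> On_obj \<psi> d \<Longrightarrow> e d s \<in> On_obj \<phi> d"
    and "u \<in> hom D d d' \<Longrightarrow> s \<in> On_obj \<psi> d' \<Longrightarrow> e d (restriction \<psi> u s) = restriction \<phi> u (e d' s)"
    and "c \<in> Obj C \<Longrightarrow> y \<in> On_obj \<phi> c \<Longrightarrow> \<exists>d \<in> Obj D. \<exists>h \<in> hom C c d. \<exists>s \<in> On_obj \<psi> d.
        y = restriction \<phi> h (e d s)"
    and "h \<in> hom C c d \<Longrightarrow> h' \<in> hom C c d' \<Longrightarrow> d \<in> Obj D \<Longrightarrow> d' \<in> Obj D \<Longrightarrow>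
        s \<in> On_obj \<psi> d \<Longrightarrow> s' \<in> On_obj \<psi> d' \<Longrightarrow>
        restriction \<phi> h (e d s) = restriction \<phi> h' (e d' s') \<Longrightarrow> ((h, s), (h', s')) \<in> zigzag (lan_step C D \<psi>)"
  using assms unfolding pointwise_lan_def by blast+

text \<open>A transformation \<open>\<alpha>\<close> defined on \<open>\<psi>\<close> extends to \<open>\<phi>\<close> by sending the restriction along \<open>h\<close> of \<open>e d s\<close> to the
  restriction along \<open>h\<close> of \<open>\<alpha> s\<close>. Naturality of \<open>\<alpha>\<close> makes this constant along zigzags, hence well
  defined.\<close>

lemma pointwise_lan_imp_left_kan_extension:
  assumes C: "category C" and sub: "subcategory D C"
    and psi: "presheaf \<Omega> D \<psi>" and phi: "presheaf \<Omega> C \<phi>" and pl: "pointwise_lan C D \<psi> \<phi> e"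
  shows "is_left_kan_extension (op_cat D) (op_cat C) (set_cat \<Omega>) (incl_functor (op_cat D)) \<psi> \<phi>"
proof -
  interpret C: category C by fact
  interpret D: category D using subcategoryD(1)[OF sub] .
  note D = D.category_axioms
  note pl' = pointwise_lanD[OF pl]
  let ?K = "incl_functor (op_cat D)"
  define \<eta> where "\<eta> = mk_nt D \<psi> e (psh_restrict D \<phi>)"
  have eh: "\<eta> \<in> hom (psh_cat \<Omega> D) \<psi> (psh_restrict D \<phi>)"
    unfolding \<eta>_def
    by (rule mk_nt_hom[OF D psi presheaf_psh_restrict[OF C sub phi]])
      (use pl'(1,2) D.hom_Obj in \<open>simp_all add: homD(1)\<close>)
  have eapp: "nt_app \<eta> d s = e d s" if "d \<in> Obj D" "s \<in> On_obj \<psi> d" for d s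
    unfolding \<eta>_def by (rule nt_app_mk[OF that])
  have "\<exists>!\<beta>. \<beta> \<in> hom (psh_cat \<Omega> C) \<phi> M \<and> Cmp (psh_cat \<Omega> D) (whisker (op_cat D) \<beta> ?K) \<eta> = \<alpha>"
    if M: "presheaf \<Omega> C M" and al: "\<alpha> \<in> hom (psh_cat \<Omega> D) \<psi> (psh_restrict D M)" for M \<alpha>
  proof -
    have aM: "nt_app \<alpha> d s \<in> On_obj M d" if "d \<in> Obj D" "s \<in> On_obj \<psi> d" for d s
      using psh_homD(3)[OF D al that] that by simp
    have anat: "nt_app \<alpha> d (restriction \<psi> u s) = restriction M u (nt_app \<alpha> d' s)"
      if "u \<in> hom D d d'" "s \<in> On_obj \<psi> d'" for u d d' s
      using psh_homD(4)[OF D al that] homD(1)[OF that(1)] by simp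
    have wd: "restriction M h (nt_app \<alpha> d s) = restriction M h' (nt_app \<alpha> d' s')"
      if "h \<in> hom C c d" "h' \<in> hom C c d'" "d \<in> Obj D" "d' \<in> Obj D" "s \<in> On_obj \<psi> d" "s' \<in> On_obj \<psi> d'"
        "restriction \<phi> h (e d s) = restriction \<phi> h' (e d' s')" for c h h' d d' s s'
    proof -
      have "((h, s), (h', s')) \<in> zigzag (lan_step C D \<psi>)" by (rule pl'(4)[OF that])
      then have "(case (h, s) of (h, s) \<Rightarrow> restriction M h (nt_app \<alpha> (Cod C h) s)) =
          (case (h', s') of (h, s) \<Rightarrow> restriction M h (nt_app \<alpha> (Cod C h) s))"
      proof (rule zigzag_invariant)
        fix p q assume "(p, q) \<in> lan_step C D \<psi>"
        then obtain u h s where p: "p = (Cmp C u h, s)" and q: "q = (h, restriction \<psi> u s)"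
          and u: "u \<in> hom D (Dom D u) (Cod D u)" and h: "h \<in> hom C (Dom C h) (Dom D u)"
          and s: "s \<in> On_obj \<psi> (Cod D u)"
          by (auto simp: lan_step_def hom_def)
        have u': "u \<in> hom C (Dom D u) (Cod D u)" using subcategoryD(3)[OF sub u] .
        have "restriction M (Cmp C u h) (nt_app \<alpha> (Cod D u) s) =
            restriction M h (nt_app \<alpha> (Dom D u) (restriction \<psi> u s))"
          using restriction_Cmp[OF C M h u' aM[OF _ s]] anat[OF u s] D.hom_Obj[OF u] by simp
        then show "(case p of (h, s) \<Rightarrow> restriction M h (nt_app \<alpha> (Cod C h) s)) =
            (case q of (h, s) \<Rightarrow> restriction M h (nt_app \<alpha> (Cod C h) s))"
          using homD(3)[OF h] homD(3)[OF C.Cmp_in[OF h u']] by (simp add: p q)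
      qed
      then show ?thesis using that(1,2) by (simp add: homD)
    qed
    have "\<exists>z. \<forall>d \<in> Obj D. \<forall>h \<in> hom C c d. \<forall>s \<in> On_obj \<psi> d.
        y = restriction \<phi> h (e d s) \<longrightarrow> z = restriction M h (nt_app \<alpha> d s)"
      if c: "c \<in> Obj C" and y: "y \<in> On_obj \<phi> c" for c y
      using pl'(3)[OF c y] wd by metis
    then obtain t where t: "\<And>c y d h s. c \<in> Obj C \<Longrightarrow> y \<in> On_obj \<phi> c \<Longrightarrow> d \<in> Obj D \<Longrightarrow> h \<in> hom C c d \<Longrightarrow>
        s \<in> On_obj \<psi> d \<Longrightarrow> y = restriction \<phi> h (e d s) \<Longrightarrow> t c y = restriction M h (nt_app \<alpha> d s)"
      by metis
    have tm: "t c (restriction \<phi> h (e d s)) = restriction M h (nt_app \<alpha> d s)"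
      if "d \<in> Obj D" "h \<in> hom C c d" "s \<in> On_obj \<psi> d" for c d h s
      using t[OF C.hom_Obj(1)[OF that(2)] _ that refl] restriction_in[OF C phi that(2) pl'(1)[OF that(1,3)]]
      by blast
    define \<beta> where "\<beta> = mk_nt C \<phi> t M"
    have bh: "\<beta> \<in> hom (psh_cat \<Omega> C) \<phi> M"
      unfolding \<beta>_def
    proof (rule mk_nt_hom[OF C phi M])
      show "t c a \<in> On_obj M c" if c: "c \<in> Obj C" and a: "a \<in> On_obj \<phi> c" for c a
        using pl'(3)[OF c a] tm restriction_in[OF C M] aM by metis
      show "t x (restriction \<phi> f a) = restriction M f (t y a)"
        if f: "f \<in> hom C x y" and a: "a \<in> On_obj \<phi> y" for f x y a
      proof -
        obtain d h s where d: "d \<in> Obj D" and h: "h \<in> hom C y d" and s: "s \<in> On_obj \<psi> d"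
          and a': "a = restriction \<phi> h (e d s)"
          using pl'(3)[OF C.hom_Obj(2)[OF f] a] by blast
        show ?thesis
          using restriction_Cmp[OF C phi f h pl'(1)[OF d s]] restriction_Cmp[OF C M f h aM[OF d s]]
            tm[OF d C.Cmp_in[OF f h] s] tm[OF d h s] a' by simp
      qed
    qed
    have bapp: "nt_app \<beta> c y = t c y" if "c \<in> Obj C" "y \<in> On_obj \<phi> c" for c y
      unfolding \<beta>_def by (rule nt_app_mk[OF that])
    have te: "t d (e d s) = nt_app \<alpha> d s" if d: "d \<in> Obj D" and s: "s \<in> On_obj \<psi> d" for d s
    proof -
      have dC: "d \<in> Obj C" using subcategoryD(2)[OF sub d] .
      show ?thesis
        using tm[OF d C.Idn_in[OF dC] s] restriction_Idn[OF C phi dC pl'(1)[OF d s]]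
          restriction_Idn[OF C M dC aM[OF d s]] by simp
    qed
    have wapp: "nt_app (Cmp (psh_cat \<Omega> D) (whisker (op_cat D) \<beta>' ?K) \<eta>) d s = nt_app \<beta>' d (e d s)"
      if b: "\<beta>' \<in> hom (psh_cat \<Omega> C) \<phi> M" and d: "d \<in> Obj D" and s: "s \<in> On_obj \<psi> d" for \<beta>' d s
      using nt_app_Cmp[OF D eh whisker_hom(1)[OF C sub b] d s] whisker_hom(2)[OF C sub b d] eapp[OF d s]
      by simp
    show ?thesis
    proof (rule ex1I[of _ \<beta>], intro conjI bh)
      show "Cmp (psh_cat \<Omega> D) (whisker (op_cat D) \<beta> ?K) \<eta> = \<alpha>"
        using wapp[OF bh] bapp[OF subcategoryD(2)[OF sub]] pl'(1) te
        by (intro psh_hom_eqI[OF D Cmp_psh_hom[OF D eh whisker_hom(1)[OF C sub bh]] al]) simp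
    next
      fix \<beta>' assume b: "\<beta>' \<in> hom (psh_cat \<Omega> C) \<phi> M \<and> Cmp (psh_cat \<Omega> D) (whisker (op_cat D) \<beta>' ?K) \<eta> = \<alpha>"
      then have b': "\<beta>' \<in> hom (psh_cat \<Omega> C) \<phi> M" by blast
      show "\<beta>' = \<beta>"
      proof (rule psh_hom_eqI[OF C b' bh])
        fix c y assume c: "c \<in> Obj C" and y: "y \<in> On_obj \<phi> c"
        obtain d h s where d: "d \<in> Obj D" and h: "h \<in> hom C c d" and s: "s \<in> On_obj \<psi> d"
          and y': "y = restriction \<phi> h (e d s)"
          using pl'(3)[OF c y] by blast
        have "nt_app \<beta>' c y = restriction M h (nt_app \<beta>' d (e d s))"
          unfolding y' by (rule psh_homD(4)[OF C b' h pl'(1)[OF d s]])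
        also have "nt_app \<beta>' d (e d s) = nt_app \<alpha> d s" using wapp[OF b' d s] b by simp
        finally show "nt_app \<beta>' c y = nt_app \<beta> c y" using bapp[OF c y] tm[OF d h s] y' by simp
      qed
    qed
  qed
  then show ?thesis unfolding is_left_kan_extension_def using phi eh by blast
qed

text \<open>The element \<open>s\<close> of \<open>\<psi> d\<close> gives, by the Yoneda lemma applied to its image under the unit, an arrow
  from the representable of \<open>d\<close> to \<open>\<phi>\<close>; these form the colimit cocone. A cocone \<open>\<nu>\<close> with vertex \<open>b\<close> conversely
  yields a transformation \<open>\<alpha>\<close> from \<open>\<psi>\<close> to the restriction of \<open>b\<close> by evaluation at identities, and
  an arrow \<open>\<phi> \<rightarrow> b\<close> factors the one exactly when it factors the other.\<close>

lemma left_kan_extension_imp_weighted_colimit: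
  assumes ls: "locally_small \<Omega> C" and sub: "subcategory D C"
    and lan: "is_left_kan_extension (op_cat D) (op_cat C) (set_cat \<Omega>) (incl_functor (op_cat D)) \<psi> \<phi>"
  shows "is_weighted_colimit D (psh_cat \<Omega> C) \<psi> (comp_functor D (yoneda C) (incl_functor D)) \<phi>"
proof -
  interpret C: category C using ls by (simp add: locally_small_def)
  note C = C.category_axioms
  interpret D: category D using subcategoryD(1)[OF sub] .
  note D = D.category_axioms
  let ?K = "incl_functor (op_cat D)" and ?Y = "comp_functor D (yoneda C) (incl_functor D)"
  obtain \<eta> where phi: "presheaf \<Omega> C \<phi>" and eh: "\<eta> \<in> hom (psh_cat \<Omega> D) \<psi> (psh_restrict D \<phi>)"
    and univ: "\<And>M \<alpha>. presheaf \<Omega> C M \<Longrightarrow> \<alpha> \<in> hom (psh_cat \<Omega> D) \<psi> (psh_restrict D M) \<Longrightarrow>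
      \<exists>!\<beta>. \<beta> \<in> hom (psh_cat \<Omega> C) \<phi> M \<and> Cmp (psh_cat \<Omega> D) (whisker (op_cat D) \<beta> ?K) \<eta> = \<alpha>"
    using lan unfolding is_left_kan_extension_def by blast
  have psi: "presheaf \<Omega> D \<psi>" using psh_homD(1)[OF D eh] .
  define E where "E = elements_cat D \<psi>"
  define F where "F = elements_diagram D \<psi> ?Y"
  have E: "category E" unfolding E_def by (rule category_elements_cat[OF D psi])
  have F: "is_functor E (psh_cat \<Omega> C) F"
    unfolding F_def E_def
    by (rule elements_diagram_functor[OF D psi functor_comp[OF D incl_functor_functor[OF sub] yoneda_functor[OF ls]]])
  have EO: "Obj E = {(d, s). d \<in> Obj D \<and> s \<in> On_obj \<psi> d}" by (simp add: E_def elements_cat_simps)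
  have Fo: "On_obj F (d, s) = yoneda_obj C d" if "d \<in> Obj D" "s \<in> On_obj \<psi> d" for d s
    unfolding F_def elements_diagram_simps(1)[OF that]
    using that subcategoryD(2)[OF sub] by (simp add: comp_functor_def incl_functor_def yoneda_def)
  have EA: "\<exists>d s u d' s'. a = ((d, s), u, (d', s')) \<and> d \<in> Obj D \<and> d' \<in> Obj D \<and> s' \<in> On_obj \<psi> d' \<and>
      u \<in> hom D d d' \<and> s = restriction \<psi> u s' \<and> s \<in> On_obj \<psi> d \<and> On_arr F a = On_arr (yoneda C) u"
    if a: "a \<in> Arr E" for a
  proof -
    obtain d s u d' s' where "a = ((d, s), u, (d', s'))" "s' \<in> On_obj \<psi> d'" and u: "u \<in> hom D d d'"
      "s = restriction \<psi> u s'" "s \<in> On_obj \<psi> d"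
      using a by (auto simp: E_def elements_cat_simps)
    moreover have "On_arr F ((d, s), u, (d', s')) = On_arr ?Y u"
      unfolding F_def by (rule elements_diagram_simps(2)) (use a calculation in \<open>simp add: E_def\<close>)
    ultimately show ?thesis
      using D.hom_Obj[OF u(1)] by (simp add: comp_functor_def incl_functor_def homD)
  qed
  have sC: "d \<in> Obj D \<Longrightarrow> d \<in> Obj C" for d by (rule subcategoryD(2)[OF sub])
  have ein: "nt_app \<eta> d s \<in> On_obj \<phi> d" if "d \<in> Obj D" "s \<in> On_obj \<psi> d" for d s
    using psh_homD(3)[OF D eh that] that by simp
  have enat: "nt_app \<eta> d (restriction \<psi> u s) = restriction \<phi> u (nt_app \<eta> d' s)"
    if "u \<in> hom D d d'" "s \<in> On_obj \<psi> d'" for u d d' s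
    using psh_homD(4)[OF D eh that] homD(1)[OF that(1)] by simp
  define \<mu> where "\<mu> = (\<lambda>(d, s). mk_nt C (yoneda_obj C d) (\<lambda>x h. restriction \<phi> h (nt_app \<eta> d s)) \<phi>)"
  have mh: "\<mu> (d, s) \<in> hom (psh_cat \<Omega> C) (yoneda_obj C d) \<phi>" if d: "d \<in> Obj D" and s: "s \<in> On_obj \<psi> d" for d s
    unfolding \<mu>_def prod.case
  proof (rule mk_nt_hom[OF C presheaf_yoneda_obj[OF ls sC[OF d]] phi])
    show "restriction \<phi> a (nt_app \<eta> d s) \<in> On_obj \<phi> c" if "c \<in> Obj C" "a \<in> On_obj (yoneda_obj C d) c" for c a
      using that restriction_in[OF C phi _ ein[OF d s]] by (simp add: yoneda_obj_obj)
    show "restriction \<phi> (restriction (yoneda_obj C d) f a) (nt_app \<eta> d s) =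
        restriction \<phi> f (restriction \<phi> a (nt_app \<eta> d s))"
      if f: "f \<in> hom C x y" and a: "a \<in> On_obj (yoneda_obj C d) y" for f x y a
    proof -
      have a': "a \<in> hom C y d" using a C.hom_Obj[OF f] by (simp add: yoneda_obj_obj)
      show ?thesis
        using restriction_Cmp[OF C phi f a' ein[OF d s]] yoneda_obj_restriction[OF f a'] by simp
    qed
  qed
  have mapp: "nt_app (\<mu> (d, s)) c h = restriction \<phi> h (nt_app \<eta> d s)" if "h \<in> hom C c d" for d s c h
    unfolding \<mu>_def prod.case using that C.hom_Obj[OF that] by (simp add: nt_app_mk yoneda_obj_obj)
  have mu: "is_cocone E (psh_cat \<Omega> C) F \<phi> \<mu>"
  proof (rule psh_coconeI[OF C E F phi])
    show "\<mu> i \<in> hom (psh_cat \<Omega> C) (On_obj F i) \<phi>" if "i \<in> Obj E" for i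
      using that mh Fo by (auto simp: EO)
    fix a c x assume a: "a \<in> Arr E" and c: "c \<in> Obj C" and x: "x \<in> On_obj (On_obj F (Dom E a)) c"
    obtain d s u d' s' where aE: "a = ((d, s), u, (d', s'))" and d: "d \<in> Obj D" "d' \<in> Obj D" and s': "s' \<in> On_obj \<psi> d'"
      and u: "u \<in> hom D d d'" and s: "s = restriction \<psi> u s'" "s \<in> On_obj \<psi> d"
      and Fa: "On_arr F a = On_arr (yoneda C) u"
      using EA[OF a] by blast
    note uC = subcategoryD(3)[OF sub u]
    have x': "x \<in> hom C c d" using x c by (simp add: aE E_def elements_cat_simps Fo[OF d(1) s(2)] yoneda_obj_obj)
    have "nt_app (\<mu> (d', s')) c (nt_app (On_arr F a) c x) = restriction \<phi> (Cmp C u x) (nt_app \<eta> d' s')"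
      unfolding Fa yoneda_arr_hom(2)[OF ls uC x'] by (rule mapp[OF C.Cmp_in[OF x' uC]])
    also have "\<dots> = restriction \<phi> x (nt_app \<eta> d s)"
      using restriction_Cmp[OF C phi x' uC ein[OF d(2) s']] enat[OF u s'] s(1) by simp
    also have "\<dots> = nt_app (\<mu> (d, s)) c x" using mapp[OF x'] by simp
    finally show "nt_app (\<mu> (Cod E a)) c (nt_app (On_arr F a) c x) = nt_app (\<mu> (Dom E a)) c x"
      by (simp add: aE E_def elements_cat_simps)
  qed
  have "\<exists>!\<beta>. \<beta> \<in> hom (psh_cat \<Omega> C) \<phi> b \<and> (\<forall>i \<in> Obj E. Cmp (psh_cat \<Omega> C) \<beta> (\<mu> i) = \<nu> i)"
    if nu: "is_cocone E (psh_cat \<Omega> C) F b \<nu>" for b \<nu>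
  proof -
    have b: "presheaf \<Omega> C b" using nu by (simp add: is_cocone_def)
    have nh: "\<nu> (d, s) \<in> hom (psh_cat \<Omega> C) (yoneda_obj C d) b" if "d \<in> Obj D" "s \<in> On_obj \<psi> d" for d s
      using nu that Fo by (auto simp: is_cocone_def EO)
    have id: "Idn C d \<in> On_obj (yoneda_obj C d) d" if "d \<in> Obj D" for d
      using C.Idn_in[OF sC[OF that]] sC[OF that] by (simp add: yoneda_obj_obj)
    have nuh: "nt_app (\<nu> (d, s)) c h = restriction b h (nt_app (\<nu> (d, s)) d (Idn C d))"
      if d: "d \<in> Obj D" and s: "s \<in> On_obj \<psi> d" and h: "h \<in> hom C c d" for d s c h
      using psh_homD(4)[OF C nh[OF d s] h id[OF d]] yoneda_obj_restriction[OF h C.Idn_in[OF sC[OF d]]]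
        C.Cmp_Idn_left[OF h] by simp
    define t where "t d s = nt_app (\<nu> (d, s)) d (Idn C d)" for d s
    have tin: "t d s \<in> On_obj b d" if "d \<in> Obj D" "s \<in> On_obj \<psi> d" for d s
      unfolding t_def using psh_homD(3)[OF C nh[OF that] sC[OF that(1)] id[OF that(1)]] .
    have tnat: "t d (restriction \<psi> u s) = restriction b u (t d' s)"
      if u: "u \<in> hom D d d'" and s: "s \<in> On_obj \<psi> d'" for u d d' s
    proof -
      note uC = subcategoryD(3)[OF sub u] and d = D.hom_Obj[OF u]
      let ?s = "restriction \<psi> u s"
      have s2: "?s \<in> On_obj \<psi> d" by (rule restriction_in[OF D psi u s])
      have a: "((d, ?s), u, (d', s)) \<in> Arr E" using u s s2 by (auto simp: E_def elements_cat_simps)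
      have Fa: "On_arr F ((d, ?s), u, (d', s)) = On_arr (yoneda C) u" using EA[OF a] by auto
      have x: "Idn C d \<in> On_obj (On_obj F (d, ?s)) d" using Fo[OF d(1) s2] id[OF d(1)] by simp
      have "nt_app (\<nu> (d', s)) d (nt_app (On_arr (yoneda C) u) d (Idn C d)) = t d ?s"
        using cocone_app(2)[OF C F E nu sC[OF d(1)] a, of "Idn C d"] x Fa
        by (simp add: E_def elements_cat_simps t_def)
      moreover have "nt_app (On_arr (yoneda C) u) d (Idn C d) = u"
        using yoneda_arr_hom(2)[OF ls uC C.Idn_in[OF sC[OF d(1)]]] C.Cmp_Idn_right[OF uC] by simp
      ultimately show ?thesis using nuh[OF d(2) s uC] by (simp add: t_def)
    qed
    define \<alpha> where "\<alpha> = mk_nt D \<psi> t (psh_restrict D b)"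
    have ah: "\<alpha> \<in> hom (psh_cat \<Omega> D) \<psi> (psh_restrict D b)"
      unfolding \<alpha>_def
      by (rule mk_nt_hom[OF D psi presheaf_psh_restrict[OF C sub b]])
        (use tin tnat D.hom_Obj in \<open>simp_all add: homD(1)\<close>)
    have aapp: "nt_app \<alpha> d s = t d s" if "d \<in> Obj D" "s \<in> On_obj \<psi> d" for d s
      unfolding \<alpha>_def by (rule nt_app_mk[OF that])
    have wapp: "nt_app (Cmp (psh_cat \<Omega> D) (whisker (op_cat D) \<beta>' ?K) \<eta>) d s = nt_app \<beta>' d (nt_app \<eta> d s)"
      if b: "\<beta>' \<in> hom (psh_cat \<Omega> C) \<phi> b" and d: "d \<in> Obj D" and s: "s \<in> On_obj \<psi> d" for \<beta>' d s
      using nt_app_Cmp[OF D eh whisker_hom(1)[OF C sub b] d s] whisker_hom(2)[OF C sub b d]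
      by simp
    have iff: "(\<forall>i \<in> Obj E. Cmp (psh_cat \<Omega> C) \<beta> (\<mu> i) = \<nu> i) \<longleftrightarrow>
        Cmp (psh_cat \<Omega> D) (whisker (op_cat D) \<beta> ?K) \<eta> = \<alpha>"
      if be: "\<beta> \<in> hom (psh_cat \<Omega> C) \<phi> b" for \<beta>
    proof
      assume L: "\<forall>i \<in> Obj E. Cmp (psh_cat \<Omega> C) \<beta> (\<mu> i) = \<nu> i"
      have "nt_app \<beta> d (nt_app \<eta> d s) = t d s" if d: "d \<in> Obj D" and s: "s \<in> On_obj \<psi> d" for d s
      proof -
        have "t d s = nt_app \<beta> d (nt_app (\<mu> (d, s)) d (Idn C d))"
          using L d s nt_app_Cmp[OF C mh[OF d s] be sC[OF d] id[OF d]] by (simp add: t_def EO)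
        then show ?thesis
          using mapp[OF C.Idn_in[OF sC[OF d]], of s] restriction_Idn[OF C phi sC[OF d] ein[OF d s]] by simp
      qed
      then show "Cmp (psh_cat \<Omega> D) (whisker (op_cat D) \<beta> ?K) \<eta> = \<alpha>"
        using wapp[OF be] aapp
        by (intro psh_hom_eqI[OF D Cmp_psh_hom[OF D eh whisker_hom(1)[OF C sub be]] ah]) simp
    next
      assume R: "Cmp (psh_cat \<Omega> D) (whisker (op_cat D) \<beta> ?K) \<eta> = \<alpha>"
      have "Cmp (psh_cat \<Omega> C) \<beta> (\<mu> (d, s)) = \<nu> (d, s)" if d: "d \<in> Obj D" and s: "s \<in> On_obj \<psi> d" for d s
      proof (rule psh_hom_eqI[OF C Cmp_psh_hom[OF C mh[OF d s] be] nh[OF d s]])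
        fix c h assume c: "c \<in> Obj C" and h: "h \<in> On_obj (yoneda_obj C d) c"
        then have h': "h \<in> hom C c d" by (simp add: yoneda_obj_obj)
        have "nt_app (Cmp (psh_cat \<Omega> C) \<beta> (\<mu> (d, s))) c h = nt_app \<beta> c (restriction \<phi> h (nt_app \<eta> d s))"
          using nt_app_Cmp[OF C mh[OF d s] be c h] mapp[OF h'] by simp
        also have "\<dots> = restriction b h (nt_app \<beta> d (nt_app \<eta> d s))"
          by (rule psh_homD(4)[OF C be h' ein[OF d s]])
        also have "nt_app \<beta> d (nt_app \<eta> d s) = t d s" using wapp[OF be d s] R aapp[OF d s] by simp
        also have "restriction b h (t d s) = nt_app (\<nu> (d, s)) c h" using nuh[OF d s h'] by (simp add: t_def)
        finally show "nt_app (Cmp (psh_cat \<Omega> C) \<beta> (\<mu> (d, s))) c h = nt_app (\<nu> (d, s)) c h" .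
      qed
      then show "\<forall>i \<in> Obj E. Cmp (psh_cat \<Omega> C) \<beta> (\<mu> i) = \<nu> i" by (auto simp: EO)
    qed
    show ?thesis using univ[OF b ah] iff by metis
  qed
  then show ?thesis
    unfolding is_weighted_colimit_def is_colimit_def using mu by (auto simp: E_def F_def)
qed


section \<open>Subpresheaves on a subcategory\<close>

lemma presheaf_subpresheaf:
  assumes C: "category C" and sub: "subcategory E C" and F: "presheaf \<Omega> C F"
    and le: "\<And>c. c \<in> Obj E \<Longrightarrow> P c \<subseteq> On_obj F c"
    and st: "\<And>f x y a. f \<in> hom E x y \<Longrightarrow> a \<in> P y \<Longrightarrow> restriction F f a \<in> P x"
  shows "presheaf \<Omega> E (mk_psh E P (restriction F))"
proof -
  interpret E: category E using subcategoryD(1)[OF sub] .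
  show ?thesis
  proof (rule presheaf_mk_psh[OF E.category_axioms _ st])
    show "|P c| <o \<Omega>" if "c \<in> Obj E" for c
      using card_of_subset_less[OF presheaf_small[OF C F subcategoryD(2)[OF sub that]] le[OF that]] .
    show "restriction F (Idn E c) a = a" if "c \<in> Obj E" "a \<in> P c" for c a
      using restriction_Idn[OF C F subcategoryD(2)[OF sub that(1)]] le[OF that(1)] that(2)
        subcategoryD(4)[OF sub that(1)] by auto
    show "restriction F (Cmp E g f) a = restriction F f (restriction F g a)"
      if f: "f \<in> hom E x y" and g: "g \<in> hom E y z" and a: "a \<in> P z" for f g x y z a
      using restriction_Cmp[OF C F subcategoryD(3)[OF sub f] subcategoryD(3)[OF sub g]]
        le[OF E.hom_Obj(2)[OF g]] a subcategoryD(5)[OF sub f g] by auto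
  qed
qed

text \<open>The subpresheaf of the restriction of \<open>F\<close> to \<open>E\<close> that is generated by the elements \<open>e d s\<close>.\<close>

definition image_psh :: "('u, 'u) cat \<Rightarrow> ('u, 'u) cat \<Rightarrow> 'u psh \<Rightarrow> 'u psh \<Rightarrow> ('u \<Rightarrow> 'u \<Rightarrow> 'u) \<Rightarrow> 'u psh" where
  "image_psh E D \<psi> F e = mk_psh E (\<lambda>c. {restriction F h (e d s) | h d s.
     h \<in> hom E c d \<and> d \<in> Obj D \<and> s \<in> On_obj \<psi> d}) (restriction F)"

lemma image_psh_obj:
  "c \<in> Obj E \<Longrightarrow> On_obj (image_psh E D \<psi> F e) c =
     {restriction F h (e d s) | h d s. h \<in> hom E c d \<and> d \<in> Obj D \<and> s \<in> On_obj \<psi> d}"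
  unfolding image_psh_def by (rule mk_psh_obj)

lemma image_psh_restriction:
  assumes "category E" "f \<in> hom E x y" "a \<in> On_obj (image_psh E D \<psi> F e) y"
  shows "restriction (image_psh E D \<psi> F e) f a = restriction F f a"
proof -
  interpret category E by fact
  show ?thesis
    unfolding image_psh_def
    by (rule mk_psh_restriction[OF homD(1)[OF assms(2)]])
      (use assms(2,3) image_psh_obj[OF hom_Obj(2)[OF assms(2)]] in \<open>simp add: homD\<close>)
qed

lemma
  assumes C: "category C" and sub: "subcategory E C" and F: "presheaf \<Omega> C F"
    and e: "\<And>d s. d \<in> Obj D \<Longrightarrow> s \<in> On_obj \<psi> d \<Longrightarrow> e d s \<in> On_obj F d"
  shows image_psh_le: "c \<in> Obj E \<Longrightarrow> On_obj (image_psh E D \<psi> F e) c \<subseteq> On_obj F c"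
    and presheaf_image_psh: "presheaf \<Omega> E (image_psh E D \<psi> F e)"
proof -
  interpret E: category E using subcategoryD(1)[OF sub] .
  let ?P = "\<lambda>c. {restriction F h (e d s) | h d s. h \<in> hom E c d \<and> d \<in> Obj D \<and> s \<in> On_obj \<psi> d}"
  have le: "?P c \<subseteq> On_obj F c" for c
    using restriction_in[OF C F subcategoryD(3)[OF sub] e] by blast
  then show "c \<in> Obj E \<Longrightarrow> On_obj (image_psh E D \<psi> F e) c \<subseteq> On_obj F c"
    by (simp add: image_psh_obj)
  show "presheaf \<Omega> E (image_psh E D \<psi> F e)"
    unfolding image_psh_def
  proof (rule presheaf_subpresheaf[OF C sub F le])
    fix f x y a assume f: "f \<in> hom E x y" and "a \<in> ?P y"
    then obtain h d s where h: "h \<in> hom E y d" "d \<in> Obj D" "s \<in> On_obj \<psi> d" "a = restriction F h (e d s)"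
      by blast
    have "restriction F f a = restriction F (Cmp E h f) (e d s)"
      using restriction_Cmp[OF C F subcategoryD(3)[OF sub f] subcategoryD(3)[OF sub h(1)] e[OF h(2,3)]]
        subcategoryD(5)[OF sub f h(1)] h(4) by simp
    then show "restriction F f a \<in> ?P x" using E.Cmp_in[OF f h(1)] h(2,3) by blast
  qed
qed

lemma subcategory_subcategory:
  assumes D: "subcategory D C" and E: "subcategory E C" and le: "Arr D \<subseteq> Arr E"
  shows "subcategory D E"
proof -
  interpret D: category D using subcategoryD(1)[OF D] .
  interpret E: category E using subcategoryD(1)[OF E] .
  have o: "d \<in> Obj E" if "d \<in> Obj D" for d
  proof -
    have "Idn D d \<in> Arr E" "Dom D (Idn D d) = d" using D.Idn_in[OF that] le by (auto simp: hom_def)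
    moreover have "Dom D (Idn D d) = Dom E (Idn D d)"
      using D E D.Idn_in[OF that] le unfolding subcategory_def by (auto simp: hom_def)
    ultimately show ?thesis using E.Dom_in by metis
  qed
  have dc: "Dom D f = Dom E f \<and> Cod D f = Cod E f" if "f \<in> Arr D" for f
    using D E le that unfolding subcategory_def by auto
  have "Cmp D g f = Cmp E g f" if "f \<in> Arr D" "g \<in> Arr D" "Cod D f = Dom D g" for f g
    using D E le that dc[OF that(1)] dc[OF that(2)] unfolding subcategory_def by (metis subsetD)
  then show ?thesis
    using D E o le dc D.category_axioms unfolding subcategory_def by auto
qed

text \<open>The arrow \<open>h\<close> is the only ingredient of a step taken from \<open>C\<close>: once it is in \<open>E\<close>, so is its
  composite with an arrow of \<open>D\<close>.\<close>

lemma lan_step_subcategory: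
  assumes E: "subcategory E C" and D: "subcategory D E"
  shows "{p \<in> lan_step C D \<psi>. fst (snd p) \<in> Arr E} \<subseteq> lan_step E D \<psi>"
proof
  fix p assume "p \<in> {p \<in> lan_step C D \<psi>. fst (snd p) \<in> Arr E}"
  then obtain u h s where p: "p = ((Cmp C u h, s), (h, restriction \<psi> u s))"
    and u: "u \<in> Arr D" and h: "h \<in> Arr E" "Cod C h = Dom D u" and s: "s \<in> On_obj \<psi> (Cod D u)"
    unfolding lan_step_def by auto
  have "Cod E h = Cod C h" "u \<in> Arr E" "Dom E u = Dom D u"
    using E D u h unfolding subcategory_def by auto
  moreover from this have "Cmp E u h = Cmp C u h"
    using E h unfolding subcategory_def by auto
  ultimately have "Cmp E u h = Cmp C u h" and "Cod E h = Dom D u" using h by simp_all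
  then have "((Cmp E u h, s), (h, restriction \<psi> u s)) \<in> lan_step E D \<psi>"
    unfolding lan_step_def using u h(1) s by blast
  then show "p \<in> lan_step E D \<psi>" using p \<open>Cmp E u h = Cmp C u h\<close> by simp
qed


section \<open>A diagram of generated presheaves\<close>

text \<open>A diagram of presheaves generated over subcategories \<open>D j\<close>, its weighted colimit \<open>\<phi>\<close>, and a
  subcategory \<open>E\<close> rich enough for the diagram to descend to it. The last three assumptions are the
  richness: identifications in \<open>F j\<close> between elements coming from \<open>E\<close> are witnessed in \<open>E\<close>; the arrows
  \<open>F f\<close> take generators to elements generated over \<open>E\<close>; and identifications in the colimit are
  witnessed by zigzags through elements generated over \<open>E\<close>. The bound \<open>\<kappa>\<close> enters
  only when such an \<open>E\<close> is constructed.\<close>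

locale generated_diagram =
  fixes \<Omega> :: "'u rel" and C J :: "('u, 'u) cat" and \<omega> :: "'u psh"
    and F :: "('u, 'u, 'u psh, 'u psh_arr) ftor" and \<phi> :: "'u psh" and \<mu> :: "'u \<times> 'u \<Rightarrow> 'u psh_arr"
    and D :: "'u \<Rightarrow> ('u, 'u) cat" and \<psi> :: "'u \<Rightarrow> 'u psh" and e :: "'u \<Rightarrow> 'u \<Rightarrow> 'u \<Rightarrow> 'u"
    and E :: "('u, 'u) cat"
  assumes C: "category C" and J: "category J" and om: "presheaf \<Omega> J \<omega>"
    and F: "is_functor J (psh_cat \<Omega> C) F"
    and mu: "is_cocone (elements_cat J \<omega>) (psh_cat \<Omega> C) (elements_diagram J \<omega> F) \<phi> \<mu>"
    and pw: "pointwise_colimit (elements_cat J \<omega>) C (elements_diagram J \<omega> F) \<phi> \<mu>"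
    and D: "\<And>j. j \<in> Obj J \<Longrightarrow> subcategory (D j) C"
    and pl: "\<And>j. j \<in> Obj J \<Longrightarrow> pointwise_lan C (D j) (\<psi> j) (On_obj F j) (e j)"
    and E: "subcategory E C"
    and arrows: "\<And>j. j \<in> Obj J \<Longrightarrow> Arr (D j) \<subseteq> Arr E"
    and lan_zigzag: "\<And>j c h h' d d' s s'. j \<in> Obj J \<Longrightarrow> h \<in> hom E c d \<Longrightarrow> h' \<in> hom E c d' \<Longrightarrow>
        d \<in> Obj (D j) \<Longrightarrow> d' \<in> Obj (D j) \<Longrightarrow> s \<in> On_obj (\<psi> j) d \<Longrightarrow> s' \<in> On_obj (\<psi> j) d' \<Longrightarrow>
        restriction (On_obj F j) h (e j d s) = restriction (On_obj F j) h' (e j d' s') \<Longrightarrow>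
        ((h, s), (h', s')) \<in> zigzag (lan_step E (D j) (\<psi> j))"
    and transport: "\<And>f j j' d s. f \<in> hom J j j' \<Longrightarrow> d \<in> Obj (D j) \<Longrightarrow> s \<in> On_obj (\<psi> j) d \<Longrightarrow>
        nt_app (On_arr F f) d (e j d s) \<in> On_obj (image_psh E (D j') (\<psi> j') (On_obj F j') (e j')) d"
    and colim_zigzag: "\<And>c i i' z z'. c \<in> Obj E \<Longrightarrow> i \<in> Obj (elements_cat J \<omega>) \<Longrightarrow> i' \<in> Obj (elements_cat J \<omega>) \<Longrightarrow>
        z \<in> On_obj (image_psh E (D (fst i)) (\<psi> (fst i)) (On_obj F (fst i)) (e (fst i))) c \<Longrightarrow>
        z' \<in> On_obj (image_psh E (D (fst i')) (\<psi> (fst i')) (On_obj F (fst i')) (e (fst i'))) c \<Longrightarrow>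
        ((i, z), (i', z')) \<in> zigzag (colim_step (elements_cat J \<omega>) (elements_diagram J \<omega> F) c) \<Longrightarrow>
        ((i, z), (i', z')) \<in> zigzag {((k, a), q) \<in> colim_step (elements_cat J \<omega>) (elements_diagram J \<omega> F) c.
           a \<in> On_obj (image_psh E (D (fst k)) (\<psi> (fst k)) (On_obj F (fst k)) (e (fst k))) c}"
begin

text \<open>The weighted colimit of \<open>F\<close> is the ordinary colimit of \<open>G\<close> over \<open>I\<close>; \<open>S\<close>, \<open>SF\<close> and \<open>T\<close> are
  the values over \<open>E\<close> of the diagram, the diagram itself, and its colimit.\<close>

definition "I = elements_cat J \<omega>"
definition "G = elements_diagram J \<omega> F"
definition "S j = image_psh E (D j) (\<psi> j) (On_obj F j) (e j)"
definition "SF = \<lparr>On_obj = (\<lambda>j \<in> Obj J. S j),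
  On_arr = (\<lambda>f \<in> Arr J. mk_nt E (S (Dom J f)) (nt_app (On_arr F f)) (S (Cod J f)))\<rparr>"
definition "T = mk_psh E (\<lambda>c. {nt_app (\<mu> i) c z | i z. i \<in> Obj I \<and> z \<in> On_obj (S (fst i)) c}) (restriction \<phi>)"

sublocale C: category C by (rule C)
sublocale J: category J by (rule J)
sublocale E: category E by (rule subcategoryD(1)[OF E])

lemma I: "category I"
  unfolding I_def by (rule category_elements_cat[OF J om])

lemma G: "is_functor I (psh_cat \<Omega> C) G"
  unfolding I_def G_def by (rule elements_diagram_functor[OF J om F])

lemma mu': "is_cocone I (psh_cat \<Omega> C) G \<phi> \<mu>"
  unfolding I_def G_def by (rule mu)

lemma pw': "pointwise_colimit I C G \<phi> \<mu>"
  unfolding I_def G_def by (rule pw)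

lemma Obj_I_iff: "i \<in> Obj I \<longleftrightarrow> fst i \<in> Obj J \<and> snd i \<in> On_obj \<omega> (fst i)"
  by (cases i) (simp add: I_def elements_cat_simps)

lemma On_obj_G: "i \<in> Obj I \<Longrightarrow> On_obj G i = On_obj F (fst i)"
  unfolding G_def by (cases i) (simp add: elements_diagram_simps Obj_I_iff)

lemma Arr_I_cases:
  assumes "a \<in> Arr I"
  obtains p f q where "a = (p, f, q)" "p \<in> Obj I" "q \<in> Obj I" "f \<in> hom J (fst p) (fst q)"
    "Dom I a = p" "Cod I a = q" "On_arr G a = On_arr F f"
proof -
  obtain p f q where a: "a = (p, f, q)" and f: "f \<in> hom J (fst p) (fst q)"
    using assms by (auto simp: I_def elements_cat_simps)
  interpret I: category I by (rule I)
  have dc: "Dom I a = p" "Cod I a = q" unfolding a I_def by (simp_all add: elements_cat_simps)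
  have "On_arr G a = On_arr F f"
    unfolding G_def a by (rule elements_diagram_simps(2)) (use assms in \<open>simp add: a I_def\<close>)
  with a f dc I.Dom_in[OF assms] I.Cod_in[OF assms] show ?thesis by (intro that) simp_all
qed

lemma F_presheaf: "j \<in> Obj J \<Longrightarrow> presheaf \<Omega> C (On_obj F j)"
  by (rule functor_to_psh_catD(1)[OF F])

lemma F_hom: "f \<in> hom J j j' \<Longrightarrow> On_arr F f \<in> hom (psh_cat \<Omega> C) (On_obj F j) (On_obj F j')"
  using functor_to_psh_catD(2)[OF F, of f] by (simp add: hom_def[of J])

lemma mu_hom: "i \<in> Obj I \<Longrightarrow> \<mu> i \<in> hom (psh_cat \<Omega> C) (On_obj F (fst i)) \<phi>"
  using mu' On_obj_G[of i] unfolding is_cocone_def by metis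

lemma phi: "presheaf \<Omega> C \<phi>"
  using mu by (simp add: is_cocone_def)

lemma mu_step: "a \<in> Arr I \<Longrightarrow> c \<in> Obj C \<Longrightarrow> x \<in> On_obj (On_obj G (Dom I a)) c \<Longrightarrow>
    nt_app (\<mu> (Cod I a)) c (nt_app (On_arr G a) c x) = nt_app (\<mu> (Dom I a)) c x"
  using cocone_app(2)[OF C G I mu'] .

lemma E_imp_C: "c \<in> Obj E \<Longrightarrow> c \<in> Obj C" "f \<in> hom E x y \<Longrightarrow> f \<in> hom C x y"
  using subcategoryD(2,3)[OF E] by blast+

lemma D_subcategory_E: "j \<in> Obj J \<Longrightarrow> subcategory (D j) E"
  using subcategory_subcategory[OF D E arrows] .

lemma S_presheaf: "j \<in> Obj J \<Longrightarrow> presheaf \<Omega> E (S j)"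
  unfolding S_def by (rule presheaf_image_psh[OF C E F_presheaf pointwise_lanD(1)[OF pl]])

lemma S_le: "j \<in> Obj J \<Longrightarrow> c \<in> Obj E \<Longrightarrow> z \<in> On_obj (S j) c \<Longrightarrow> z \<in> On_obj (On_obj F j) c"
  unfolding S_def by (rule subsetD[OF image_psh_le[OF C E F_presheaf pointwise_lanD(1)[OF pl]]])

lemma S_restriction: "f \<in> hom E x y \<Longrightarrow> a \<in> On_obj (S j) y \<Longrightarrow>
    restriction (S j) f a = restriction (On_obj F j) f a"
  unfolding S_def by (rule image_psh_restriction[OF E.category_axioms])

lemma S_stable: "j \<in> Obj J \<Longrightarrow> f \<in> hom E x y \<Longrightarrow> a \<in> On_obj (S j) y \<Longrightarrow>
    restriction (On_obj F j) f a \<in> On_obj (S j) x"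
  using restriction_in[OF E.category_axioms S_presheaf] S_restriction by metis

lemma S_obj: "c \<in> Obj E \<Longrightarrow> z \<in> On_obj (S j) c \<longleftrightarrow> (\<exists>h d s. h \<in> hom E c d \<and> d \<in> Obj (D j) \<and>
    s \<in> On_obj (\<psi> j) d \<and> z = restriction (On_obj F j) h (e j d s))"
  unfolding S_def image_psh_obj by auto

lemma unit_in_S: "j \<in> Obj J \<Longrightarrow> d \<in> Obj (D j) \<Longrightarrow> s \<in> On_obj (\<psi> j) d \<Longrightarrow> e j d s \<in> On_obj (S j) d"
proof -
  assume j: "j \<in> Obj J" and d: "d \<in> Obj (D j)" and s: "s \<in> On_obj (\<psi> j) d"
  have dE: "d \<in> Obj E" using subcategoryD(2)[OF D_subcategory_E[OF j] d] .
  show ?thesis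
    using restriction_Idn[OF C F_presheaf[OF j] E_imp_C(1)[OF dE] pointwise_lanD(1)[OF pl[OF j] d s]]
      subcategoryD(4)[OF E dE] E.Idn_in[OF dE] d s unfolding S_obj[OF dE] by metis
qed

text \<open>\<open>S j\<close> is generated by \<open>\<psi> j\<close> by construction, and the first richness assumption says
  that it makes no identifications beyond those witnessed over \<open>E\<close>. Thus it is a weighted colimit of representables on \<open>E\<close>.\<close>

lemma S_pointwise_lan:
  assumes j: "j \<in> Obj J"
  shows "pointwise_lan E (D j) (\<psi> j) (S j) (e j)"
  unfolding pointwise_lan_def
proof (intro conjI ballI allI impI)
  interpret Dj: category "D j" using subcategoryD(1)[OF D[OF j]] .
  show "e j d s \<in> On_obj (S j) d" if "d \<in> Obj (D j)" "s \<in> On_obj (\<psi> j) d" for d s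
    using unit_in_S[OF j that] .
  show "e j d (restriction (\<psi> j) u s) = restriction (S j) u (e j d' s)"
    if u: "u \<in> hom (D j) d d'" and s: "s \<in> On_obj (\<psi> j) d'" for u d d' s
    using pointwise_lanD(2)[OF pl[OF j] u s]
      S_restriction[OF subcategoryD(3)[OF D_subcategory_E[OF j] u] unit_in_S[OF j Dj.hom_Obj(2)[OF u] s]] by simp
  show "\<exists>d\<in>Obj (D j). \<exists>h\<in>hom E c d. \<exists>s\<in>On_obj (\<psi> j) d. y = restriction (S j) h (e j d s)"
    if c: "c \<in> Obj E" and y: "y \<in> On_obj (S j) c" for c y
    using y S_restriction unit_in_S[OF j] unfolding S_obj[OF c] by metis
  show "((h, s), (h', s')) \<in> zigzag (lan_step E (D j) (\<psi> j))"
    if "h \<in> hom E c d" "h' \<in> hom E c d'" "d \<in> Obj (D j)" "d' \<in> Obj (D j)"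
       "s \<in> On_obj (\<psi> j) d" "s' \<in> On_obj (\<psi> j) d'"
       "restriction (S j) h (e j d s) = restriction (S j) h' (e j d' s')" for c h h' d d' s s'
    using lan_zigzag[OF j that(1-6)] that(7) S_restriction[OF that(1) unit_in_S[OF j that(3,5)]]
      S_restriction[OF that(2) unit_in_S[OF j that(4,6)]] by simp
qed

text \<open>It suffices to know this for generators, as \<open>F f\<close> commutes with restriction.\<close>

lemma S_transport:
  assumes f: "f \<in> hom J j j'" and c: "c \<in> Obj E" and z: "z \<in> On_obj (S j) c"
  shows "nt_app (On_arr F f) c z \<in> On_obj (S j') c"
proof -
  note j = J.hom_Obj[OF f]
  obtain h d s where h: "h \<in> hom E c d" and d: "d \<in> Obj (D j)" and s: "s \<in> On_obj (\<psi> j) d"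
    and z': "z = restriction (On_obj F j) h (e j d s)"
    using z unfolding S_obj[OF c] by blast
  have "nt_app (On_arr F f) c z = restriction (On_obj F j') h (nt_app (On_arr F f) d (e j d s))"
    unfolding z' by (rule psh_homD(4)[OF C F_hom[OF f] E_imp_C(2)[OF h] pointwise_lanD(1)[OF pl[OF j(1)] d s]])
  then show ?thesis
    using S_stable[OF j(2) h] transport[OF f d s] unfolding S_def by simp
qed

lemma SF_obj: "j \<in> Obj J \<Longrightarrow> On_obj SF j = S j"
  by (simp add: SF_def)

lemma SF_arr:
  assumes f: "f \<in> hom J j j'"
  shows "On_arr SF f \<in> hom (psh_cat \<Omega> E) (S j) (S j')"
    and "c \<in> Obj E \<Longrightarrow> z \<in> On_obj (S j) c \<Longrightarrow> nt_app (On_arr SF f) c z = nt_app (On_arr F f) c z"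
proof -
  note j = J.hom_Obj[OF f]
  have eq: "On_arr SF f = mk_nt E (S j) (nt_app (On_arr F f)) (S j')"
    using f by (simp add: SF_def homD)
  show "On_arr SF f \<in> hom (psh_cat \<Omega> E) (S j) (S j')"
    unfolding eq
  proof (rule mk_nt_hom[OF E.category_axioms S_presheaf[OF j(1)] S_presheaf[OF j(2)] S_transport[OF f]])
    fix g x y a assume g: "g \<in> hom E x y" and a: "a \<in> On_obj (S j) y"
    note y = E.hom_Obj(2)[OF g]
    show "nt_app (On_arr F f) x (restriction (S j) g a) = restriction (S j') g (nt_app (On_arr F f) y a)"
      using psh_homD(4)[OF C F_hom[OF f] E_imp_C(2)[OF g] S_le[OF j(1) y a]] S_restriction[OF g a]
        S_restriction[OF g S_transport[OF f y a]] by simp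
  qed
  show "c \<in> Obj E \<Longrightarrow> z \<in> On_obj (S j) c \<Longrightarrow> nt_app (On_arr SF f) c z = nt_app (On_arr F f) c z"
    unfolding eq by (rule nt_app_mk)
qed

lemma SF_functor: "is_functor J (psh_cat \<Omega> E) SF"
proof -
  have h: "On_arr SF f \<in> hom (psh_cat \<Omega> E) (On_obj SF (Dom J f)) (On_obj SF (Cod J f))" if "f \<in> Arr J" for f
    using SF_arr(1)[of f "Dom J f" "Cod J f"] that J.Dom_in[OF that] J.Cod_in[OF that]
    by (simp add: SF_obj hom_def[of J])
  have "On_obj SF \<in> Obj J \<rightarrow>\<^sub>E Obj (psh_cat \<Omega> E)" using S_presheaf by (auto simp: SF_def)
  moreover have "On_arr SF \<in> Arr J \<rightarrow>\<^sub>E Arr (psh_cat \<Omega> E)"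
    using homD(1)[OF h] by (auto simp: SF_def)
  moreover have "On_arr SF (Idn J j) = Idn (psh_cat \<Omega> E) (On_obj SF j)" if j: "j \<in> Obj J" for j
    unfolding SF_obj[OF j]
  proof (rule psh_hom_eqI[OF E.category_axioms SF_arr(1)[OF J.Idn_in[OF j]] Idn_psh_hom[OF E.category_axioms S_presheaf[OF j]]])
    fix c a assume c: "c \<in> Obj E" and a: "a \<in> On_obj (S j) c"
    have "On_arr F (Idn J j) = Idn (psh_cat \<Omega> C) (On_obj F j)"
      using F j unfolding is_functor_def[of J] by blast
    then show "nt_app (On_arr SF (Idn J j)) c a = nt_app (Idn (psh_cat \<Omega> E) (S j)) c a"
      using SF_arr(2)[OF J.Idn_in[OF j] c a] nt_app_Idn[OF c a, of \<Omega>]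
        nt_app_Idn[OF E_imp_C(1)[OF c] S_le[OF j c a], of \<Omega>] by simp
  qed
  moreover have "On_arr SF (Cmp J g f) = Cmp (psh_cat \<Omega> E) (On_arr SF g) (On_arr SF f)"
    if "f \<in> Arr J" "g \<in> Arr J" "Cod J f = Dom J g" for f g
  proof -
    have f: "f \<in> hom J (Dom J f) (Dom J g)" and g: "g \<in> hom J (Dom J g) (Cod J g)"
      using that by (auto simp: hom_def)
    note gf = J.Cmp_in[OF f g]
    show ?thesis
    proof (rule psh_hom_eqI[OF E.category_axioms SF_arr(1)[OF gf]
          Cmp_psh_hom[OF E.category_axioms SF_arr(1)[OF f] SF_arr(1)[OF g]]])
      fix c a assume c: "c \<in> Obj E" and a: "a \<in> On_obj (S (Dom J f)) c"
      have "On_arr F (Cmp J g f) = Cmp (psh_cat \<Omega> C) (On_arr F g) (On_arr F f)"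
        using F that unfolding is_functor_def[of J] by blast
      then show "nt_app (On_arr SF (Cmp J g f)) c a = nt_app (Cmp (psh_cat \<Omega> E) (On_arr SF g) (On_arr SF f)) c a"
        using SF_arr(2)[OF gf c a] nt_app_Cmp[OF E.category_axioms SF_arr(1)[OF f] SF_arr(1)[OF g] c a]
          SF_arr(2)[OF f c a] SF_arr(2)[OF g c S_transport[OF f c a]]
          nt_app_Cmp[OF C F_hom[OF f] F_hom[OF g] E_imp_C(1)[OF c] S_le[OF J.hom_Obj(1)[OF f] c a]] by simp
    qed
  qed
  ultimately show ?thesis unfolding is_functor_def[of J] using h by blast
qed

lemma T_obj: "c \<in> Obj E \<Longrightarrow> y \<in> On_obj T c \<longleftrightarrow> (\<exists>i z. i \<in> Obj I \<and> z \<in> On_obj (S (fst i)) c \<and> y = nt_app (\<mu> i) c z)"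
  unfolding T_def by (auto simp: mk_psh_obj)

lemma T_le: "c \<in> Obj E \<Longrightarrow> y \<in> On_obj T c \<Longrightarrow> y \<in> On_obj \<phi> c"
  unfolding T_obj using psh_homD(3)[OF C mu_hom E_imp_C(1)] S_le Obj_I_iff by blast

lemma T_stable:
  assumes f: "f \<in> hom E x y" and i: "i \<in> Obj I" and z: "z \<in> On_obj (S (fst i)) y"
  shows "restriction \<phi> f (nt_app (\<mu> i) y z) = nt_app (\<mu> i) x (restriction (On_obj F (fst i)) f z)"
    and "restriction (On_obj F (fst i)) f z \<in> On_obj (S (fst i)) x"
  using psh_homD(4)[OF C mu_hom[OF i] E_imp_C(2)[OF f]] S_le[OF _ E.hom_Obj(2)[OF f] z] S_stable[OF _ f z] i Obj_I_iff by auto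

lemma T_presheaf: "presheaf \<Omega> E T"
  unfolding T_def
proof (rule presheaf_subpresheaf[OF C E phi])
  show "{nt_app (\<mu> i) c z |i z. i \<in> Obj I \<and> z \<in> On_obj (S (fst i)) c} \<subseteq> On_obj \<phi> c" if "c \<in> Obj E" for c
    using T_le[OF that] T_obj[OF that] by blast
  show "restriction \<phi> f a \<in> {nt_app (\<mu> i) x z |i z. i \<in> Obj I \<and> z \<in> On_obj (S (fst i)) x}"
    if "f \<in> hom E x y" "a \<in> {nt_app (\<mu> i) y z |i z. i \<in> Obj I \<and> z \<in> On_obj (S (fst i)) y}" for f x y a
    using that(2) T_stable[OF that(1)] by blast
qed

lemma T_restriction: "f \<in> hom E x y \<Longrightarrow> a \<in> On_obj T y \<Longrightarrow> restriction T f a = restriction \<phi> f a"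
  unfolding T_def using E.hom_Obj(2) by (intro mk_psh_restriction) (auto simp: homD mk_psh_obj)

text \<open>Joint surjectivity holds by definition of \<open>T\<close>. If two elements of the \<open>S j\<close> agree in \<open>T\<close>, they agree
  in \<open>\<phi>\<close>, hence are connected by a zigzag in \<open>F\<close>, which the last richness assumption
  places inside \<open>S\<close>.\<close>

lemma T_weighted_colimit: "is_weighted_colimit J (psh_cat \<Omega> E) \<omega> SF T"
proof -
  let ?G = "elements_diagram J \<omega> SF"
  have G': "is_functor I (psh_cat \<Omega> E) ?G"
    unfolding I_def by (rule elements_diagram_functor[OF J om SF_functor])
  have Go': "On_obj ?G i = S (fst i)" if "i \<in> Obj I" for i
    using that by (cases i) (simp add: elements_diagram_simps Obj_I_iff SF_obj)
  have Ga': "nt_app (On_arr ?G a) c z = nt_app (On_arr G a) c z"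
    if a: "a \<in> Arr I" and c: "c \<in> Obj E" and z: "z \<in> On_obj (S (fst (Dom I a))) c" for a c z
  proof -
    obtain p f q where a': "a = (p, f, q)" and f: "f \<in> hom J (fst p) (fst q)" "Dom I a = p"
      "On_arr G a = On_arr F f"
      using Arr_I_cases[OF a] by metis
    have "On_arr ?G (p, f, q) = On_arr SF f"
      by (rule elements_diagram_simps(2)) (use a a' in \<open>simp add: I_def\<close>)
    then show ?thesis using SF_arr(2)[OF f(1) c, of z] z f by (simp add: a')
  qed
  define \<tau> where "\<tau> i = mk_nt E (S (fst i)) (nt_app (\<mu> i)) T" for i
  have tapp: "nt_app (\<tau> i) c z = nt_app (\<mu> i) c z" if "c \<in> Obj E" "z \<in> On_obj (S (fst i)) c" for i c z
    unfolding \<tau>_def by (rule nt_app_mk[OF that])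
  have th: "\<tau> i \<in> hom (psh_cat \<Omega> E) (S (fst i)) T" if i: "i \<in> Obj I" for i
    unfolding \<tau>_def
  proof (rule mk_nt_hom[OF E.category_axioms S_presheaf T_presheaf])
    show "fst i \<in> Obj J" using i Obj_I_iff by blast
    show in_T: "nt_app (\<mu> i) c a \<in> On_obj T c" if "c \<in> Obj E" "a \<in> On_obj (S (fst i)) c" for c a
      using that i T_obj by blast
    show "nt_app (\<mu> i) x (restriction (S (fst i)) f a) = restriction T f (nt_app (\<mu> i) y a)"
      if f: "f \<in> hom E x y" and a: "a \<in> On_obj (S (fst i)) y" for f x y a
      using T_stable(1)[OF f i a] T_restriction[OF f in_T[OF E.hom_Obj(2)[OF f] a]] S_restriction[OF f a]
      by simp
  qed
  interpret I: category I by (rule I)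
  have cocone: "is_cocone I (psh_cat \<Omega> E) ?G T \<tau>"
  proof (rule psh_coconeI[OF E.category_axioms I G' T_presheaf])
    show "\<tau> i \<in> hom (psh_cat \<Omega> E) (On_obj ?G i) T" if "i \<in> Obj I" for i
      using th[OF that] Go'[OF that] by simp
    fix a c x assume a: "a \<in> Arr I" and c: "c \<in> Obj E" and x: "x \<in> On_obj (On_obj ?G (Dom I a)) c"
    have x': "x \<in> On_obj (S (fst (Dom I a))) c" using x Go'[OF I.Dom_in[OF a]] by simp
    have "nt_app (On_arr ?G a) c x \<in> On_obj (S (fst (Cod I a))) c"
      using psh_homD(3)[OF E.category_axioms functor_to_psh_catD(2)[OF G' a] c x] Go'[OF I.Cod_in[OF a]] by simp
    then show "nt_app (\<tau> (Cod I a)) c (nt_app (On_arr ?G a) c x) = nt_app (\<tau> (Dom I a)) c x"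
      using tapp[OF c] x' Ga'[OF a c x'] mu_step[OF a E_imp_C(1)[OF c], of x] S_le[OF _ c x']
        On_obj_G[OF I.Dom_in[OF a]] I.Dom_in[OF a] Obj_I_iff by simp
  qed
  have "pointwise_colimit I E ?G T \<tau>"
    unfolding pointwise_colimit_def
  proof (intro conjI ballI impI)
    show "\<exists>i\<in>Obj I. \<exists>x\<in>On_obj (On_obj ?G i) c. y = nt_app (\<tau> i) c x"
      if c: "c \<in> Obj E" and y: "y \<in> On_obj T c" for c y
      using y Go' tapp[OF c] unfolding T_obj[OF c] by metis
    show "((i, z), (i', z')) \<in> zigzag (colim_step I ?G c)"
      if c: "c \<in> Obj E" and i: "i \<in> Obj I" "i' \<in> Obj I" and z: "z \<in> On_obj (On_obj ?G i) c"
        "z' \<in> On_obj (On_obj ?G i') c" and eq: "nt_app (\<tau> i) c z = nt_app (\<tau> i') c z'" for c i i' z z'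
    proof -
      have zS: "z \<in> On_obj (S (fst i)) c" "z' \<in> On_obj (S (fst i')) c" using z Go' i by simp_all
      have zG: "z \<in> On_obj (On_obj G i) c" "z' \<in> On_obj (On_obj G i') c"
        using zS On_obj_G i S_le c Obj_I_iff by auto
      have "nt_app (\<mu> i) c z = nt_app (\<mu> i') c z'" using eq tapp[OF c] zS by simp
      then have "((i, z), (i', z')) \<in> zigzag (colim_step I G c)"
        using pw' E_imp_C(1)[OF c] i zG unfolding pointwise_colimit_def by blast
      then have "((i, z), (i', z')) \<in> zigzag {((k, a), q) \<in> colim_step I G c. a \<in> On_obj (S (fst k)) c}"
        using colim_zigzag[OF c] i zS unfolding I_def G_def S_def by blast
      then show ?thesis
      proof (rule zigzag_mono)
        show "{((k, a), q) \<in> colim_step I G c. a \<in> On_obj (S (fst k)) c} \<subseteq> colim_step I ?G c"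
        proof clarify
          fix k x k' x' assume "((k, x), k', x') \<in> colim_step I G c" and x: "x \<in> On_obj (S (fst k)) c"
          then obtain a where a: "a \<in> Arr I" "k = Dom I a" "k' = Cod I a" "x' = nt_app (On_arr G a) c x"
            unfolding colim_step_def by blast
          have "x \<in> On_obj (On_obj ?G (Dom I a)) c" using x a(2) Go'[OF I.Dom_in[OF a(1)]] by simp
          then have "((Dom I a, x), Cod I a, nt_app (On_arr ?G a) c x) \<in> colim_step I ?G c"
            unfolding colim_step_def using a(1) by blast
          then show "((k, x), k', x') \<in> colim_step I ?G c" using x Ga'[OF a(1) c, of x] a by simp
        qed
      qed
    qed
  qed
  then have "is_colimit I (psh_cat \<Omega> E) ?G T"
    by (rule pointwise_colimit_imp_colimit[OF E.category_axioms I G' cocone])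
  then show ?thesis by (simp add: is_weighted_colimit_def I_def)
qed

lemma lan_step_T:
  assumes u: "u \<in> hom E d d'" and h: "h \<in> hom C c d" and t: "t \<in> On_obj T d'"
  shows "((Cmp C u h, t), (h, restriction \<phi> u t)) \<in> zigzag (lan_step C E T)"
proof -
  have "((Cmp C u h, t), (h, restriction T u t)) \<in> lan_step C E T"
    unfolding lan_step_def using u h t by (auto simp: hom_def)
  then show ?thesis using T_restriction[OF u t] zigzag_step by metis
qed

text \<open>An element of \<open>F j\<close> may be presented in several ways as the restriction of an element of \<open>S j\<close>. All of
  these give the same formal restriction of an element of \<open>T\<close>: rewriting them in terms of
  generators gives two presentations over \<open>\<psi> j\<close>, which are connected because \<open>F j\<close> is generated by \<open>\<psi> j\<close>,
  and the steps over \<open>D j\<close> map to steps over \<open>E\<close>.\<close>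

lemma representations_zigzag:
  assumes i: "i \<in> Obj I" and h: "h \<in> hom C c b" "h' \<in> hom C c b'"
    and b: "b \<in> Obj E" "b' \<in> Obj E" and z: "z \<in> On_obj (S (fst i)) b" "z' \<in> On_obj (S (fst i)) b'"
    and eq: "restriction (On_obj F (fst i)) h z = restriction (On_obj F (fst i)) h' z'"
  shows "((h, nt_app (\<mu> i) b z), (h', nt_app (\<mu> i) b' z')) \<in> zigzag (lan_step C E T)"
proof -
  define j where "j = fst i"
  have j: "j \<in> Obj J" using i Obj_I_iff by (simp add: j_def)
  note pl' = pointwise_lanD[OF pl[OF j]]
  interpret Dj: category "D j" using subcategoryD(1)[OF D[OF j]] .
  have DjC: "d \<in> Obj (D j) \<Longrightarrow> d \<in> Obj E" for d using subcategoryD(2)[OF D_subcategory_E[OF j]] .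
  have muT: "nt_app (\<mu> i) d y \<in> On_obj T d" if "d \<in> Obj E" "y \<in> On_obj (S j) d" for d y
    using that i T_obj j_def by blast
  have gen: "\<exists>k d s. k \<in> hom E b d \<and> d \<in> Obj (D j) \<and> s \<in> On_obj (\<psi> j) d \<and>
      restriction (On_obj F j) h z = restriction (On_obj F j) (Cmp C k h) (e j d s) \<and>
      ((Cmp C k h, nt_app (\<mu> i) d (e j d s)), (h, nt_app (\<mu> i) b z)) \<in> zigzag (lan_step C E T)"
    if h: "h \<in> hom C c b" and b: "b \<in> Obj E" and z: "z \<in> On_obj (S j) b" for h b z
  proof -
    obtain k d s where k: "k \<in> hom E b d" and d: "d \<in> Obj (D j)" and s: "s \<in> On_obj (\<psi> j) d"
      and z': "z = restriction (On_obj F j) k (e j d s)"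
      using z unfolding S_obj[OF b] by blast
    have es: "e j d s \<in> On_obj (S j) d" by (rule unit_in_S[OF j d s])
    have "restriction \<phi> k (nt_app (\<mu> i) d (e j d s)) = nt_app (\<mu> i) b z"
      using T_stable(1)[OF k i] es z' j_def by simp
    then have "((Cmp C k h, nt_app (\<mu> i) d (e j d s)), (h, nt_app (\<mu> i) b z)) \<in> zigzag (lan_step C E T)"
      using lan_step_T[OF k h muT[OF DjC[OF d] es]] by simp
    moreover have "restriction (On_obj F j) h z = restriction (On_obj F j) (Cmp C k h) (e j d s)"
      using restriction_Cmp[OF C F_presheaf[OF j] h E_imp_C(2)[OF k] pl'(1)[OF d s]] z' by simp
    ultimately show ?thesis using k d s by blast
  qed
  obtain k d s where k: "k \<in> hom E b d" and d: "d \<in> Obj (D j)" and s: "s \<in> On_obj (\<psi> j) d"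
    and e1: "restriction (On_obj F j) h z = restriction (On_obj F j) (Cmp C k h) (e j d s)"
    and c1: "((Cmp C k h, nt_app (\<mu> i) d (e j d s)), (h, nt_app (\<mu> i) b z)) \<in> zigzag (lan_step C E T)"
    using gen[OF h(1) b(1) z(1)[folded j_def]] by blast
  obtain k' d' s' where k': "k' \<in> hom E b' d'" and d': "d' \<in> Obj (D j)" and s': "s' \<in> On_obj (\<psi> j) d'"
    and e2: "restriction (On_obj F j) h' z' = restriction (On_obj F j) (Cmp C k' h') (e j d' s')"
    and c2: "((Cmp C k' h', nt_app (\<mu> i) d' (e j d' s')), (h', nt_app (\<mu> i) b' z')) \<in> zigzag (lan_step C E T)"
    using gen[OF h(2) b(2) z(2)[folded j_def]] by blast
  have kh: "Cmp C k h \<in> hom C c d" "Cmp C k' h' \<in> hom C c d'"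
    using C.Cmp_in[OF h(1) E_imp_C(2)[OF k]] C.Cmp_in[OF h(2) E_imp_C(2)[OF k']] .
  have "((Cmp C k h, s), (Cmp C k' h', s')) \<in> zigzag (lan_step C (D j) (\<psi> j))"
    by (rule pl'(4)[OF kh d d' s s']) (use e1 e2 eq j_def in simp)
  then have "(case (Cmp C k h, s) of (h, s) \<Rightarrow> (h, nt_app (\<mu> i) (Cod C h) (e j (Cod C h) s)),
      case (Cmp C k' h', s') of (h, s) \<Rightarrow> (h, nt_app (\<mu> i) (Cod C h) (e j (Cod C h) s))) \<in> zigzag (lan_step C E T)"
  proof (rule zigzag_map)
    fix p q assume "(p, q) \<in> lan_step C (D j) (\<psi> j)"
    then obtain u g s where p: "p = (Cmp C u g, s)" and q: "q = (g, restriction (\<psi> j) u s)"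
      and u: "u \<in> hom (D j) (Dom (D j) u) (Cod (D j) u)" and g: "g \<in> hom C (Dom C g) (Dom (D j) u)"
      and s: "s \<in> On_obj (\<psi> j) (Cod (D j) u)"
      by (auto simp: lan_step_def hom_def)
    note uE = subcategoryD(3)[OF D_subcategory_E[OF j] u]
    have es: "e j (Cod (D j) u) s \<in> On_obj (S j) (Cod (D j) u)"
      by (rule unit_in_S[OF j Dj.hom_Obj(2)[OF u] s])
    have "restriction \<phi> u (nt_app (\<mu> i) (Cod (D j) u) (e j (Cod (D j) u) s)) =
        nt_app (\<mu> i) (Dom (D j) u) (e j (Dom (D j) u) (restriction (\<psi> j) u s))"
      using T_stable(1)[OF uE i] es pl'(2)[OF u s] j_def by simp
    then show "(case p of (h, s) \<Rightarrow> (h, nt_app (\<mu> i) (Cod C h) (e j (Cod C h) s)),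
        case q of (h, s) \<Rightarrow> (h, nt_app (\<mu> i) (Cod C h) (e j (Cod C h) s))) \<in> zigzag (lan_step C E T)"
      using lan_step_T[OF uE g muT[OF E.hom_Obj(2)[OF uE] es]] homD(3)[OF g]
        homD(3)[OF C.Cmp_in[OF g E_imp_C(2)[OF uE]]] by (simp add: p q)
  qed
  then have "((Cmp C k h, nt_app (\<mu> i) d (e j d s)), (Cmp C k' h', nt_app (\<mu> i) d' (e j d' s'))) \<in> zigzag (lan_step C E T)"
    using homD(3)[OF kh(1)] homD(3)[OF kh(2)] by simp
  then show ?thesis using c1 c2 zigzag_sym zigzag_trans by metis
qed

text \<open>Suppose the restrictions of \<open>t\<close> along \<open>h\<close> and of \<open>t'\<close> along \<open>h'\<close> agree in \<open>\<phi>\<close>. They come from elements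
  of the diagram connected by a zigzag at \<open>c\<close>. Each element on the zigzag has a
  presentation over \<open>E\<close>, unique up to zigzags by \<open>representations_zigzag\<close>, and passing along an arrow of
  the diagram moves a presentation to one with the same image in \<open>T\<close>.\<close>

lemma T_pointwise_lan: "pointwise_lan C E T \<phi> (\<lambda>d t. t)"
  unfolding pointwise_lan_def
proof (intro conjI ballI allI impI)
  interpret I: category I by (rule I)
  show "s \<in> On_obj \<phi> d" if "d \<in> Obj E" "s \<in> On_obj T d" for d s using T_le[OF that] .
  show "restriction T u s = restriction \<phi> u s" if "u \<in> hom E d d'" "s \<in> On_obj T d'" for u d d' s
    using T_restriction[OF that] .
  have rep: "\<exists>h b z. h \<in> hom C c b \<and> b \<in> Obj E \<and> z \<in> On_obj (S (fst i)) b \<and> w = restriction (On_obj F (fst i)) h z"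
    if i: "i \<in> Obj I" and c: "c \<in> Obj C" and w: "w \<in> On_obj (On_obj F (fst i)) c" for i c w
  proof -
    have j: "fst i \<in> Obj J" using i Obj_I_iff by blast
    show ?thesis
      using pointwise_lanD(3)[OF pl[OF j] c w] unit_in_S[OF j] subcategoryD(2)[OF D_subcategory_E[OF j]] by blast
  qed
  show "\<exists>d\<in>Obj E. \<exists>h\<in>hom C c d. \<exists>t\<in>On_obj T d. y = restriction \<phi> h t"
    if c: "c \<in> Obj C" and y: "y \<in> On_obj \<phi> c" for c y
  proof -
    obtain i w where i: "i \<in> Obj I" and w: "w \<in> On_obj (On_obj F (fst i)) c" and y': "y = nt_app (\<mu> i) c w"
      using pw' c y On_obj_G unfolding pointwise_colimit_def by metis
    obtain h b z where h: "h \<in> hom C c b" and b: "b \<in> Obj E" and z: "z \<in> On_obj (S (fst i)) b"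
      and w': "w = restriction (On_obj F (fst i)) h z"
      using rep[OF i c w] by blast
    have "y = restriction \<phi> h (nt_app (\<mu> i) b z)"
      using psh_homD(4)[OF C mu_hom[OF i] h S_le[OF _ b z]] i Obj_I_iff y' w' by auto
    then show ?thesis using b h i z T_obj[OF b] by blast
  qed
  show "((h, t), (h', t')) \<in> zigzag (lan_step C E T)"
    if h: "h \<in> hom C c b" "h' \<in> hom C c b'" and b: "b \<in> Obj E" "b' \<in> Obj E"
      and t: "t \<in> On_obj T b" "t' \<in> On_obj T b'" and eq: "restriction \<phi> h t = restriction \<phi> h' t'"
    for c h h' b b' t t'
  proof -
    have c: "c \<in> Obj C" using C.hom_Obj[OF h(1)] by blast
    obtain i z where i: "i \<in> Obj I" and z: "z \<in> On_obj (S (fst i)) b" and tz: "t = nt_app (\<mu> i) b z"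
      using t(1) unfolding T_obj[OF b(1)] by blast
    obtain i' z' where i': "i' \<in> Obj I" and z': "z' \<in> On_obj (S (fst i')) b'" and tz': "t' = nt_app (\<mu> i') b' z'"
      using t(2) unfolding T_obj[OF b(2)] by blast
    have zF: "z \<in> On_obj (On_obj F (fst i)) b" "z' \<in> On_obj (On_obj F (fst i')) b'"
      using S_le[OF _ b(1) z] S_le[OF _ b(2) z'] i i' Obj_I_iff by auto
    let ?w = "restriction (On_obj F (fst i)) h z" and ?w' = "restriction (On_obj F (fst i')) h' z'"
    have "nt_app (\<mu> i) c ?w = nt_app (\<mu> i') c ?w'"
      using psh_homD(4)[OF C mu_hom[OF i] h(1) zF(1)] psh_homD(4)[OF C mu_hom[OF i'] h(2) zF(2)] eq tz tz' by simp
    moreover have "?w \<in> On_obj (On_obj F (fst i)) c" "?w' \<in> On_obj (On_obj F (fst i')) c"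
      using restriction_in[OF C F_presheaf h(1) zF(1)] restriction_in[OF C F_presheaf h(2) zF(2)] i i' Obj_I_iff by auto
    ultimately have "((i, ?w), (i', ?w')) \<in> zigzag (colim_step I G c)"
      using pw' c i i' On_obj_G unfolding pointwise_colimit_def by simp
    \<comment> \<open>The claim is carried along for all presentations of the current element, so that each step may use
      the presentation that suits it.\<close>
    then have "(case (i', ?w') of (k, w) \<Rightarrow> k \<in> Obj I \<and> w \<in> On_obj (On_obj F (fst k)) c \<and>
        (\<forall>g a y. g \<in> hom C c a \<longrightarrow> a \<in> Obj E \<longrightarrow> y \<in> On_obj (S (fst k)) a \<longrightarrow>
          w = restriction (On_obj F (fst k)) g y \<longrightarrow> ((h, t), (g, nt_app (\<mu> k) a y)) \<in> zigzag (lan_step C E T)))"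
      (is "?P (i', ?w')")
    proof (induction rule: zigzag_induct)
      case refl
      show ?case
        using representations_zigzag[OF i h(1) _ b(1) _ z] i restriction_in[OF C F_presheaf h(1) zF(1)] Obj_I_iff tz by auto
    next
      case (step p q)
      then obtain a w where a: "a \<in> Arr I" and p: "p = (Dom I a, w)" and q: "q = (Cod I a, nt_app (On_arr G a) c w)"
        unfolding colim_step_def by blast
      obtain k f k' where f: "f \<in> hom J (fst k) (fst k')" and k: "Dom I a = k" "Cod I a = k'" "k \<in> Obj I" "k' \<in> Obj I"
        and Ga: "On_arr G a = On_arr F f"
        using Arr_I_cases[OF a] by metis
      have w: "w \<in> On_obj (On_obj F (fst k)) c" using step.IH by (simp add: p k)
      obtain g b0 y where g: "g \<in> hom C c b0" and b0: "b0 \<in> Obj E" and y: "y \<in> On_obj (S (fst k)) b0"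
        and wy: "w = restriction (On_obj F (fst k)) g y"
        using rep[OF k(3) c w] by blast
      have IH: "((h, t), (g, nt_app (\<mu> k) b0 y)) \<in> zigzag (lan_step C E T)"
        using step.IH g b0 y wy by (simp add: p k)
      have yF: "y \<in> On_obj (On_obj F (fst k)) b0" using S_le[OF _ b0 y] k Obj_I_iff by blast
      have y1: "nt_app (On_arr F f) b0 y \<in> On_obj (S (fst k')) b0" by (rule S_transport[OF f b0 y])
      have "nt_app (On_arr F f) c w = restriction (On_obj F (fst k')) g (nt_app (On_arr F f) b0 y)"
        unfolding wy by (rule psh_homD(4)[OF C F_hom[OF f] g yF])
      moreover have "nt_app (\<mu> k') b0 (nt_app (On_arr F f) b0 y) = nt_app (\<mu> k) b0 y"
        using mu_step[OF a E_imp_C(1)[OF b0], of y] yF k Ga On_obj_G by simp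
      ultimately have "((g, nt_app (\<mu> k) b0 y), (g', nt_app (\<mu> k') a' y')) \<in> zigzag (lan_step C E T)"
        if "g' \<in> hom C c a'" "a' \<in> Obj E" "y' \<in> On_obj (S (fst k')) a'"
          "nt_app (On_arr F f) c w = restriction (On_obj F (fst k')) g' y'" for g' a' y'
        using representations_zigzag[OF k(4) g that(1) b0 that(2) y1 that(3)] that(4) by simp
      then have "\<forall>g' a' y'. g' \<in> hom C c a' \<longrightarrow> a' \<in> Obj E \<longrightarrow> y' \<in> On_obj (S (fst k')) a' \<longrightarrow>
          nt_app (On_arr F f) c w = restriction (On_obj F (fst k')) g' y' \<longrightarrow>
          ((h, t), (g', nt_app (\<mu> k') a' y')) \<in> zigzag (lan_step C E T)"
        using IH zigzag_trans by metis
      then show ?case using psh_homD(3)[OF C F_hom[OF f] c w] k(4) by (simp add: q k Ga)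
    next
      case (unstep p q)
      then obtain a w where a: "a \<in> Arr I" and w: "w \<in> On_obj (On_obj G (Dom I a)) c"
        and q: "q = (Dom I a, w)" and p: "p = (Cod I a, nt_app (On_arr G a) c w)"
        unfolding colim_step_def by blast
      obtain k f k' where f: "f \<in> hom J (fst k) (fst k')" and k: "Dom I a = k" "Cod I a = k'" "k \<in> Obj I" "k' \<in> Obj I"
        and Ga: "On_arr G a = On_arr F f"
        using Arr_I_cases[OF a] by metis
      have wF: "w \<in> On_obj (On_obj F (fst k)) c" using w k On_obj_G by simp
      have "((h, t), (g, nt_app (\<mu> k) b0 y)) \<in> zigzag (lan_step C E T)"
        if g: "g \<in> hom C c b0" and b0: "b0 \<in> Obj E" and y: "y \<in> On_obj (S (fst k)) b0"
          and wy: "w = restriction (On_obj F (fst k)) g y" for g b0 y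
      proof -
        have yF: "y \<in> On_obj (On_obj F (fst k)) b0" using S_le[OF _ b0 y] k Obj_I_iff by blast
        have y1: "nt_app (On_arr F f) b0 y \<in> On_obj (S (fst k')) b0" by (rule S_transport[OF f b0 y])
        have "nt_app (On_arr F f) c w = restriction (On_obj F (fst k')) g (nt_app (On_arr F f) b0 y)"
          unfolding wy by (rule psh_homD(4)[OF C F_hom[OF f] g yF])
        then have "((h, t), (g, nt_app (\<mu> k') b0 (nt_app (On_arr F f) b0 y))) \<in> zigzag (lan_step C E T)"
          using unstep.IH g b0 y1 by (simp add: p k Ga)
        then show ?thesis using mu_step[OF a E_imp_C(1)[OF b0], of y] yF k Ga On_obj_G by simp
      qed
      then show ?case using wF k(3) by (simp add: q k)
    qed
    then show ?thesis using h(2) b(2) z' tz' by simp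
  qed
qed

end


section \<open>Small witness-closed subcategories\<close>

text \<open>\<open>W h h'\<close> lists the arrows that have to be present as soon as \<open>h\<close> and \<open>h'\<close> are. Identities and
  composites are demands of the same kind, so the closure is a subcategory.\<close>

lemma ex_small_witness_closed_subcategory:
  assumes C: "category C" and reg: "regular_cardinal \<kappa>" and unc: "natLeq <o \<kappa>"
    and A: "A \<subseteq> Arr C" "|A| <o \<kappa>" and W: "\<And>h h'. |W h h'| <o \<kappa>"
  shows "\<exists>E. subcategory E C \<and> small_category \<kappa> E \<and> A \<subseteq> Arr E \<and>
    (\<forall>h \<in> Arr E. \<forall>h' \<in> Arr E. W h h' \<inter> Arr C \<subseteq> Arr E)"
proof -
  interpret C: category C by fact
  let ?W = "\<lambda>h h'. W h h' \<union> {Idn C (Dom C h), Idn C (Cod C h), Cmp C h' h}"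
  have "|?W h h'| <o \<kappa>" for h h'
    by (rule card_of_Un_less[OF reg W card_of_finite_less[OF reg]]) simp
  then have "\<exists>X. A \<subseteq> X \<and> |X| <o \<kappa> \<and> (\<forall>h \<in> X. \<forall>h' \<in> X. ?W h h' \<subseteq> X)"
    by (rule ex_small_closed_superset[OF reg unc A(2)])
  then obtain X where X: "A \<subseteq> X" "|X| <o \<kappa>" and "\<forall>h \<in> X. \<forall>h' \<in> X. ?W h h' \<subseteq> X"
    by (elim exE conjE)
  then have cl: "\<And>h h'. h \<in> X \<Longrightarrow> h' \<in> X \<Longrightarrow> ?W h h' \<subseteq> X" by simp
  define E where "E = \<lparr>Obj = {c \<in> Obj C. Idn C c \<in> X}, Arr = X \<inter> Arr C, Dom = Dom C, Cod = Cod C,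
    Idn = Idn C, Cmp = Cmp C\<rparr>"
  have hE: "f \<in> hom E x y \<longleftrightarrow> f \<in> hom C x y \<and> f \<in> X" for f x y
    by (auto simp: hom_def E_def)
  have cE: "category E"
  proof
    show "Dom E f \<in> Obj E" "Cod E f \<in> Obj E" if "f \<in> Arr E" for f
      using that cl[of f f] C.Dom_in C.Cod_in by (auto simp: E_def)
    show "Idn E x \<in> hom E x x" if "x \<in> Obj E" for x
      using that C.Idn_in unfolding hE by (auto simp: E_def)
    show "Cmp E g f \<in> hom E x z" if "f \<in> hom E x y" "g \<in> hom E y z" for f g x y z
      using that C.Cmp_in cl[of f g] unfolding hE by (auto simp: E_def)
  qed (auto simp: hE, auto simp: E_def C.Cmp_Idn_left C.Cmp_Idn_right C.Cmp_assoc)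
  then have "subcategory E C" by (auto simp: subcategory_def E_def)
  moreover have "small_category \<kappa> E"
    using cE card_of_subset_less[OF X(2), of "Arr E"] by (auto simp: small_category_def E_def)
  moreover have "A \<subseteq> Arr E" using X(1) A(1) by (auto simp: E_def)
  moreover have "\<forall>h \<in> Arr E. \<forall>h' \<in> Arr E. W h h' \<inter> Arr C \<subseteq> Arr E"
    using cl by (auto simp: E_def)
  ultimately show ?thesis by blast
qed

lemma card_of_Obj_less:
  assumes "small_category \<kappa> J"
  shows "|Obj J| <o \<kappa>"
proof -
  interpret category J using assms by (simp add: small_category_def)
  have "Obj J \<subseteq> Dom J ` Arr J" using Idn_in by (force simp: hom_def)
  moreover have "|Dom J ` Arr J| <o \<kappa>"
    using assms unfolding small_category_def by (blast intro: card_of_image_less)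
  ultimately show ?thesis by (rule card_of_subset_less[rotated])
qed

section \<open>Presheaves generated over a small subcategory\<close>

lemma kappa_saturatedD:
  assumes "kappa_saturated \<Omega> \<kappa> \<Phi>" "\<omega> \<in> members_on \<Phi> J"
  shows "small_category \<kappa> J" "presheaf \<Omega> J \<omega>" "j \<in> Obj J \<Longrightarrow> |On_obj \<omega> j| <o \<kappa>"
  using assms
  unfolding kappa_saturated_def small_presented_class_def members_on_def small_presheaf_def by auto

lemma small_category_locally_small:
  assumes "small_category \<kappa> D" "\<kappa> \<le>o \<Omega>"
  shows "locally_small \<Omega> D"
proof -
  have "|hom D x y| <o \<kappa>" for x y
    using card_of_subset_less[of "Arr D" \<kappa> "hom D x y"] assms(1)
    unfolding small_category_def hom_def by blast
  then show ?thesis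
    using assms ordLess_ordLeq_trans unfolding locally_small_def small_category_def by blast
qed

text \<open>The only way in which saturation enters: a \<open>\<kappa>\<close>-small presheaf built by iterated \<open>\<Phi>\<close>-colimits is
  already in \<open>\<Phi>\<close>.\<close>

lemma kappa_saturatedI:
  assumes "kappa_saturated \<Omega> \<kappa> \<Phi>" "\<kappa> \<le>o \<Omega>" "small_presheaf \<kappa> D \<psi>" "\<psi> \<in> colimit_closure \<Omega> \<Phi> D"
  shows "\<psi> \<in> members_on \<Phi> D"
proof -
  have "locally_small \<Omega> D"
    using small_category_locally_small assms(2,3) unfolding small_presheaf_def by blast
  then have "(D, \<psi>) \<in> small_part \<kappa> (saturation \<Omega> \<Phi>)"
    using assms(3,4) unfolding small_part_def saturation_def by blast
  then show ?thesis using assms(1) unfolding kappa_saturated_def members_on_def by blast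
qed

text \<open>This gives one direction of the theorem, and also shows over a smaller base category that the presheaves \<open>S j\<close>
  lie in the closure.\<close>

lemma left_kan_extension_in_colimit_closure:
  assumes ls: "locally_small \<Omega> C" and sub: "subcategory D C" and psi: "\<psi> \<in> members_on \<Phi> D"
    and lan: "is_left_kan_extension (op_cat D) (op_cat C) (set_cat \<Omega>) (incl_functor (op_cat D)) \<psi> \<phi>"
  shows "\<phi> \<in> colimit_closure \<Omega> \<Phi> C"
proof (rule colimit_closure.colimit[OF psi])
  show "is_functor D (psh_cat \<Omega> C) (comp_functor D (yoneda C) (incl_functor D))"
    by (rule functor_comp[OF subcategoryD(1)[OF sub] incl_functor_functor[OF sub] yoneda_functor[OF ls]])
  show "On_obj (comp_functor D (yoneda C) (incl_functor D)) d \<in> colimit_closure \<Omega> \<Phi> C" if "d \<in> Obj D" for d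
    using subcategoryD(2)[OF sub that] that colimit_closure.yoneda
    by (simp add: comp_functor_def incl_functor_def yoneda_def)
  show "is_weighted_colimit D (psh_cat \<Omega> C) \<psi> (comp_functor D (yoneda C) (incl_functor D)) \<phi>"
    by (rule left_kan_extension_imp_weighted_colimit[OF ls sub lan])
qed

definition kan_generated :: "'u rel \<Rightarrow> 'u psh_class \<Rightarrow> ('u, 'u) cat \<Rightarrow> 'u psh \<Rightarrow> bool" where
  "kan_generated \<kappa> \<Phi> C \<phi> \<longleftrightarrow> (\<exists>D \<psi> e. subcategory D C \<and> small_category \<kappa> D \<and> \<psi> \<in> members_on \<Phi> D \<and>
     pointwise_lan C D \<psi> \<phi> e)"

text \<open>The representable of \<open>c\<close> is generated by its universal element over the subcategory with the single
  arrow \<open>Idn C c\<close>.\<close>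

lemma kan_generated_representable:
  assumes reg: "regular_cardinal \<kappa>" and le: "\<kappa> \<le>o \<Omega>"
    and ks: "kappa_saturated \<Omega> \<kappa> \<Phi>" and C: "category C" and c: "c \<in> Obj C"
  shows "kan_generated \<kappa> \<Phi> C (yoneda_obj C c)"
proof -
  interpret C: category C by fact
  note idc = C.Idn_in[OF c]
  define D where "D = \<lparr>Obj = {c}, Arr = {Idn C c}, Dom = Dom C, Cod = Cod C, Idn = Idn C, Cmp = Cmp C\<rparr>"
  have hD: "f \<in> hom D x y \<longleftrightarrow> f = Idn C c \<and> x = c \<and> y = c" for f x y
    using idc by (auto simp: hom_def D_def)
  have cD: "category D"
    using idc C.Cmp_Idn_left[OF idc] by unfold_locales (auto simp: hD, auto simp: D_def hom_def)
  have sub: "subcategory D C" using cD idc c by (auto simp: subcategory_def D_def hom_def)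
  have sm: "small_category \<kappa> D"
    using cD card_of_finite_less[OF reg, of "{Idn C c}"] by (simp add: small_category_def D_def)
  have o: "On_obj (yoneda_obj D c) c = {Idn C c}" "Obj D = {c}"
    using hD[of _ c c] by (auto simp: yoneda_obj_def D_def[of ])
  have "yoneda_obj D c \<in> members_on \<Phi> D"
    by (rule kappa_saturatedI[OF ks le])
      (use sm o card_of_finite_less[OF reg, of "{Idn C c}"] colimit_closure.yoneda[of c D] in \<open>auto simp: small_presheaf_def\<close>)
  moreover have "pointwise_lan C D (yoneda_obj D c) (yoneda_obj C c) (\<lambda>d s. s)"
    unfolding pointwise_lan_def
  proof (intro conjI ballI allI impI)
    have r: "restriction (yoneda_obj C c) h (Idn C c) = h" if "h \<in> hom C x c" for h x
      using yoneda_obj_restriction[OF that idc] C.Cmp_Idn_left[OF that] by simp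
    show "s \<in> On_obj (yoneda_obj C c) d" if "d \<in> Obj D" "s \<in> On_obj (yoneda_obj D c) d" for d s
      using that o idc c by (simp add: yoneda_obj_obj)
    show "restriction (yoneda_obj D c) u s = restriction (yoneda_obj C c) u s"
      if u: "u \<in> hom D d d'" and s: "s \<in> On_obj (yoneda_obj D c) d'" for u d d' s
    proof -
      have "u = Idn C c" "d = c" "d' = c" "s = Idn C c" using u s o by (auto simp: hD)
      then show ?thesis
        using r[OF idc] yoneda_obj_restriction[of "Idn C c" D c c "Idn C c" c] C.Cmp_Idn_left[OF idc]
        by (simp add: hD) (simp add: D_def)
    qed
    show "\<exists>d\<in>Obj D. \<exists>h\<in>hom C x d. \<exists>s\<in>On_obj (yoneda_obj D c) d. y = restriction (yoneda_obj C c) h s"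
      if x: "x \<in> Obj C" and y: "y \<in> On_obj (yoneda_obj C c) x" for x y
      using r[of y x] y x o by (simp add: yoneda_obj_obj) metis
    show "((h, s), (h', s')) \<in> zigzag (lan_step C D (yoneda_obj D c))"
      if "h \<in> hom C x d" "h' \<in> hom C x d'" "d \<in> Obj D" "d' \<in> Obj D" "s \<in> On_obj (yoneda_obj D c) d"
        "s' \<in> On_obj (yoneda_obj D c) d'" "restriction (yoneda_obj C c) h s = restriction (yoneda_obj C c) h' s'"
      for x h h' d d' s s'
      using that r[of h x] r[of h' x] o by simp
  qed
  ultimately show ?thesis unfolding kan_generated_def using sub sm by blast
qed

text \<open>Composing the unit with the isomorphism suffices; \<open>D\<close> and \<open>\<psi>\<close> stay the same.\<close>

lemma kan_generated_isomorphic: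
  assumes C: "category C" and gen: "kan_generated \<kappa> \<Phi> C \<phi>"
    and iso: "isomorphic_in (psh_cat \<Omega> C) \<phi> \<phi>'"
  shows "kan_generated \<kappa> \<Phi> C \<phi>'"
proof -
  interpret C: category C by fact
  obtain D \<psi> e where D: "subcategory D C" "small_category \<kappa> D" "\<psi> \<in> members_on \<Phi> D"
    and pl: "pointwise_lan C D \<psi> \<phi> e"
    using gen unfolding kan_generated_def by blast
  interpret D: category D using subcategoryD(1)[OF D(1)] .
  obtain f g where f: "f \<in> hom (psh_cat \<Omega> C) \<phi> \<phi>'" and g: "g \<in> hom (psh_cat \<Omega> C) \<phi>' \<phi>"
    and gf: "Cmp (psh_cat \<Omega> C) g f = Idn (psh_cat \<Omega> C) \<phi>" and fg: "Cmp (psh_cat \<Omega> C) f g = Idn (psh_cat \<Omega> C) \<phi>'"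
    using iso unfolding isomorphic_in_def by blast
  have gfa: "nt_app g c (nt_app f c y) = y" if "c \<in> Obj C" "y \<in> On_obj \<phi> c" for c y
    using nt_app_Cmp[OF C f g that] gf nt_app_Idn[OF that, of \<Omega>] by simp
  have fga: "nt_app f c (nt_app g c y) = y" if "c \<in> Obj C" "y \<in> On_obj \<phi>' c" for c y
    using nt_app_Cmp[OF C g f that] fg nt_app_Idn[OF that, of \<Omega>] by simp
  note pl' = pointwise_lanD[OF pl] and dC = subcategoryD(2)[OF D(1)]
  have phi: "presheaf \<Omega> C \<phi>" using psh_homD(1)[OF C f] .
  have fr: "restriction \<phi>' h (nt_app f d (e d s)) = nt_app f c (restriction \<phi> h (e d s))"
    if "h \<in> hom C c d" "d \<in> Obj D" "s \<in> On_obj \<psi> d" for h c d s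
    using psh_homD(4)[OF C f that(1) pl'(1)[OF that(2,3)]] by simp
  have "pointwise_lan C D \<psi> \<phi>' (\<lambda>d s. nt_app f d (e d s))"
    unfolding pointwise_lan_def
  proof (intro conjI ballI allI impI)
    show "nt_app f d (e d s) \<in> On_obj \<phi>' d" if "d \<in> Obj D" "s \<in> On_obj \<psi> d" for d s
      using psh_homD(3)[OF C f dC[OF that(1)] pl'(1)[OF that]] .
    show "nt_app f d (e d (restriction \<psi> u s)) = restriction \<phi>' u (nt_app f d' (e d' s))"
      if u: "u \<in> hom D d d'" and s: "s \<in> On_obj \<psi> d'" for u d d' s
      using pl'(2)[OF u s] fr[OF subcategoryD(3)[OF D(1) u] D.hom_Obj(2)[OF u] s] by simp
    show "\<exists>d\<in>Obj D. \<exists>h\<in>hom C c d. \<exists>s\<in>On_obj \<psi> d. y = restriction \<phi>' h (nt_app f d (e d s))"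
      if c: "c \<in> Obj C" and y: "y \<in> On_obj \<phi>' c" for c y
      using pl'(3)[OF c psh_homD(3)[OF C g c y]] fga[OF c y] fr by metis
    show "((h, s), (h', s')) \<in> zigzag (lan_step C D \<psi>)"
      if h: "h \<in> hom C c d" "h' \<in> hom C c d'" and d: "d \<in> Obj D" "d' \<in> Obj D"
        and s: "s \<in> On_obj \<psi> d" "s' \<in> On_obj \<psi> d'"
        and eq: "restriction \<phi>' h (nt_app f d (e d s)) = restriction \<phi>' h' (nt_app f d' (e d' s'))"
      for c h h' d d' s s'
    proof (rule pl'(4)[OF h d s])
      have c: "c \<in> Obj C" using C.hom_Obj[OF h(1)] by blast
      show "restriction \<phi> h (e d s) = restriction \<phi> h' (e d' s')"
        using eq unfolding fr[OF h(1) d(1) s(1)] fr[OF h(2) d(2) s(2)]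
        using gfa[OF c restriction_in[OF C phi h(1) pl'(1)[OF d(1) s(1)]]]
          gfa[OF c restriction_in[OF C phi h(2) pl'(1)[OF d(2) s(2)]]] by metis
    qed
  qed
  then show ?thesis unfolding kan_generated_def using D by blast
qed

text \<open>The inductive step. The subcategory \<open>E\<close> is obtained by closing the arrows of all \<open>D j\<close>, together with
  arrows presenting the images of generators under the diagram, under the witnesses that the
  locale asks for; there are fewer than \<open>\<kappa>\<close> of them because \<open>J\<close>, the \<open>D j\<close>, \<open>\<omega>\<close> and the \<open>\<psi> j\<close> are
  \<open>\<kappa>\<close>-small.\<close>

lemma kan_generated_colimit:
  fixes \<Omega> \<kappa> :: "'u rel"
  assumes regO: "regular_cardinal \<Omega>" and reg: "regular_cardinal \<kappa>" and unc: "natLeq <o \<kappa>"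
    and le: "\<kappa> \<le>o \<Omega>" and ks: "kappa_saturated \<Omega> \<kappa> \<Phi>" and C: "category C"
    and om: "\<omega> \<in> members_on \<Phi> J" and F: "is_functor J (psh_cat \<Omega> C) F"
    and gen: "\<And>j. j \<in> Obj J \<Longrightarrow> kan_generated \<kappa> \<Phi> C (On_obj F j)"
    and col: "is_weighted_colimit J (psh_cat \<Omega> C) \<omega> F \<phi>"
  shows "kan_generated \<kappa> \<Phi> C \<phi>"
proof -
  interpret C: category C by fact
  note omD = kappa_saturatedD[OF ks om]
  have J: "category J" using omD(1) by (simp add: small_category_def)
  interpret J: category J by fact
  let ?I = "elements_cat J \<omega>" and ?G = "elements_diagram J \<omega> F"
  have I: "category ?I" by (rule category_elements_cat[OF J omD(2)])
  interpret I: category ?I by fact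
  have Gf: "is_functor ?I (psh_cat \<Omega> C) ?G" by (rule elements_diagram_functor[OF J omD(2) F])
  have IO: "Obj ?I = (SIGMA j : Obj J. On_obj \<omega> j)" by (auto simp: elements_cat_simps)
  have Ismall: "|Obj ?I| <o \<kappa>"
    unfolding IO by (rule card_of_Sigma_less[OF reg card_of_Obj_less[OF omD(1)] omD(3)])
  obtain \<mu> where mu: "is_cocone ?I (psh_cat \<Omega> C) ?G \<phi> \<mu>" and pw: "pointwise_colimit ?I C ?G \<phi> \<mu>"
    using colimit_imp_pointwise_colimit[OF regO C I ordLess_ordLeq_trans[OF Ismall le] Gf] col
    unfolding is_weighted_colimit_def by blast
  have "\<forall>j \<in> Obj J. \<exists>D \<psi> e. subcategory D C \<and> small_category \<kappa> D \<and> \<psi> \<in> members_on \<Phi> D \<and>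
     pointwise_lan C D \<psi> (On_obj F j) e"
    using gen unfolding kan_generated_def by blast
  then obtain D \<psi> e where D: "\<And>j. j \<in> Obj J \<Longrightarrow> subcategory (D j) C"
    and Ds: "\<And>j. j \<in> Obj J \<Longrightarrow> small_category \<kappa> (D j)"
    and psi: "\<And>j. j \<in> Obj J \<Longrightarrow> \<psi> j \<in> members_on \<Phi> (D j)"
    and pl: "\<And>j. j \<in> Obj J \<Longrightarrow> pointwise_lan C (D j) (\<psi> j) (On_obj F j) (e j)"
    by metis
  note psiD = kappa_saturatedD[OF ks psi]
  have Fo: "j \<in> Obj J \<Longrightarrow> presheaf \<Omega> C (On_obj F j)" for j
    by (rule functor_to_psh_catD(1)[OF F])
  have Fa: "On_arr F f \<in> hom (psh_cat \<Omega> C) (On_obj F j) (On_obj F j')" if "f \<in> hom J j j'" for f j j'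
    using functor_to_psh_catD(2)[OF F, of f] that by (simp add: hom_def[of J])
  have "\<forall>j \<in> Obj J. \<forall>c \<in> Obj C. \<forall>z \<in> On_obj (On_obj F j) c. \<exists>h. \<exists>d \<in> Obj (D j). h \<in> hom C c d \<and>
      (\<exists>s \<in> On_obj (\<psi> j) d. z = restriction (On_obj F j) h (e j d s))"
    using pointwise_lanD(3)[OF pl] by blast
  then obtain g where g: "\<And>j c z. j \<in> Obj J \<Longrightarrow> c \<in> Obj C \<Longrightarrow> z \<in> On_obj (On_obj F j) c \<Longrightarrow>
      \<exists>d \<in> Obj (D j). g j c z \<in> hom C c d \<and>
      (\<exists>s \<in> On_obj (\<psi> j) d. z = restriction (On_obj F j) (g j c z) (e j d s))"
    by metis
  \<comment> \<open>Finite sets of witnesses: of arrows for a zigzag over \<open>D j\<close>, and of elements for a zigzag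
    in the diagram. An element is turned into the arrow \<open>g\<close> of a presentation of it.\<close>
  define W1 where "W1 j p p' = (SOME W. finite W \<and> ((p, p') \<in> zigzag (lan_step C (D j) (\<psi> j)) \<longrightarrow>
     (p, p') \<in> zigzag {x \<in> lan_step C (D j) (\<psi> j). fst (snd x) \<in> W}))" for j p p'
  have W1: "finite (W1 j p p') \<and> ((p, p') \<in> zigzag (lan_step C (D j) (\<psi> j)) \<longrightarrow>
     (p, p') \<in> zigzag {x \<in> lan_step C (D j) (\<psi> j). fst (snd x) \<in> W1 j p p'})" for j p p'
    unfolding W1_def by (rule someI_ex[OF zigzag_finite_image_witness[where f = "\<lambda>x. fst (snd x)"]])
  define W2 where "W2 c p p' = (SOME W. finite W \<and> ((p, p') \<in> zigzag (colim_step ?I ?G c) \<longrightarrow>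
     (p, p') \<in> zigzag {x \<in> colim_step ?I ?G c. fst x \<in> W}))" for c p p'
  have W2: "finite (W2 c p p') \<and> ((p, p') \<in> zigzag (colim_step ?I ?G c) \<longrightarrow>
     (p, p') \<in> zigzag {x \<in> colim_step ?I ?G c. fst x \<in> W2 c p p'})" for c p p'
    unfolding W2_def by (rule someI_ex[OF zigzag_finite_image_witness[where f = fst]])
  \<comment> \<open>A copy of \<open>\<psi> j\<close> with empty values off \<open>D j\<close>, so that the witness sets below are small for arbitrary
    arrows.\<close>
  define P where "P j d = (if j \<in> Obj J \<and> d \<in> Obj (D j) then On_obj (\<psi> j) d else {})" for j d
  have Ps: "|P j d| <o \<kappa>" for j d
    using psiD(3) card_of_finite_less[OF reg] by (auto simp: P_def)
  define A where "A = (\<Union>j \<in> Obj J. Arr (D j)) \<union>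
    (\<Union>f \<in> Arr J. \<Union>d \<in> Obj (D (Dom J f)). \<Union>s \<in> On_obj (\<psi> (Dom J f)) d.
       {g (Cod J f) d (nt_app (On_arr F f) d (e (Dom J f) d s))})"
  have As: "|A| <o \<kappa>"
  proof -
    have a: "|Arr J| <o \<kappa>" "\<And>j. j \<in> Obj J \<Longrightarrow> |Arr (D j)| <o \<kappa>"
      using omD(1) Ds unfolding small_category_def by auto
    have s: "|{x}| <o \<kappa>" for x :: 'u using card_of_finite_less[OF reg, of "{x}"] by simp
    show ?thesis
      unfolding A_def
      by (intro card_of_Un_less card_of_UN_less reg a card_of_Obj_less[OF omD(1)]
          card_of_Obj_less[OF Ds] psiD(3) s J.Dom_in)
  qed
  have AC: "A \<subseteq> Arr C"
  proof -
    have "g (Cod J f) d (nt_app (On_arr F f) d (e (Dom J f) d s)) \<in> Arr C"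
      if "f \<in> Arr J" "d \<in> Obj (D (Dom J f))" "s \<in> On_obj (\<psi> (Dom J f)) d" for f d s
    proof -
      have f: "f \<in> hom J (Dom J f) (Cod J f)" using that by (simp add: hom_def)
      note j = J.hom_Obj[OF f] and d = subcategoryD(2)[OF D[OF J.hom_Obj(1)[OF f]] that(2)]
      show ?thesis
        using g[OF j(2) d psh_homD(3)[OF C Fa[OF f] d pointwise_lanD(1)[OF pl[OF j(1)] that(2,3)]]]
        by (auto simp: hom_def)
    qed
    then show ?thesis using D unfolding A_def subcategory_def by blast
  qed
  define W where "W h h' =
    (\<Union>j \<in> Obj J. \<Union>s \<in> P j (Cod C h). \<Union>s' \<in> P j (Cod C h'). W1 j (h, s) (h', s')) \<union>
    (\<Union>i \<in> Obj ?I. \<Union>i' \<in> Obj ?I. \<Union>s \<in> P (fst i) (Cod C h). \<Union>s' \<in> P (fst i') (Cod C h').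
       (\<lambda>(k, y). g (fst k) (Dom C h) y) ` W2 (Dom C h)
         (i, restriction (On_obj F (fst i)) h (e (fst i) (Cod C h) s))
         (i', restriction (On_obj F (fst i')) h' (e (fst i') (Cod C h') s')))" for h h'
  have Ws: "|W h h'| <o \<kappa>" for h h'
    unfolding W_def
    by (intro card_of_Un_less card_of_UN_less reg Ps card_of_Obj_less[OF omD(1)] Ismall
        card_of_finite_less finite_imageI conjunct1[OF W1] conjunct1[OF W2])
  obtain E where E: "subcategory E C" and Es: "small_category \<kappa> E" and AE: "A \<subseteq> Arr E"
    and cl: "\<And>h h'. h \<in> Arr E \<Longrightarrow> h' \<in> Arr E \<Longrightarrow> W h h' \<inter> Arr C \<subseteq> Arr E"
    using ex_small_witness_closed_subcategory[OF C reg unc AC As, of W] Ws by blast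
  have homE: "f \<in> hom E x y" if "f \<in> hom C x y" "f \<in> Arr E" for f x y
    using that E unfolding subcategory_def hom_def by auto
  note EC = subcategoryD(2,3)[OF E]
  have arrows: "Arr (D j) \<subseteq> Arr E" if "j \<in> Obj J" for j
    using AE that unfolding A_def by blast
  have DE: "subcategory (D j) E" if "j \<in> Obj J" for j
    using subcategory_subcategory[OF D[OF that] E arrows[OF that]] .
  let ?S = "\<lambda>j. image_psh E (D j) (\<psi> j) (On_obj F j) (e j)"
  have inS: "z \<in> On_obj (?S j) c"
    if j: "j \<in> Obj J" and c: "c \<in> Obj E" and z: "z \<in> On_obj (On_obj F j) c" and gE: "g j c z \<in> Arr E" for j c z
    using g[OF j EC(1)[OF c] z] homE[OF _ gE] unfolding image_psh_obj[OF c] by blast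
  interpret GD: generated_diagram \<Omega> C J \<omega> F \<phi> \<mu> D \<psi> e E
  proof
    fix j c h h' d d' s s'
    assume j: "j \<in> Obj J" and h: "h \<in> hom E c d" "h' \<in> hom E c d'" and d: "d \<in> Obj (D j)" "d' \<in> Obj (D j)"
      and s: "s \<in> On_obj (\<psi> j) d" "s' \<in> On_obj (\<psi> j) d'"
      and eq: "restriction (On_obj F j) h (e j d s) = restriction (On_obj F j) h' (e j d' s')"
    let ?W = "W1 j (h, s) (h', s')"
    have "s \<in> P j (Cod C h)" "s' \<in> P j (Cod C h')"
      using s d j homD(3)[OF EC(2)[OF h(1)]] homD(3)[OF EC(2)[OF h(2)]] by (simp_all add: P_def)
    then have "?W \<subseteq> W h h'" unfolding W_def using j by blast
    then have WE: "?W \<inter> Arr C \<subseteq> Arr E" using cl[OF homD(1)[OF h(1)] homD(1)[OF h(2)]] by blast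
    have "((h, s), (h', s')) \<in> zigzag {x \<in> lan_step C (D j) (\<psi> j). fst (snd x) \<in> ?W}"
      by (rule conjunct2[OF W1, THEN mp, OF pointwise_lanD(4)[OF pl[OF j] EC(2)[OF h(1)] EC(2)[OF h(2)] d s eq]])
    then show "((h, s), (h', s')) \<in> zigzag (lan_step E (D j) (\<psi> j))"
    proof (rule zigzag_mono)
      have "{x \<in> lan_step C (D j) (\<psi> j). fst (snd x) \<in> ?W} \<subseteq> {x \<in> lan_step C (D j) (\<psi> j). fst (snd x) \<in> Arr E}"
        using WE unfolding lan_step_def by auto
      then show "{x \<in> lan_step C (D j) (\<psi> j). fst (snd x) \<in> ?W} \<subseteq> lan_step E (D j) (\<psi> j)"
        using lan_step_subcategory[OF E DE[OF j]] by blast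
    qed
  next
    fix f j j' d s assume f: "f \<in> hom J j j'" and d: "d \<in> Obj (D j)" and s: "s \<in> On_obj (\<psi> j) d"
    note j = J.hom_Obj[OF f] and dE = subcategoryD(2)[OF DE[OF J.hom_Obj(1)[OF f]] d]
    have "g j' d (nt_app (On_arr F f) d (e j d s)) \<in> A"
      unfolding A_def using f d s by (auto simp: hom_def[of J])
    then show "nt_app (On_arr F f) d (e j d s) \<in> On_obj (?S j') d"
      using AE psh_homD(3)[OF C Fa[OF f] EC(1)[OF dE] pointwise_lanD(1)[OF pl[OF j(1)] d s]]
      by (intro inS[OF j(2) dE]) auto
  next
    fix c i i' z z'
    assume c: "c \<in> Obj E" and i: "i \<in> Obj ?I" "i' \<in> Obj ?I"
      and z: "z \<in> On_obj (?S (fst i)) c" "z' \<in> On_obj (?S (fst i')) c"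
      and cn: "((i, z), (i', z')) \<in> zigzag (colim_step ?I ?G c)"
    obtain h d s where h: "h \<in> hom E c d" "d \<in> Obj (D (fst i))" "s \<in> On_obj (\<psi> (fst i)) d"
      and zh: "z = restriction (On_obj F (fst i)) h (e (fst i) d s)"
      using z(1) unfolding image_psh_obj[OF c] by blast
    obtain h' d' s' where h': "h' \<in> hom E c d'" "d' \<in> Obj (D (fst i'))" "s' \<in> On_obj (\<psi> (fst i')) d'"
      and zh': "z' = restriction (On_obj F (fst i')) h' (e (fst i') d' s')"
      using z(2) unfolding image_psh_obj[OF c] by blast
    have cd: "Cod C h = d" "Cod C h' = d'" "Dom C h = c" using homD[OF EC(2)[OF h(1)]] homD[OF EC(2)[OF h'(1)]] by auto
    have sP: "s \<in> P (fst i) d" "s' \<in> P (fst i') d'" using h h' i by (auto simp: P_def IO)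
    have "(\<lambda>(k, y). g (fst k) c y) ` W2 c (i, z) (i', z') \<subseteq> W h h'"
      unfolding W_def cd zh zh'
      by (rule le_supI2, rule SUP_upper2[OF i(1)], rule SUP_upper2[OF i(2)], rule SUP_upper2[OF sP(1)],
          rule SUP_upper2[OF sP(2)], rule order_refl)
    then have gE: "g (fst k) c y \<in> Arr E" if "(k, y) \<in> W2 c (i, z) (i', z')" "g (fst k) c y \<in> Arr C" for k y
      using cl[OF homD(1)[OF h(1)] homD(1)[OF h'(1)]] that by auto
    show "((i, z), (i', z')) \<in> zigzag {((k, a), q) \<in> colim_step ?I ?G c. a \<in> On_obj (?S (fst k)) c}"
    proof (rule zigzag_mono[OF conjunct2[OF W2, THEN mp, OF cn]], clarify)
      fix k y k' y' assume st: "((k, y), (k', y')) \<in> colim_step ?I ?G c" and "fst ((k, y), (k', y')) \<in> W2 c (i, z) (i', z')"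
      then have w: "(k, y) \<in> W2 c (i, z) (i', z')" by simp
      obtain a where a: "a \<in> Arr ?I" "k = Dom ?I a" and y: "y \<in> On_obj (On_obj ?G k) c"
        using st unfolding colim_step_def by blast
      have k: "k \<in> Obj ?I" using I.Dom_in[OF a(1)] a(2) by simp
      have kJ: "fst k \<in> Obj J" using k by (auto simp: IO)
      have y': "y \<in> On_obj (On_obj F (fst k)) c"
        using y k by (cases k) (simp add: elements_diagram_simps IO)
      have "g (fst k) c y \<in> Arr C" using g[OF kJ EC(1)[OF c] y'] by (auto simp: hom_def)
      then show "y \<in> On_obj (?S (fst k)) c" by (rule inS[OF kJ c y' gE[OF w]])
    qed
  qed (use arrows in \<open>simp_all add: C J omD(2) F mu pw D pl E\<close>)
  have Els: "locally_small \<Omega> E" by (rule small_category_locally_small[OF Es le])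
  have Scl: "GD.S j \<in> colimit_closure \<Omega> \<Phi> E" if j: "j \<in> Obj J" for j
    by (rule left_kan_extension_in_colimit_closure[OF Els DE[OF j] psi[OF j]],
        rule pointwise_lan_imp_left_kan_extension[OF GD.E.category_axioms DE[OF j] psiD(2)[OF j]
          GD.S_presheaf[OF j] GD.S_pointwise_lan[OF j]])
  have Tcl: "GD.T \<in> colimit_closure \<Omega> \<Phi> E"
    by (rule colimit_closure.colimit[OF om GD.SF_functor _ GD.T_weighted_colimit])
      (simp add: GD.SF_obj Scl)
  have "|On_obj GD.T c| <o \<kappa>" if c: "c \<in> Obj E" for c
  proof -
    have Ss: "|On_obj (GD.S j) c| <o \<kappa>" if j: "j \<in> Obj J" for j
    proof -
      have "On_obj (GD.S j) c \<subseteq> (\<Union>h \<in> Arr E. \<Union>s \<in> P j (Cod C h). {restriction (On_obj F j) h (e j (Cod C h) s)})"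
      proof
        fix z assume "z \<in> On_obj (GD.S j) c"
        then obtain h d s where "h \<in> hom E c d" "d \<in> Obj (D j)" "s \<in> On_obj (\<psi> j) d"
          "z = restriction (On_obj F j) h (e j d s)"
          unfolding GD.S_obj[OF c] by blast
        then show "z \<in> (\<Union>h \<in> Arr E. \<Union>s \<in> P j (Cod C h). {restriction (On_obj F j) h (e j (Cod C h) s)})"
          using j homD(1)[of h E c d] homD(3)[OF EC(2), of h c d] by (auto simp: P_def)
      qed
      moreover have "|\<Union>h \<in> Arr E. \<Union>s \<in> P j (Cod C h). {restriction (On_obj F j) h (e j (Cod C h) s)}| <o \<kappa>"
      proof (intro card_of_UN_less reg Ps)
        show "|Arr E| <o \<kappa>" using Es by (simp add: small_category_def)
        show "|{x}| <o \<kappa>" for x :: 'u using card_of_finite_less[OF reg, of "{x}"] by simp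
      qed
      ultimately show ?thesis by (rule card_of_subset_less[rotated])
    qed
    have "On_obj GD.T c \<subseteq> (\<Union>i \<in> Obj ?I. nt_app (\<mu> i) c ` On_obj (GD.S (fst i)) c)"
      using GD.T_obj[OF c] unfolding GD.I_def by blast
    moreover have "|\<Union>i \<in> Obj ?I. nt_app (\<mu> i) c ` On_obj (GD.S (fst i)) c| <o \<kappa>"
      by (intro card_of_UN_less reg Ismall card_of_image_less Ss) (auto simp: IO)
    ultimately show ?thesis by (rule card_of_subset_less[rotated])
  qed
  then have "GD.T \<in> members_on \<Phi> E"
    using kappa_saturatedI[OF ks le _ Tcl] Es unfolding small_presheaf_def by blast
  then show ?thesis
    unfolding kan_generated_def using E Es GD.T_pointwise_lan by blast
qed

lemma colimit_closure_kan_generated: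
  fixes \<Omega> \<kappa> :: "'u rel"
  assumes "regular_cardinal \<Omega>" "regular_cardinal \<kappa>" "natLeq <o \<kappa>" "\<kappa> \<le>o \<Omega>"
    and "kappa_saturated \<Omega> \<kappa> \<Phi>" and "category C" and "\<phi> \<in> colimit_closure \<Omega> \<Phi> C"
  shows "kan_generated \<kappa> \<Phi> C \<phi>"
  using assms(7)
proof (induction rule: colimit_closure.induct)
  case (yoneda c)
  then show ?case by (rule kan_generated_representable[OF assms(2,4-6)])
next
  case (replete \<phi> \<phi>')
  then show ?case using kan_generated_isomorphic[OF assms(6)] by blast
next
  case (colimit \<omega> J F \<phi>)
  then show ?case using kan_generated_colimit[OF assms(1-6)] by blast
qed

theorem corollary4p9:
  fixes \<Omega> \<kappa> :: "'u rel" and \<Phi> \<Psi> :: "'u psh_class"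
    and C :: "('u, 'u) cat" and \<phi> :: "'u psh"
  assumes "regular_cardinal \<Omega>"
    and "regular_cardinal \<kappa>" and "natLeq <o \<kappa>" and "\<kappa> \<le>o \<Omega>"
    and "saturated \<Omega> \<Psi>" and "\<Phi> = small_part \<kappa> \<Psi>" and "kappa_saturated \<Omega> \<kappa> \<Phi>"
    and "locally_small \<Omega> C" and "presheaf \<Omega> C \<phi>"
  shows "(\<phi> \<in> members_on (saturation \<Omega> \<Phi>) C \<longleftrightarrow>
      (\<exists>D \<psi>. subcategory D C \<and> small_category \<kappa> D \<and> \<psi> \<in> members_on \<Phi> D \<and>
        is_left_kan_extension (op_cat D) (op_cat C) (set_cat \<Omega>) (incl_functor (op_cat D)) \<psi> \<phi>))
    \<and> (\<forall>D \<psi>. subcategory D C \<and> small_category \<kappa> D \<and> \<psi> \<in> members_on \<Phi> D \<and>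
        is_left_kan_extension (op_cat D) (op_cat C) (set_cat \<Omega>) (incl_functor (op_cat D)) \<psi> \<phi> \<longrightarrow>
        is_weighted_colimit D (psh_cat \<Omega> C) \<psi> (comp_functor D (yoneda C) (incl_functor D)) \<phi>)"
proof (intro conjI iffI allI impI)
  have C: "category C" using assms(8) by (simp add: locally_small_def)
  assume "\<phi> \<in> members_on (saturation \<Omega> \<Phi>) C"
  then have "\<phi> \<in> colimit_closure \<Omega> \<Phi> C" by (simp add: members_on_def saturation_def)
  then have "kan_generated \<kappa> \<Phi> C \<phi>"
    by (rule colimit_closure_kan_generated[OF assms(1-4,7) C])
  then obtain D \<psi> e where D: "subcategory D C" "small_category \<kappa> D" "\<psi> \<in> members_on \<Phi> D"
    and pl: "pointwise_lan C D \<psi> \<phi> e"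
    unfolding kan_generated_def by blast
  then show "\<exists>D \<psi>. subcategory D C \<and> small_category \<kappa> D \<and> \<psi> \<in> members_on \<Phi> D \<and>
      is_left_kan_extension (op_cat D) (op_cat C) (set_cat \<Omega>) (incl_functor (op_cat D)) \<psi> \<phi>"
    using pointwise_lan_imp_left_kan_extension[OF C D(1) kappa_saturatedD(2)[OF assms(7) D(3)] assms(9) pl]
    by blast
next
  assume "\<exists>D \<psi>. subcategory D C \<and> small_category \<kappa> D \<and> \<psi> \<in> members_on \<Phi> D \<and>
      is_left_kan_extension (op_cat D) (op_cat C) (set_cat \<Omega>) (incl_functor (op_cat D)) \<psi> \<phi>"
  then have "\<phi> \<in> colimit_closure \<Omega> \<Phi> C"
    using left_kan_extension_in_colimit_closure[OF assms(8)] by blast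
  then show "\<phi> \<in> members_on (saturation \<Omega> \<Phi>) C"
    using assms(8) by (simp add: members_on_def saturation_def)
next
  fix D \<psi>
  assume "subcategory D C \<and> small_category \<kappa> D \<and> \<psi> \<in> members_on \<Phi> D \<and>
      is_left_kan_extension (op_cat D) (op_cat C) (set_cat \<Omega>) (incl_functor (op_cat D)) \<psi> \<phi>"
  then show "is_weighted_colimit D (psh_cat \<Omega> C) \<psi> (comp_functor D (yoneda C) (incl_functor D)) \<phi>"
    using left_kan_extension_imp_weighted_colimit[OF assms(8)] by blast
qed

end
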